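(* Let $R,S\in\mathscr{A}$ be two symmetries with $\tau(R)=\alpha$, $\tau(S)=\beta$, and let $(U_t)_{t\ge 0}$ be a free unitary Brownian motion freely independent from $\{R,S\}$. Put $f_n(t):=\tau\left[(RU_tSU_t^* )^n\right]$ for $n\ge 1$, $t\ge 0$. Then $$\partial_t f_1=-f_1+\alpha\beta,$$ and for every $n\ge 2$, $$\partial_t f_n=-nf_n-n\sum_{k=1}^{n-1}f_kf_{n-k}+\begin{cases} n^2\alpha\beta & \text{if } n \text{ is odd},\\ n^2\,\dfrac{\alpha^2+\beta^2}{2} & \text{if } n\text{ is even}.\end{cases}$$
   Context: $(\mathscr{A},\tau)$ is a $W^*$-probability space (von Neumann algebra with faithful normal tracial state $\tau$). A symmetry is a self-adjoint unitary. A free unitary Brownian motion $(U_t)_{t\ge0}$ in $(\mathscr{A},\tau)$ with $U_0=\mathbf 1$ is the solution of the free stochastic differential equation $dU_t=iU_t\,dB_t-\tfrac12U_t\,dt$, where $(B_t)$ is a free additive (semicircular) Brownian motion with $\tau(B_t^2)=t$. *)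

theory Defs
  imports "HOL-Analysis.Analysis"
begin

section \<open>Complex Hilbert spaces and their bounded operators\<close>

text \<open>The norm, metric and completeness are those of the underlying real Hilbert space;
  the real inner product is the real part of the complex one, which is linear in its second
  argument.\<close>

class complex_hilbert_space = real_inner + complete_space +
  fixes scaleC :: "complex \<Rightarrow> 'a \<Rightarrow> 'a" (infixr "*\<^sub>C" 75)
    and cinner :: "'a \<Rightarrow> 'a \<Rightarrow> complex"
  assumes scaleC_add_right: "c *\<^sub>C (x + y) = c *\<^sub>C x + c *\<^sub>C y"
    and scaleC_add_left: "(c + d) *\<^sub>C x = c *\<^sub>C x + d *\<^sub>C x"
    and scaleC_scaleC: "c *\<^sub>C (d *\<^sub>C x) = (c * d) *\<^sub>C x"
    and scaleR_scaleC: "scaleR r x = of_real r *\<^sub>C x"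
    and cinner_commute: "cinner x y = cnj (cinner y x)"
    and cinner_add_right: "cinner x (y + z) = cinner x y + cinner x z"
    and cinner_scaleC_right: "cinner x (c *\<^sub>C y) = c * cinner x y"
    and inner_eq_Re_cinner: "inner x y = Re (cinner x y)"

lemma cinner_self:
  fixes x :: "'a::complex_hilbert_space"
  shows "cinner x x = of_real ((norm x)\<^sup>2)"
proof -
  have "Im (cinner x x) = - Im (cinner x x)"
    using cinner_commute[of x x] by (metis cnj.simps(2))
  then show ?thesis
    by (simp add: complex_eq_iff power2_norm_eq_inner inner_eq_Re_cinner)
qed

lemma norm_scaleC:
  fixes x :: "'a::complex_hilbert_space"
  shows "norm (c *\<^sub>C x) = cmod c * norm x"
proof -
  have "cinner (c *\<^sub>C x) (c *\<^sub>C x) = c * (cnj c * cinner x x)"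
    by (metis cinner_commute cinner_scaleC_right complex_cnj_mult complex_cnj_cnj)
  also have "\<dots> = of_real ((cmod c * norm x)\<^sup>2)"
    by (simp add: cinner_self power_mult_distrib complex_norm_square
        flip: mult.assoc del: of_real_power)
  finally have "(norm (c *\<^sub>C x))\<^sup>2 = (cmod c * norm x)\<^sup>2"
    by (metis cinner_self of_real_eq_iff)
  then show ?thesis
    by (simp add: power2_eq_iff_nonneg)
qed

typedef (overloaded) ('h::complex_hilbert_space) bop =
  "{A :: 'h \<Rightarrow>\<^sub>L 'h. \<forall>c x. blinfun_apply A (c *\<^sub>C x) = c *\<^sub>C blinfun_apply A x}"
proof
  show "id_blinfun \<in> {A :: 'h \<Rightarrow>\<^sub>L 'h. \<forall>c x. A (c *\<^sub>C x) = c *\<^sub>C A x}"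
    by simp
qed

setup_lifting type_definition_bop

lift_definition bop_apply :: "'h::complex_hilbert_space bop \<Rightarrow> 'h \<Rightarrow> 'h"
  is "blinfun_apply" .

lemma scaleC_zero_right: "c *\<^sub>C (0 :: 'a::complex_hilbert_space) = 0"
  using norm_scaleC[of c 0] by simp

lemma scaleC_minus_right: "c *\<^sub>C (- x :: 'a::complex_hilbert_space) = - (c *\<^sub>C x)"
  by (metis scaleC_add_right scaleC_zero_right add.right_inverse neg_eq_iff_add_eq_0)

lemma scaleC_scaleR_commute:
  "c *\<^sub>C (r *\<^sub>R x :: 'a::complex_hilbert_space) = r *\<^sub>R (c *\<^sub>C x)"
  by (simp add: scaleR_scaleC scaleC_scaleC mult.commute)

text \<open>The bounded complex-linear operators, with composition as product and the operator norm.
  The axiom \<open>0 \<noteq> 1\<close> of \<open>ring_1\<close> fails in general, since the Hilbert space may be zero.\<close>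

instantiation bop :: (complex_hilbert_space) "{real_normed_algebra, monoid_mult}"
begin

lift_definition zero_bop :: "'a bop" is 0
  by (simp add: scaleC_zero_right)

lift_definition one_bop :: "'a bop" is id_blinfun
  by simp

lift_definition plus_bop :: "'a bop \<Rightarrow> 'a bop \<Rightarrow> 'a bop" is "(+)"
  by (simp add: blinfun.add_left scaleC_add_right)

lift_definition uminus_bop :: "'a bop \<Rightarrow> 'a bop" is uminus
  by (simp add: blinfun.minus_left scaleC_minus_right)

lift_definition minus_bop :: "'a bop \<Rightarrow> 'a bop \<Rightarrow> 'a bop" is "(-)"
  by (metis (no_types, lifting) blinfun.diff_left diff_conv_add_uminus
      scaleC_add_right scaleC_minus_right)

lift_definition times_bop :: "'a bop \<Rightarrow> 'a bop \<Rightarrow> 'a bop" is "(o\<^sub>L)"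
  by simp

lift_definition scaleR_bop :: "real \<Rightarrow> 'a bop \<Rightarrow> 'a bop" is "(*\<^sub>R)"
  by (simp add: blinfun.scaleR_left scaleC_scaleR_commute)

lift_definition norm_bop :: "'a bop \<Rightarrow> real" is norm .

definition "dist_bop (A :: 'a bop) B = norm (A - B)"

definition "sgn_bop (A :: 'a bop) = inverse (norm A) *\<^sub>R A"

definition [code del]:
  "(uniformity :: ('a bop \<times> 'a bop) filter) = (INF e\<in>{0 <..}. principal {(x, y). dist x y < e})"

definition open_bop :: "'a bop set \<Rightarrow> bool"
  where [code del]:
    "open_bop S = (\<forall>x\<in>S. \<forall>\<^sub>F (x', y) in uniformity. x' = x \<longrightarrow> y \<in> S)"

instance
proof
  fix A B C :: "'a bop" and r s :: real
  show "A + B + C = A + (B + C)" "A + B = B + A" "0 + A = A" "- A + A = 0" "A - B = A + - B"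
    by (transfer, simp)+
  show "r *\<^sub>R (A + B) = r *\<^sub>R A + r *\<^sub>R B" "(r + s) *\<^sub>R A = r *\<^sub>R A + s *\<^sub>R A"
    "r *\<^sub>R s *\<^sub>R A = (r * s) *\<^sub>R A" "1 *\<^sub>R A = A"
    by (transfer, simp add: algebra_simps)+
  show "A * B * C = A * (B * C)" "(A + B) * C = A * C + B * C" "A * (B + C) = A * B + A * C"
    "r *\<^sub>R A * B = r *\<^sub>R (A * B)" "A * r *\<^sub>R B = r *\<^sub>R (A * B)" "1 * A = A" "A * 1 = A"
    by (transfer, rule blinfun_eqI,
        simp add: blinfun.add_left blinfun.add_right blinfun.scaleR_left blinfun.scaleR_right)+
  show "dist A B = norm (A - B)" "sgn A = inverse (norm A) *\<^sub>R A"
    by (simp_all add: dist_bop_def sgn_bop_def)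
  show "(uniformity :: ('a bop \<times> 'a bop) filter) = (INF e\<in>{0 <..}. principal {(x, y). dist x y < e})"
    by (rule uniformity_bop_def)
  show "open S = (\<forall>x\<in>S. \<forall>\<^sub>F (x', y) in uniformity. x' = x \<longrightarrow> y \<in> S)" for S :: "'a bop set"
    by (rule open_bop_def)
  show "(norm A = 0) = (A = 0)" "norm (A + B) \<le> norm A + norm B"
    "norm (r *\<^sub>R A) = \<bar>r\<bar> * norm A"
    by (transfer, simp add: norm_triangle_ineq)+
  show "norm (A * B) \<le> norm A * norm B"
    by (transfer, rule norm_blinfun_compose)
qed

end

lemma bounded_linear_scaleC_blinfun:
  fixes A :: "'a::real_normed_vector \<Rightarrow>\<^sub>L 'h::complex_hilbert_space"
  shows "bounded_linear (\<lambda>x. c *\<^sub>C blinfun_apply A x)"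
proof (rule bounded_linear_intro)
  show "norm (c *\<^sub>C A x) \<le> norm x * (cmod c * norm A)" for x
    using mult_left_mono[OF norm_blinfun[of A x], of "cmod c"]
    by (simp add: norm_scaleC mult_ac)
qed (simp_all add: blinfun.add_right blinfun.scaleR_right scaleC_add_right
    scaleC_scaleR_commute)

lift_definition scale_bop :: "complex \<Rightarrow> 'h::complex_hilbert_space bop \<Rightarrow> 'h bop"
  is "\<lambda>c A. Blinfun (\<lambda>x. c *\<^sub>C blinfun_apply A x)"
  by (simp add: bounded_linear_Blinfun_apply bounded_linear_scaleC_blinfun scaleC_scaleC
      mult.commute)

text \<open>The Hilbert space adjoint; it exists by the Riesz representation theorem.\<close>

definition adj :: "'h::complex_hilbert_space bop \<Rightarrow> 'h bop"
  where "adj A = (THE B. \<forall>x y. cinner (bop_apply B x) y = cinner x (bop_apply A y))"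

definition symmetry :: "'h::complex_hilbert_space bop \<Rightarrow> bool"
  where "symmetry R \<longleftrightarrow> adj R = R \<and> adj R * R = 1 \<and> R * adj R = 1"


section \<open>Von Neumann algebras and \<open>W\<^sup>*\<close>-probability spaces\<close>

definition commutant :: "'h::complex_hilbert_space bop set \<Rightarrow> 'h bop set"
  where "commutant X = {A. \<forall>B\<in>X. A * B = B * A}"

definition von_neumann_algebra :: "'h::complex_hilbert_space bop set \<Rightarrow> bool"
  where "von_neumann_algebra M \<longleftrightarrow>
    (\<forall>A\<in>M. adj A \<in> M) \<and> commutant (commutant M) = M"

text \<open>The usual order on self-adjoint operators.\<close>

definition bop_le :: "'h::complex_hilbert_space bop \<Rightarrow> 'h bop \<Rightarrow> bool"
  where "bop_le A B \<longleftrightarrow> (\<forall>x. Re (cinner x (bop_apply A x)) \<le> Re (cinner x (bop_apply B x)))"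

definition self_adjoint_part :: "'h::complex_hilbert_space bop set \<Rightarrow> 'h bop set"
  where "self_adjoint_part M = {A \<in> M. adj A = A}"

text \<open>Normality says that \<open>\<tau>\<close> preserves the supremum of every increasing net that is bounded
  above; nets are given by their ranges, the upward directed sets \<open>D\<close>.\<close>

locale wstar_probability_space =
  fixes M :: "'h::complex_hilbert_space bop set"
    and \<tau> :: "'h bop \<Rightarrow> complex"
  assumes von_neumann: "von_neumann_algebra M"
    and add: "A \<in> M \<Longrightarrow> B \<in> M \<Longrightarrow> \<tau> (A + B) = \<tau> A + \<tau> B"
    and scale: "A \<in> M \<Longrightarrow> \<tau> (scale_bop c A) = c * \<tau> A"
    and unit: "\<tau> 1 = 1"
    and positive: "A \<in> M \<Longrightarrow> \<tau> (adj A * A) \<in> \<real>\<^sub>\<ge>\<^sub>0"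
    and faithful: "A \<in> M \<Longrightarrow> \<tau> (adj A * A) = 0 \<Longrightarrow> A = 0"
    and tracial: "A \<in> M \<Longrightarrow> B \<in> M \<Longrightarrow> \<tau> (A * B) = \<tau> (B * A)"
    and normal: "D \<subseteq> self_adjoint_part M \<Longrightarrow> D \<noteq> {} \<Longrightarrow>
        (\<forall>A\<in>D. \<forall>B\<in>D. \<exists>C\<in>D. bop_le A C \<and> bop_le B C) \<Longrightarrow>
        S \<in> self_adjoint_part M \<Longrightarrow>
        (\<forall>A\<in>D. bop_le A S) \<Longrightarrow>
        (\<forall>T\<in>self_adjoint_part M. (\<forall>A\<in>D. bop_le A T) \<longrightarrow> bop_le S T) \<Longrightarrow>
        Re (\<tau> S) = (SUP A\<in>D. Re (\<tau> A))"

definition L2_norm :: "('h::complex_hilbert_space bop \<Rightarrow> complex) \<Rightarrow> 'h bop \<Rightarrow> real"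
  where "L2_norm \<tau> A = sqrt (Re (\<tau> (adj A * A)))"


section \<open>Free independence\<close>

inductive_set star_algebra_generated ::
    "'h::complex_hilbert_space bop set \<Rightarrow> 'h bop set"
  for X where
  gen: "A \<in> X \<Longrightarrow> A \<in> star_algebra_generated X"
| one: "1 \<in> star_algebra_generated X"
| add: "A \<in> star_algebra_generated X \<Longrightarrow> B \<in> star_algebra_generated X \<Longrightarrow>
    A + B \<in> star_algebra_generated X"
| mult: "A \<in> star_algebra_generated X \<Longrightarrow> B \<in> star_algebra_generated X \<Longrightarrow>
    A * B \<in> star_algebra_generated X"
| scale: "A \<in> star_algebra_generated X \<Longrightarrow> scale_bop c A \<in> star_algebra_generated X"
| adj: "A \<in> star_algebra_generated X \<Longrightarrow> adj A \<in> star_algebra_generated X"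

text \<open>Centred elements of the generated unital \<open>*\<close>-algebras, consecutive factors being taken
  from different algebras, have a product of trace zero. In a word \<open>w\<close> each letter is tagged
  with the algebra it comes from.\<close>

definition free_family ::
    "('h::complex_hilbert_space bop \<Rightarrow> complex) \<Rightarrow> 'i set \<Rightarrow> ('i \<Rightarrow> 'h bop set) \<Rightarrow> bool"
  where "free_family \<tau> I X \<longleftrightarrow>
    (\<forall>w. w \<noteq> [] \<and> distinct_adj (map fst w) \<and>
      (\<forall>(i, A)\<in>set w. i \<in> I \<and> A \<in> star_algebra_generated (X i) \<and> \<tau> A = 0) \<longrightarrow>
      \<tau> (prod_list (map snd w)) = 0)"

definition freely_independent ::
    "('h::complex_hilbert_space bop \<Rightarrow> complex) \<Rightarrow> 'h bop set \<Rightarrow> 'h bop set \<Rightarrow> bool"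
  where "freely_independent \<tau> X Y \<longleftrightarrow>
    free_family \<tau> (UNIV :: bool set) (\<lambda>b. if b then X else Y)"


section \<open>Free Brownian motions\<close>

text \<open>A self-adjoint \<open>A\<close> whose moments are those of the semicircle law of mean \<open>0\<close> and
  variance \<open>v > 0\<close>.\<close>

definition semicircular ::
    "('h::complex_hilbert_space bop \<Rightarrow> complex) \<Rightarrow> real \<Rightarrow> 'h bop \<Rightarrow> bool"
  where "semicircular \<tau> v A \<longleftrightarrow> adj A = A \<and>
    (\<forall>n. \<tau> (A ^ n) = of_real
      (integral {- 2 * sqrt v .. 2 * sqrt v} (\<lambda>x. x ^ n * sqrt (4 * v - x\<^sup>2) / (2 * pi * v))))"

definition filtration ::
    "'h::complex_hilbert_space bop set \<Rightarrow> (real \<Rightarrow> 'h bop set) \<Rightarrow> bool"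
  where "filtration M F \<longleftrightarrow>
    (\<forall>t\<ge>0. von_neumann_algebra (F t) \<and> F t \<subseteq> M) \<and>
    (\<forall>s t. 0 \<le> s \<and> s \<le> t \<longrightarrow> F s \<subseteq> F t)"

definition free_brownian_motion ::
    "('h::complex_hilbert_space bop \<Rightarrow> complex) \<Rightarrow> (real \<Rightarrow> 'h bop set) \<Rightarrow> (real \<Rightarrow> 'h bop) \<Rightarrow> bool"
  where "free_brownian_motion \<tau> F B \<longleftrightarrow>
    B 0 = 0 \<and>
    (\<forall>t\<ge>0. B t \<in> F t \<and> adj (B t) = B t) \<and>
    (\<forall>s t. 0 \<le> s \<and> s < t \<longrightarrow>
      semicircular \<tau> (t - s) (B t - B s) \<and> freely_independent \<tau> {B t - B s} (F s))"

text \<open>The free stochastic integral \<open>\<integral>\<^sub>0\<^sup>t X\<^sub>s dB\<^sub>s\<close>. A list \<open>P\<close> of triples \<open>(a, b, Y)\<close> stands for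
  the simple process \<open>\<Sum> Y 1\<^bsub>[a,b)\<^esub>\<close>, adapted if \<open>Y\<close> belongs to the algebra at the left end
  point, and its integral is \<open>\<Sum> Y (B\<^sub>b - B\<^sub>a)\<close>. The integral of \<open>X\<close> is the
  \<open>L\<^sup>2(\<tau>)\<close>-limit of the integrals of adapted simple processes converging to \<open>X\<close> in
  \<open>L\<^sup>2([0,t]; L\<^sup>2(\<tau>))\<close>; by the free Ito isometry it does not depend on their choice.\<close>

definition simple_adapted ::
    "(real \<Rightarrow> 'h::complex_hilbert_space bop set) \<Rightarrow> real \<Rightarrow> (real \<times> real \<times> 'h bop) list \<Rightarrow> bool"
  where "simple_adapted F t P \<longleftrightarrow>
    (\<forall>(a, b, Y)\<in>set P. 0 \<le> a \<and> a \<le> b \<and> b \<le> t \<and> Y \<in> F a)"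

definition simple_process ::
    "(real \<times> real \<times> 'h::complex_hilbert_space bop) list \<Rightarrow> real \<Rightarrow> 'h bop"
  where "simple_process P s = (\<Sum>(a, b, Y)\<leftarrow>P. indicator {a..<b} s *\<^sub>R Y)"

definition simple_integral ::
    "(real \<Rightarrow> 'h::complex_hilbert_space bop) \<Rightarrow> (real \<times> real \<times> 'h bop) list \<Rightarrow> 'h bop"
  where "simple_integral B P = (\<Sum>(a, b, Y)\<leftarrow>P. Y * (B b - B a))"

definition has_free_stochastic_integral ::
    "('h::complex_hilbert_space bop \<Rightarrow> complex) \<Rightarrow> (real \<Rightarrow> 'h bop set) \<Rightarrow> (real \<Rightarrow> 'h bop) \<Rightarrow>
      (real \<Rightarrow> 'h bop) \<Rightarrow> real \<Rightarrow> 'h bop \<Rightarrow> bool"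
  where "has_free_stochastic_integral \<tau> F B X t Z \<longleftrightarrow>
    Z \<in> F t \<and>
    (\<exists>P e. (\<forall>n. simple_adapted F t (P n)) \<and>
      (\<forall>n::nat. ((\<lambda>s. (L2_norm \<tau> (simple_process (P n) s - X s))\<^sup>2) has_integral e n) {0..t}) \<and>
      e \<longlonglongrightarrow> 0 \<and>
      (\<lambda>n. L2_norm \<tau> (simple_integral B (P n) - Z)) \<longlonglongrightarrow> 0)"

text \<open>The equation \<open>dU\<^sub>t = i U\<^sub>t dB\<^sub>t - \<onehalf> U\<^sub>t dt\<close>, \<open>U\<^sub>0 = 1\<close>, in integrated form, for a
  norm-continuous adapted process. Unitarity of \<open>U\<^sub>t\<close> is a consequence.\<close>

definition free_unitary_SDE ::
    "('h::complex_hilbert_space bop \<Rightarrow> complex) \<Rightarrow> (real \<Rightarrow> 'h bop set) \<Rightarrow> (real \<Rightarrow> 'h bop) \<Rightarrow>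
      (real \<Rightarrow> 'h bop) \<Rightarrow> bool"
  where "free_unitary_SDE \<tau> F B U \<longleftrightarrow>
    continuous_on {0..} U \<and> (\<forall>t\<ge>0. U t \<in> F t) \<and>
    (\<forall>t\<ge>0. \<exists>Z D. has_free_stochastic_integral \<tau> F B U t Z \<and> (U has_integral D) {0..t} \<and>
      U t = 1 + scale_bop \<i> Z - (1/2) *\<^sub>R D)"

definition free_unitary_brownian_motion ::
    "'h::complex_hilbert_space bop set \<Rightarrow> ('h bop \<Rightarrow> complex) \<Rightarrow> (real \<Rightarrow> 'h bop) \<Rightarrow> bool"
  where "free_unitary_brownian_motion M \<tau> U \<longleftrightarrow>
    (\<exists>F B. filtration M F \<and> free_brownian_motion \<tau> F B \<and> free_unitary_SDE \<tau> F B U)"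

end

(* Fix t and write V = U_t^* U_u for u > t close to t. Conjugating by U_t turns the n-th moment at
   time u into the trace of (R' V S V^* )^n with R' = U_t^* R U_t, which is expanded to second order
   in V - 1. The Ito isometry shows that V - 1 is i (B_u - B_t) up to an error of smaller order in
   L^2, and B_u - B_t is free from the past; norm continuity of U disposes of the third order terms.
   The symmetries R, S are not assumed free from B, only from U. Hence traces of words in R', S, V
   are first reduced, by freeness of {R, S} from U, to traces of elements of the algebra generated
   by U, in which the coefficients of V - 1 lie in the past. This gives the right derivative of the
   moments; as it is continuous, it is the derivative. *)
theory Submission
  imports Defs
begin

section \<open>Bounded operators on a complex Hilbert space\<close>

subsection \<open>Riesz representation and adjoints\<close>

text \<open>Two kinds of freeness compete. Increments of \<open>B\<close> are free from
  \<open>F t\<close>, while \<open>R\<close> and \<open>S\<close> are free only from the process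
  \<open>U\<close> and need not lie in \<open>F t\<close>; so in a trace of the form
  \<open>p * Y * q * Y\<close>, with \<open>p\<close> and \<open>q\<close> words in
  \<open>R'\<close> and \<open>S\<close>, neither freeness applies at once. What reconciles them is
  an increment that lies in the algebra of \<open>U\<close> and is exactly orthogonal to its past:
  \<open>V u\<close> minus the scalar \<open>exp (- (u - t) / 2)\<close>, its conditional mean. The
  increment of \<open>B\<close> only approximates it in \<open>L2\<close>. Orthogonality lets
  \<open>p\<close> and \<open>q\<close> be exchanged for elements of the past of \<open>U\<close>;
  then the increment of \<open>B\<close> may take over. On the scale \<open>1 / sqrt (u - t)\<close>
  two increments together give a finite limit, with signs \<open>\<i> * \<i> = - 1\<close> and
  \<open>\<i> * - \<i> = 1\<close>. The coefficients with an odd number of letters collapse by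
  \<open>R * R = 1\<close> and \<open>S * S = 1\<close> to the traces of \<open>R\<close> and
  \<open>S\<close>, and counting them produces the constant terms with factor
  \<open>n^2\<close>.\<close>

text \<open>The representing vector minimises the functional
  \<open>x \<mapsto> \<parallel>x\<parallel>\<^sup>2 - 2 \<phi> x\<close>; the parallelogram law makes every minimising sequence Cauchy.\<close>

lemma riesz_representation_real:
  fixes \<phi> :: "'a::{real_inner,complete_space} \<Rightarrow> real"
  assumes "bounded_linear \<phi>"
  obtains z where "\<And>y. \<phi> y = inner z y"
proof -
  interpret \<phi>: bounded_linear \<phi> by fact
  obtain K where K: "\<And>x. norm (\<phi> x) \<le> norm x * K" "K \<ge> 0"
    using \<phi>.nonneg_bounded by blast
  define J where "J x = (norm x)\<^sup>2 - 2 * \<phi> x" for x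
  have J_lower: "J x \<ge> - K\<^sup>2" for x
  proof -
    have "\<phi> x \<le> norm x * K" using K(1)[of x] by simp
    moreover have "(norm x - K)\<^sup>2 \<ge> 0" by simp
    ultimately show ?thesis by (simp add: J_def power2_eq_square algebra_simps)
  qed
  have bdd: "bdd_below (range J)"
    using J_lower by (intro bdd_belowI[of _ "- K\<^sup>2"]) auto
  define m where "m = (INF x. J x)"
  have m_le: "m \<le> J x" for x
    unfolding m_def by (rule cINF_lower[OF bdd]) simp
  have "\<exists>x. J x < m + 1 / Suc n" for n
    using cInf_lessD[of "range J" "m + 1 / Suc n"] by (auto simp: m_def)
  then obtain X where X: "\<And>n. J (X n) < m + 1 / Suc n" by metis
  have para: "(norm (x - y))\<^sup>2 = 2 * J x + 2 * J y - 4 * J ((1/2) *\<^sub>R (x + y))" for x y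
  proof -
    have "norm ((1/2) *\<^sub>R (x + y)) = norm (x + y) / 2" "\<phi> ((1/2) *\<^sub>R (x + y)) = (\<phi> x + \<phi> y) / 2"
      by (simp_all add: \<phi>.scaleR \<phi>.add del: scaleR_add_right)
    then have "4 * J ((1/2) *\<^sub>R (x + y)) = (norm (x + y))\<^sup>2 - 4 * \<phi> x - 4 * \<phi> y"
      by (simp add: J_def power_divide del: scaleR_add_right)
    then show ?thesis
      by (simp add: J_def power2_norm_eq_inner inner_add_left inner_add_right inner_diff_left
          inner_diff_right inner_commute)
  qed
  have close: "(norm (X i - X j))\<^sup>2 \<le> 4 / Suc N" if "N \<le> i" "N \<le> j" for i j N
  proof -
    have "1 / real (Suc i) \<le> 1 / Suc N" "1 / real (Suc j) \<le> 1 / Suc N"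
      using that by (auto intro!: divide_left_mono)
    then show ?thesis
      using para[of "X i" "X j"] X[of i] X[of j] m_le[of "(1/2) *\<^sub>R (X i + X j)"]
      by linarith
  qed
  have "Cauchy X"
  proof (rule CauchyI)
    fix e :: real assume e: "e > 0"
    obtain N where N: "real N > 4 / e\<^sup>2"
      using reals_Archimedean2 by blast
    have "4 / real (Suc N) < e\<^sup>2"
    proof -
      have "4 < N * e\<^sup>2" using N e by (simp add: divide_less_eq)
      also have "\<dots> \<le> Suc N * e\<^sup>2" by (intro mult_right_mono) auto
      finally show ?thesis by (simp add: divide_less_eq mult.commute)
    qed
    then have "norm (X i - X j) < e" if "N \<le> i" "N \<le> j" for i j
      using close[OF that] e by (intro power_less_imp_less_base[of _ 2 e]) simp_all
    then show "\<exists>N. \<forall>i\<ge>N. \<forall>j\<ge>N. norm (X i - X j) < e"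
      by blast
  qed
  then obtain z where z: "X \<longlonglongrightarrow> z"
    using Cauchy_convergent convergent_def by blast
  have "(\<lambda>n. J (X n)) \<longlonglongrightarrow> J z"
    unfolding J_def by (intro tendsto_intros z \<phi>.tendsto)
  moreover have "(\<lambda>n. m + 1 / Suc n) \<longlonglongrightarrow> m + 0"
    by (intro tendsto_add tendsto_const LIMSEQ_Suc[OF lim_1_over_n])
  ultimately have "J z \<le> m + 0"
    by (rule LIMSEQ_le) (use X less_imp_le in blast)
  then have min: "J z \<le> J y" for y
    using m_le[of y] by simp
  have "\<phi> y = inner z y" for y
  proof (rule ccontr)
    assume ne: "\<phi> y \<noteq> inner z y"
    define d where "d = inner z y - \<phi> y"
    have d0: "d \<noteq> 0" using ne by (simp add: d_def)
    then have y0: "y \<noteq> 0" by (auto simp: d_def \<phi>.zero)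
    \<comment> \<open>The vertex of the parabola \<open>J (z + s *\<^sub>R y)\<close> in
      \<open>s\<close>; for \<open>d \<noteq> 0\<close> its value lies below
      \<open>J z\<close>.\<close>
    define s where "s = - d / (norm y)\<^sup>2"
    have "(norm (z + s *\<^sub>R y))\<^sup>2 = (norm z)\<^sup>2 + 2 * s * inner z y + s\<^sup>2 * (norm y)\<^sup>2"
      unfolding power2_norm_eq_inner
      by (simp add: inner_add_left inner_add_right inner_commute[of y z] power2_eq_square
          algebra_simps)
    then have "J (z + s *\<^sub>R y) = J z + 2 * s * d + s\<^sup>2 * (norm y)\<^sup>2"
      by (simp add: J_def d_def \<phi>.add \<phi>.scaleR algebra_simps)
    moreover have "2 * s * d + s\<^sup>2 * (norm y)\<^sup>2 = - (d\<^sup>2 / (norm y)\<^sup>2)"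
      using y0 by (simp add: s_def power2_eq_square field_simps)
    moreover have "d\<^sup>2 / (norm y)\<^sup>2 > 0" using d0 y0 by simp
    ultimately have "J (z + s *\<^sub>R y) < J z" by linarith
    then show False using min[of "z + s *\<^sub>R y"] by simp
  qed
  then show thesis by (rule that)
qed

lemma cinner_add_left: "cinner (x + y) z = cinner x z + cinner y z"
  by (metis cinner_add_right cinner_commute complex_cnj_add)

lemma cinner_scaleC_left: "cinner (c *\<^sub>C x) y = cnj c * cinner x y"
  by (metis cinner_commute cinner_scaleC_right complex_cnj_mult)

text \<open>\<open>Re (\<i> * z) = - Im z\<close> recovers the imaginary part from the real inner
  product, so a real identity valid for all \<open>y\<close> extends to the complex one by also
  testing at \<open>\<i> *\<^sub>C y\<close>.\<close>

lemma cinner_eq_inner: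
  "cinner x y = Complex (inner x y) (- inner x (\<i> *\<^sub>C y))"
  by (simp add: complex_eq_iff inner_eq_Re_cinner cinner_scaleC_right)

lemma cinner_eqI: "(\<And>y. cinner x y = cinner x' y) \<Longrightarrow> x = x'"
  by (metis inner_eq_Re_cinner inner_commute vector_eq_rdot)

lemma bop_apply_add: "bop_apply A (x + y) = bop_apply A x + bop_apply A y"
  by transfer (simp add: blinfun.add_right)

lemma bop_apply_scaleR: "bop_apply A (r *\<^sub>R x) = r *\<^sub>R bop_apply A x"
  by transfer (simp add: blinfun.scaleR_right)

lemma bop_apply_scaleC: "bop_apply A (c *\<^sub>C x) = c *\<^sub>C bop_apply A x"
  by transfer simp

lemma norm_bop_apply: "norm (bop_apply A x) \<le> norm A * norm x"
  by transfer (rule norm_blinfun)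

lemma bop_eqI: "(\<And>x. bop_apply A x = bop_apply B x) \<Longrightarrow> A = B"
  by transfer (rule blinfun_eqI)

lemma bop_apply_times: "bop_apply (A * B) x = bop_apply A (bop_apply B x)"
  by transfer simp

lemma bop_apply_one: "bop_apply 1 x = x"
  by transfer simp

lemma bop_apply_plus: "bop_apply (A + B) x = bop_apply A x + bop_apply B x"
  by transfer (simp add: blinfun.add_left)

lemma bop_apply_scale_bop: "bop_apply (scale_bop c A) x = c *\<^sub>C bop_apply A x"
  by transfer (simp add: bounded_linear_Blinfun_apply bounded_linear_scaleC_blinfun)

lemma bop_apply_scaleR_left: "bop_apply (r *\<^sub>R A) x = r *\<^sub>R bop_apply A x"
  by transfer (simp add: blinfun.scaleR_left)

lemma norm_bop_le:
  assumes "\<And>x. norm (bop_apply A x) \<le> b * norm x" "b \<ge> 0"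
  shows "norm A \<le> b"
  using assms by transfer (simp add: norm_blinfun_bound)

lemma bop_of_fun:
  fixes f :: "'h::complex_hilbert_space \<Rightarrow> 'h"
  assumes "\<And>x y. f (x + y) = f x + f y" "\<And>c x. f (c *\<^sub>C x) = c *\<^sub>C f x"
    and "\<And>x. norm (f x) \<le> norm x * K"
  obtains B where "\<And>x. bop_apply B x = f x"
proof -
  have bl: "bounded_linear f"
    by (rule bounded_linear_intro[of _ K]) (use assms in \<open>auto simp: scaleR_scaleC\<close>)
  then have *: "blinfun_apply (Blinfun f) = f"
    by (rule bounded_linear_Blinfun_apply)
  have "Blinfun f \<in> {A. \<forall>c x. blinfun_apply A (c *\<^sub>C x) = c *\<^sub>C blinfun_apply A x}"
    using assms(2) by (simp add: *)
  then have "bop_apply (Abs_bop (Blinfun f)) x = f x" for x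
    by (simp add: bop_apply.rep_eq Abs_bop_inverse *)
  then show thesis by (rule that)
qed

text \<open>The real Riesz vector of \<open>y \<mapsto> inner x (bop_apply A y)\<close> already
  represents the complex form, because \<open>A\<close> commutes with \<open>\<i>\<close>; complex
  linearity of \<open>f\<close> then follows from uniqueness.\<close>

lemma adjoint_exists:
  fixes A :: "'h::complex_hilbert_space bop"
  obtains B where "\<And>x y. cinner (bop_apply B x) y = cinner x (bop_apply A y)"
proof -
  have "\<exists>z. \<forall>y. inner x (bop_apply A y) = inner z y" for x
  proof -
    have "bounded_linear (\<lambda>y. inner x (bop_apply A y))"
    proof (rule bounded_linear_intro)
      show "norm (inner x (bop_apply A y)) \<le> norm y * (norm x * norm A)" for y
      proof -
        have "\<bar>inner x (bop_apply A y)\<bar> \<le> norm x * norm (bop_apply A y)"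
          by (rule Cauchy_Schwarz_ineq2)
        also have "\<dots> \<le> norm x * (norm A * norm y)"
          by (intro mult_left_mono norm_bop_apply) simp
        finally show ?thesis by (simp add: mult_ac)
      qed
    qed (simp_all add: bop_apply_add bop_apply_scaleR inner_add_right)
    from riesz_representation_real[OF this] show ?thesis by metis
  qed
  then obtain f where f: "\<And>x y. inner x (bop_apply A y) = inner (f x) y" by metis
  have fc: "cinner (f x) y = cinner x (bop_apply A y)" for x y
    using f[of x y] f[of x "\<i> *\<^sub>C y"] by (simp add: cinner_eq_inner bop_apply_scaleC)
  have "f (x + y) = f x + f y" for x y
    by (rule cinner_eqI) (simp add: fc cinner_add_left)
  moreover have "f (c *\<^sub>C x) = c *\<^sub>C f x" for c x
    by (rule cinner_eqI) (simp add: fc cinner_scaleC_left)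
  moreover have "norm (f x) \<le> norm x * norm A" for x
  proof (cases "f x = 0")
    case False
    have "norm (f x) * norm (f x) = inner x (bop_apply A (f x))"
      by (simp add: f flip: power2_norm_eq_inner power2_eq_square)
    also have "\<dots> \<le> norm x * norm (bop_apply A (f x))"
      by (rule norm_cauchy_schwarz)
    also have "\<dots> \<le> norm x * (norm A * norm (f x))"
      by (intro mult_left_mono norm_bop_apply) simp
    finally have "norm (f x) * norm (f x) \<le> (norm x * norm A) * norm (f x)"
      by (simp add: mult_ac)
    then show ?thesis using False by simp
  qed simp
  ultimately obtain B where "\<And>x. bop_apply B x = f x"
    using bop_of_fun[of f] by metis
  with fc that show thesis by metis
qed

lemma cinner_adj: "cinner (bop_apply (adj A) x) y = cinner x (bop_apply A y)"
proof -
  obtain B where B: "\<And>x y. cinner (bop_apply B x) y = cinner x (bop_apply A y)"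
    using adjoint_exists by blast
  have "\<forall>x y. cinner (bop_apply (adj A) x) y = cinner x (bop_apply A y)"
    unfolding adj_def
  proof (rule theI)
    show "\<forall>x y. cinner (bop_apply B x) y = cinner x (bop_apply A y)" using B by simp
    show "C = B" if "\<forall>x y. cinner (bop_apply C x) y = cinner x (bop_apply A y)" for C
      using that B by (intro bop_eqI cinner_eqI) simp
  qed
  then show ?thesis by simp
qed

lemma adjI:
  assumes "\<And>x y. cinner (bop_apply B x) y = cinner x (bop_apply A y)"
  shows "adj A = B"
  by (rule bop_eqI, rule cinner_eqI) (simp add: assms cinner_adj)

lemma cinner_adj_right: "cinner x (bop_apply (adj A) y) = cinner (bop_apply A x) y"
  by (metis cinner_adj cinner_commute)

lemma adj_adj [simp]: "adj (adj A) = A"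
  by (rule adjI) (simp add: cinner_adj_right)

lemma adj_mult [simp]: "adj (A * B) = adj B * adj A"
  by (rule adjI) (simp add: bop_apply_times cinner_adj)

lemma adj_add [simp]: "adj (A + B) = adj A + adj B"
  by (rule adjI) (simp add: bop_apply_plus cinner_adj cinner_add_left cinner_add_right)

lemma adj_scale [simp]: "adj (scale_bop c A) = scale_bop (cnj c) (adj A)"
  by (rule adjI)
    (simp add: bop_apply_scale_bop cinner_adj cinner_scaleC_left cinner_scaleC_right)

lemma adj_one [simp]: "adj 1 = 1"
  by (rule adjI) (simp add: bop_apply_one)

lemma scaleR_eq_scale_bop: "r *\<^sub>R A = scale_bop (of_real r) A"
  by (rule bop_eqI) (simp add: bop_apply_scale_bop bop_apply_scaleR_left scaleR_scaleC)

lemma adj_scaleR [simp]: "adj (r *\<^sub>R A) = r *\<^sub>R adj A"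
  by (simp add: scaleR_eq_scale_bop)

lemma adj_zero [simp]: "adj 0 = 0"
  using adj_scaleR[of 0 1] by simp

lemma adj_uminus [simp]: "adj (- A) = - adj A"
  using adj_scaleR[of "-1" A] by simp

lemma adj_diff [simp]: "adj (A - B) = adj A - adj B"
  using adj_add[of A "- B"] by simp

lemma scale_bop_mult_left: "scale_bop c A * B = scale_bop c (A * B)"
  by (rule bop_eqI) (simp add: bop_apply_times bop_apply_scale_bop)

lemma scale_bop_mult_right: "A * scale_bop c B = scale_bop c (A * B)"
  by (rule bop_eqI) (simp add: bop_apply_times bop_apply_scale_bop bop_apply_scaleC)

lemma scale_bop_scale_bop: "scale_bop c (scale_bop d A) = scale_bop (c * d) A"
  by (rule bop_eqI) (simp add: bop_apply_scale_bop scaleC_scaleC)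

lemmas scale_bop_mult = scale_bop_mult_left scale_bop_mult_right scale_bop_scale_bop

lemma scale_bop_add_right: "scale_bop c (A + B) = scale_bop c A + scale_bop c B"
  by (rule bop_eqI) (simp add: bop_apply_scale_bop bop_apply_plus scaleC_add_right)

lemma scale_bop_one [simp]: "scale_bop 1 A = A"
  using scaleR_eq_scale_bop[of 1 A] by simp

lemma scale_bop_zero [simp]: "scale_bop 0 A = 0"
  using scaleR_eq_scale_bop[of 0 A] by simp

lemma scale_bop_neg_one: "scale_bop (- 1) A = - A"
  using scaleR_eq_scale_bop[of "-1" A] by simp

lemma scale_bop_minus_left: "scale_bop (- c) A = - scale_bop c A"
  by (metis mult_minus1 scale_bop_neg_one scale_bop_scale_bop)

lemma scale_bop_minus_right: "scale_bop c (- A) = - scale_bop c A"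
  by (metis mult.commute scale_bop_neg_one scale_bop_scale_bop)

lemma scale_bop_diff_right: "scale_bop c (A - B) = scale_bop c A - scale_bop c B"
  using scale_bop_add_right[of c A "- B"] by (simp add: scale_bop_minus_right)

lemma scale_bop_scaleR: "scale_bop c (r *\<^sub>R A) = r *\<^sub>R scale_bop c A"
  by (simp add: scaleR_eq_scale_bop scale_bop_scale_bop mult.commute)

lemma norm_adj [simp]: "norm (adj A) = norm A"
proof -
  have "norm (adj A) \<le> norm A" for A :: "'a bop"
  proof (rule norm_bop_le)
    fix x
    let ?y = "bop_apply (adj A) x"
    show "norm ?y \<le> norm A * norm x"
    proof (cases "?y = 0")
      case False
      have "norm ?y * norm ?y = inner ?y ?y"
        by (simp flip: power2_norm_eq_inner power2_eq_square)
      also have "\<dots> = inner x (bop_apply A ?y)"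
        by (simp add: inner_eq_Re_cinner cinner_adj)
      also have "\<dots> \<le> norm x * norm (bop_apply A ?y)"
        by (rule norm_cauchy_schwarz)
      also have "\<dots> \<le> norm x * (norm A * norm ?y)"
        by (intro mult_left_mono norm_bop_apply) simp
      finally have "norm ?y * norm ?y \<le> (norm A * norm x) * norm ?y"
        by (simp add: mult_ac)
      then show ?thesis using False by simp
    qed simp
  qed simp
  from this[of A] this[of "adj A"] show ?thesis by simp
qed

lemma norm_one_bop_le: "norm (1 :: 'h::complex_hilbert_space bop) \<le> 1"
  by (rule norm_bop_le) (simp_all add: bop_apply_one)

lemma bounded_linear_adj: "bounded_linear adj"
  by (rule bounded_linear_intro[of _ 1]) simp_all

subsection \<open>Completeness\<close>

instance complex_hilbert_space \<subseteq> banach ..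

text \<open>Serves the square root series and the integrals of \<open>U\<close>. A limit of
  complex-linear operators stays complex linear, since the condition is closed under pointwise
  limits.\<close>

instance bop :: (complex_hilbert_space) banach
proof
  fix X :: "nat \<Rightarrow> 'a bop"
  assume X: "Cauchy X"
  have dist: "dist (Rep_bop A) (Rep_bop B) = dist A B" for A B :: "'a bop"
    by (simp add: dist_norm norm_bop.rep_eq minus_bop.rep_eq)
  have "Cauchy (\<lambda>n. Rep_bop (X n))"
    using X by (simp add: Cauchy_def dist)
  then obtain L where L: "(\<lambda>n. Rep_bop (X n)) \<longlonglongrightarrow> L"
    using Cauchy_convergent convergent_def by blast
  have ev: "(\<lambda>n. blinfun_apply (Rep_bop (X n)) x) \<longlonglongrightarrow> blinfun_apply L x" for x
    by (intro tendsto_intros L)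
  have blC: "bounded_linear (\<lambda>y::'a. c *\<^sub>C y)" for c
    by (rule bounded_linear_intro[of _ "cmod c"])
      (simp_all add: scaleC_add_right scaleC_scaleR_commute norm_scaleC)
  have "blinfun_apply L (c *\<^sub>C x) = c *\<^sub>C blinfun_apply L x" for c x
  proof (rule LIMSEQ_unique)
    show "(\<lambda>n. blinfun_apply (Rep_bop (X n)) (c *\<^sub>C x)) \<longlonglongrightarrow> blinfun_apply L (c *\<^sub>C x)"
      by (rule ev)
    show "(\<lambda>n. blinfun_apply (Rep_bop (X n)) (c *\<^sub>C x)) \<longlonglongrightarrow> c *\<^sub>C blinfun_apply L x"
    proof -
      have "blinfun_apply (Rep_bop (X n)) (c *\<^sub>C x) = c *\<^sub>C blinfun_apply (Rep_bop (X n)) x" for n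
        using Rep_bop[of "X n"] by simp
      then show ?thesis
        using bounded_linear.tendsto[OF blC ev[of x]] by simp
    qed
  qed
  then have "Rep_bop (Abs_bop L) = L"
    by (simp add: Abs_bop_inverse)
  with L have "X \<longlonglongrightarrow> Abs_bop L"
    by (simp add: tendsto_dist_iff[of X] tendsto_dist_iff[of "\<lambda>n. Rep_bop (X n)"] flip: dist)
  then show "convergent X" by (auto simp: convergent_def)
qed

subsection \<open>Square roots by the binomial series\<close>

lemma norm_power_bop: "norm (A ^ Suc k) \<le> norm A ^ Suc k" for A :: "'h::complex_hilbert_space bop"
proof (induction k)
  case (Suc k)
  have "norm (A * A ^ Suc k) \<le> norm A * norm (A ^ Suc k)" by (rule norm_mult_ineq)
  also have "\<dots> \<le> norm A * norm A ^ Suc k" by (intro mult_left_mono Suc.IH) simp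
  finally show ?case by simp
qed simp

lemma norm_power_bop': "norm (A ^ k) \<le> norm A ^ k" for A :: "'h::complex_hilbert_space bop"
  by (cases k) (use norm_power_bop in \<open>auto simp: norm_one_bop_le\<close>)

lemma adj_power [simp]: "adj (A ^ k) = adj A ^ k"
  by (induction k) (simp_all add: power_commutes)

text \<open>The binomial series of \<open>(1 - x) ^ (1/2)\<close>. The commutation clause speaks of
  the powers of \<open>H\<close> so that it passes to the limit term by term; it will put
  \<open>C\<close> in the bicommutant of an algebra containing \<open>H\<close>.\<close>

lemma square_root_of_one_minus:
  fixes H :: "'h::complex_hilbert_space bop"
  assumes self: "adj H = H" and small: "norm H < 1"
  obtains C where "adj C = C" "C * C = 1 - H"
    "\<And>X. (\<And>k. X * H ^ k = H ^ k * X) \<Longrightarrow> X * C = C * X"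
proof -
  define a where "a k = ((1/2 :: real) gchoose k) *\<^sub>R (- H) ^ k" for k
  have norm_a: "summable (\<lambda>k. norm (a k))"
  proof (rule summable_comparison_test)
    have "summable (\<lambda>k. ((1/2 :: real) gchoose k) * (norm H) ^ k)"
      using gen_binomial_real[of "norm H" "1/2"] small by (simp add: sums_iff)
    \<comment> \<open>A natural exponent would give a polynomial, with infinite radius; for
      \<open>1/2\<close> the radius is exactly 1, and inside it convergence is absolute, as the
      Cauchy product requires.\<close>
    moreover have cr: "conv_radius (\<lambda>k. (1/2::real) gchoose k) = 1"
    proof -
      have "(1/2::real) \<notin> \<nat>"
      proof
        assume "(1/2::real) \<in> \<nat>"
        then obtain n where n: "1/2 = real n" by (auto elim: Nats_cases)
        then have "real (2 * n) = real 1" by simp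
        then have "2 * n = 1" using of_nat_eq_iff by blast
        then show False by presburger
      qed
      then show ?thesis by (simp add: conv_radius_gchoose)
    qed
    ultimately show "summable (\<lambda>k. norm (((1/2 :: real) gchoose k) * (norm H) ^ k))"
      using small by (intro abs_summable_in_conv_radius) (simp add: cr)
    show "\<exists>N. \<forall>n\<ge>N. norm (norm (a n)) \<le> norm (((1/2 :: real) gchoose n) * (norm H) ^ n)"
      using norm_power_bop'[of "- H"]
      by (auto simp: a_def abs_mult intro!: mult_left_mono)
  qed
  then have sm: "summable a" by (rule summable_norm_cancel)
  define C where "C = (\<Sum>k. a k)"
  have C: "a sums C" using sm by (simp add: C_def summable_sums)
  have "(\<lambda>k. adj (a k)) sums adj C"
    by (rule bounded_linear.sums[OF bounded_linear_adj C])
  moreover have "adj (a k) = a k" for k by (simp add: a_def self)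
  ultimately have "adj C = C" using C by (simp add: sums_unique2)
  moreover have "C * C = 1 - H"
  proof -
    have "(\<lambda>k. \<Sum>i\<le>k. a i * a (k - i)) sums (C * C)"
      unfolding C_def by (rule Cauchy_product_sums[OF norm_a norm_a])
    moreover have "(\<Sum>i\<le>k. a i * a (k - i)) = ((1::real) gchoose k) *\<^sub>R (- H) ^ k" for k
    proof -
      have "(\<Sum>i\<le>k. a i * a (k - i))
          = (\<Sum>i\<le>k. (((1/2 :: real) gchoose i) * ((1/2) gchoose (k - i))) *\<^sub>R (- H) ^ k)"
        by (intro sum.cong) (auto simp: a_def simp flip: power_add)
      also have "\<dots> = (\<Sum>i\<le>k. ((1/2 :: real) gchoose i) * ((1/2) gchoose (k - i))) *\<^sub>R (- H) ^ k"
        by (simp add: scaleR_sum_left)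
      \<comment> \<open>Vandermonde with \<open>1/2 + 1/2 = 1\<close>; the coefficient
        \<open>1 gchoose k\<close> vanishes from \<open>k = 2\<close> on.\<close>
      also have "(\<Sum>i\<le>k. ((1/2 :: real) gchoose i) * ((1/2) gchoose (k - i))) = 1 gchoose k"
        using gbinomial_Vandermonde[of "1/2::real" "1/2" k] by (simp add: atMost_atLeast0)
      finally show ?thesis .
    qed
    moreover have "(\<lambda>k. ((1::real) gchoose k) *\<^sub>R (- H) ^ k) sums
        (\<Sum>k\<in>{0,1}. ((1::real) gchoose k) *\<^sub>R (- H) ^ k)"
    proof (rule sums_finite)
      fix k :: nat assume "k \<notin> {0,1}"
      then have "1 < k" by (cases k) auto
      then have "(1::real) gchoose k = 0"
        using binomial_gbinomial[of 1 k, where 'a=real] by (simp add: binomial_eq_0)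
      then show "((1::real) gchoose k) *\<^sub>R (- H) ^ k = 0" by simp
    qed simp
    ultimately show ?thesis by (simp add: sums_unique2)
  qed
  moreover have "X * C = C * X" if X: "\<And>k. X * H ^ k = H ^ k * X" for X
  proof (rule sums_unique2)
    show "(\<lambda>k. X * a k) sums (X * C)"
      by (rule bounded_linear.sums[OF bounded_linear_mult_right C])
    have "X * (- H) ^ k = (- H) ^ k * X" for k
    proof -
      have "(- H) ^ k = H ^ k \<or> (- H) ^ k = - (H ^ k)"
        by (induction k) auto
      then show ?thesis using X[of k] by auto
    qed
    then have "X * a k = a k * X" for k by (simp add: a_def)
    then show "(\<lambda>k. X * a k) sums (C * X)"
      using bounded_linear.sums[OF bounded_linear_mult_left C, of X] by simp
  qed
  ultimately show thesis by (rule that)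
qed

section \<open>The tracial \<open>L\<^sup>2\<close> norm\<close>

locale star_algebra =
  fixes N :: "'h::complex_hilbert_space bop set"
  assumes one_closed [simp]: "1 \<in> N"
    and add_closed [simp]: "A \<in> N \<Longrightarrow> B \<in> N \<Longrightarrow> A + B \<in> N"
    and mult_closed [simp]: "A \<in> N \<Longrightarrow> B \<in> N \<Longrightarrow> A * B \<in> N"
    and scale_closed [simp]: "A \<in> N \<Longrightarrow> scale_bop c A \<in> N"
    and adj_closed [simp]: "A \<in> N \<Longrightarrow> adj A \<in> N"
begin

lemma scaleR_closed [simp]: "A \<in> N \<Longrightarrow> r *\<^sub>R A \<in> N"
  by (simp add: scaleR_eq_scale_bop)

lemma zero_closed [simp]: "0 \<in> N"
  using scaleR_closed[of 1 0] by simp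

lemma uminus_closed [simp]: "A \<in> N \<Longrightarrow> - A \<in> N"
  using scaleR_closed[of A "-1"] by simp

lemma diff_closed [simp]: "A \<in> N \<Longrightarrow> B \<in> N \<Longrightarrow> A - B \<in> N"
  using add_closed[of A "- B"] by simp

lemma power_closed [simp]: "A \<in> N \<Longrightarrow> A ^ k \<in> N"
  by (induction k) simp_all

lemma sum_closed [simp]: "(\<And>i. i \<in> I \<Longrightarrow> f i \<in> N) \<Longrightarrow> sum f I \<in> N"
  by (induction I rule: infinite_finite_induct) simp_all

lemma generated_subset: "X \<subseteq> N \<Longrightarrow> star_algebra_generated X \<subseteq> N"
proof
  fix A assume "X \<subseteq> N" "A \<in> star_algebra_generated X"
  from this(2,1) show "A \<in> N" by (induction rule: star_algebra_generated.induct) auto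
qed

end

lemma star_algebra_generated: "star_algebra (star_algebra_generated X)"
  by unfold_locales (auto intro: star_algebra_generated.intros)

lemma von_neumann_star_algebra:
  assumes "von_neumann_algebra N"
  shows "star_algebra N"
proof
  have adj: "\<And>A. A \<in> N \<Longrightarrow> adj A \<in> N" and bi: "commutant (commutant N) = N"
    using assms by (auto simp: von_neumann_algebra_def)
  have mem: "A \<in> N \<longleftrightarrow> (\<forall>B\<in>commutant N. A * B = B * A)" for A
    using bi by (auto simp: commutant_def)
  show "1 \<in> N" by (simp add: mem)
  show "adj A \<in> N" if "A \<in> N" for A by (rule adj[OF that])
  show "A + B \<in> N" if "A \<in> N" "B \<in> N" for A B
    using that by (simp add: mem distrib_left distrib_right)
  show "A * B \<in> N" if "A \<in> N" "B \<in> N" for A B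
    using that unfolding mem by (metis mult.assoc)
  show "scale_bop c A \<in> N" if "A \<in> N" for c A
    using that by (simp add: mem scale_bop_mult_left scale_bop_mult_right)
qed

lemma von_neumann_square_root:
  assumes "von_neumann_algebra N" "H \<in> N" "adj H = H" "norm H < 1"
  obtains C where "C \<in> N" "adj C = C" "C * C = 1 - H"
proof -
  obtain C where C: "adj C = C" "C * C = 1 - H"
    and comm: "\<And>X. (\<And>k. X * H ^ k = H ^ k * X) \<Longrightarrow> X * C = C * X"
    using square_root_of_one_minus[OF assms(3,4)] by blast
  have "C \<in> commutant (commutant N)"
    unfolding commutant_def[of "commutant N"]
  proof (intro CollectI ballI)
    fix X assume "X \<in> commutant N"
    then have "X * H ^ k = H ^ k * X" for k
      using star_algebra.power_closed[OF von_neumann_star_algebra, OF assms(1,2)]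
      by (simp add: commutant_def)
    then show "C * X = X * C" by (metis comm)
  qed
  then show thesis using that C assms(1) by (simp add: von_neumann_algebra_def)
qed

section \<open>The inner product of the trace and its inequalities\<close>

context wstar_probability_space
begin

sublocale star_algebra M
  by (rule von_neumann_star_algebra[OF von_neumann])

lemma trace_zero [simp]: "\<tau> 0 = 0"
  using scale[of 1 0] by simp

lemma trace_scaleR: "A \<in> M \<Longrightarrow> \<tau> (r *\<^sub>R A) = of_real r * \<tau> A"
  by (simp add: scaleR_eq_scale_bop scale)

lemma trace_uminus: "A \<in> M \<Longrightarrow> \<tau> (- A) = - \<tau> A"
  using scale[of A "-1"] by (simp add: scale_bop_neg_one)

lemma trace_diff: "A \<in> M \<Longrightarrow> B \<in> M \<Longrightarrow> \<tau> (A - B) = \<tau> A - \<tau> B"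
  using add[of A "- B"] by (simp add: trace_uminus)

lemma trace_sum: "(\<And>i. i \<in> I \<Longrightarrow> f i \<in> M) \<Longrightarrow> \<tau> (sum f I) = (\<Sum>i\<in>I. \<tau> (f i))"
  by (induction I rule: infinite_finite_induct) (simp_all add: add)

lemmas trace_linear = add trace_diff trace_uminus scale trace_scaleR unit

lemma trace_square_real:
  assumes "A \<in> M"
  shows "\<tau> (adj A * A) = of_real (Re (\<tau> (adj A * A)))" "Re (\<tau> (adj A * A)) \<ge> 0"
proof -
  obtain r where r: "\<tau> (adj A * A) = of_real r" "r \<ge> 0"
    using positive[OF assms] by (rule nonneg_Reals_cases)
  show "\<tau> (adj A * A) = of_real (Re (\<tau> (adj A * A)))" unfolding r(1) by simp
  show "Re (\<tau> (adj A * A)) \<ge> 0" unfolding r(1) by (simp add: r(2))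
qed

text \<open>Hermitian symmetry comes from positivity by polarisation:
  \<open>\<tau> (adj (B + 1) * (B + 1))\<close> is real, hence so is
  \<open>\<tau> B + \<tau> (adj B)\<close>, and this is read for \<open>A\<close> and for
  \<open>scale_bop \<i> A\<close>.\<close>

lemma trace_adj:
  assumes "A \<in> M"
  shows "\<tau> (adj A) = cnj (\<tau> A)"
proof -
  have im: "Im (\<tau> B + \<tau> (adj B)) = 0" if "B \<in> M" for B
  proof -
    have "Im (\<tau> (adj (B + 1) * (B + 1))) = 0"
      by (subst trace_square_real(1)) (use that in simp_all)
    moreover have "Im (\<tau> (adj B * B)) = 0"
      by (subst trace_square_real(1)) (use that in simp_all)
    ultimately show ?thesis
      using that by (simp add: distrib_left distrib_right trace_linear)
  qed
  have "Im (\<tau> A + \<tau> (adj A)) = 0" by (rule im[OF assms])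
  moreover have "Im (\<i> * \<tau> A - \<i> * \<tau> (adj A)) = 0"
    using im[of "scale_bop \<i> A"] assms by (simp add: trace_linear)
  ultimately show ?thesis by (simp add: complex_eq_iff)
qed

abbreviation "L2 \<equiv> L2_norm \<tau>"

lemma L2_norm_nonneg [simp]: "A \<in> M \<Longrightarrow> L2 A \<ge> 0"
  by (simp add: L2_norm_def trace_square_real(2))

lemma L2_norm_square: "A \<in> M \<Longrightarrow> of_real ((L2 A)\<^sup>2) = \<tau> (adj A * A)"
  by (simp add: L2_norm_def trace_square_real(2) flip: trace_square_real(1))

lemma L2_norm_square_Re: "A \<in> M \<Longrightarrow> (L2 A)\<^sup>2 = Re (\<tau> (adj A * A))"
  by (simp add: L2_norm_def trace_square_real(2))

lemma L2_norm_zero [simp]: "L2 0 = 0"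
  by (simp add: L2_norm_def)

lemma L2_norm_one [simp]: "L2 1 = 1"
  by (simp add: L2_norm_def unit)

lemma L2_norm_adj [simp]: "A \<in> M \<Longrightarrow> L2 (adj A) = L2 A"
  by (simp add: L2_norm_def tracial)

lemma L2_norm_scale:
  assumes "A \<in> M"
  shows "L2 (scale_bop c A) = cmod c * L2 A"
proof -
  have "complex_of_real ((L2 (scale_bop c A))\<^sup>2) = of_real ((cmod c * L2 A)\<^sup>2)"
    using assms by (simp add: L2_norm_square scale_bop_mult scale power_mult_distrib complex_norm_square mult_ac del: of_real_power)
  then have "(L2 (scale_bop c A))\<^sup>2 = (cmod c * L2 A)\<^sup>2"
    by (metis of_real_eq_iff)
  then show ?thesis using assms by (simp add: power2_eq_iff_nonneg)
qed

lemma L2_norm_scaleR: "A \<in> M \<Longrightarrow> L2 (r *\<^sub>R A) = \<bar>r\<bar> * L2 A"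
  by (simp add: scaleR_eq_scale_bop L2_norm_scale)

lemma L2_norm_uminus: "A \<in> M \<Longrightarrow> L2 (- A) = L2 A"
  using L2_norm_scaleR[of A "-1"] by simp

lemma L2_norm_minus_commute: "A \<in> M \<Longrightarrow> B \<in> M \<Longrightarrow> L2 (A - B) = L2 (B - A)"
  using L2_norm_uminus[of "A - B"] by simp

lemma L2_norm_eq_0: "A \<in> M \<Longrightarrow> L2 A = 0 \<Longrightarrow> A = 0"
  using faithful[of A] L2_norm_square[of A] by simp

lemma L2_Cauchy_Schwarz:
  assumes A: "A \<in> M" and B: "B \<in> M"
  shows "cmod (\<tau> (adj A * B)) \<le> L2 A * L2 B"
proof (cases "L2 B = 0")
  case True
  then show ?thesis using L2_norm_eq_0[OF B] by simp
next
  case False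
  define b where "b = (L2 B)\<^sup>2"
  define p where "p = \<tau> (adj A * B)"
  \<comment> \<open>The coefficient of the orthogonal projection of \<open>A\<close> onto
    \<open>B\<close>; the conjugate appears because the form is linear in its second
    argument.\<close>
  define l where "l = cnj p / of_real b"
  have b: "b > 0" using False B by (simp add: b_def)
  have q: "\<tau> (adj B * A) = cnj p"
    using A B trace_adj[of "adj A * B"] by (simp add: p_def)
  have "of_real ((L2 (A - scale_bop l B))\<^sup>2)
      = \<tau> (adj A * A) - l * p - cnj l * cnj p + l * cnj l * \<tau> (adj B * B)"
    using A B by (simp add: L2_norm_square trace_linear algebra_simps scale_bop_mult scale_bop_diff_right q flip: p_def
        del: of_real_power)
  also have "\<dots> = of_real ((L2 A)\<^sup>2 - (cmod p)\<^sup>2 / b)"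
  proof -
    have "\<tau> (adj B * B) = of_real b" "\<tau> (adj A * A) = of_real ((L2 A)\<^sup>2)"
      using A B by (simp_all add: L2_norm_square b_def del: of_real_power)
    then show ?thesis
      using b by (simp add: l_def complex_norm_square field_simps del: of_real_power)
  qed
  finally have "(L2 (A - scale_bop l B))\<^sup>2 = (L2 A)\<^sup>2 - (cmod p)\<^sup>2 / b"
    by (metis of_real_eq_iff)
  then have "(cmod p)\<^sup>2 / b \<le> (L2 A)\<^sup>2"
    by (metis diff_ge_0_iff_ge zero_le_power2)
  then have "(cmod p)\<^sup>2 \<le> (L2 A * L2 B)\<^sup>2"
    using b by (simp add: field_simps power_mult_distrib b_def)
  then have "cmod p \<le> L2 A * L2 B"
    by (rule power2_le_imp_le) (use A B in simp)
  then show ?thesis by (simp add: p_def)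
qed

lemma trace_mult_le:
  "A \<in> M \<Longrightarrow> B \<in> M \<Longrightarrow> cmod (\<tau> (A * B)) \<le> L2 A * L2 B"
  using L2_Cauchy_Schwarz[of "adj A" B] by simp

lemma L2_norm_triangle:
  assumes A: "A \<in> M" and B: "B \<in> M"
  shows "L2 (A + B) \<le> L2 A + L2 B"
proof -
  have "\<tau> (adj B * A) = cnj (\<tau> (adj A * B))"
    using A B trace_adj[of "adj A * B"] by simp
  then have "(L2 (A + B))\<^sup>2
      = (L2 A)\<^sup>2 + (L2 B)\<^sup>2 + 2 * Re (\<tau> (adj A * B))"
    using A B by (simp add: L2_norm_square_Re trace_linear algebra_simps)
  moreover have "Re (\<tau> (adj A * B)) \<le> L2 A * L2 B"
    using L2_Cauchy_Schwarz[OF A B] complex_Re_le_cmod order_trans by blast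
  ultimately have "(L2 (A + B))\<^sup>2 \<le> (L2 A + L2 B)\<^sup>2"
    by (simp add: power2_sum)
  then show ?thesis by (rule power2_le_imp_le) (use A B in simp)
qed

lemma L2_norm_triangle_diff:
  "A \<in> M \<Longrightarrow> B \<in> M \<Longrightarrow> L2 (A - B) \<le> L2 A + L2 B"
  using L2_norm_triangle[of A "- B"] by (simp add: L2_norm_uminus)

lemma L2_norm_square_add_le:
  assumes "A \<in> M" "B \<in> M"
  shows "(L2 (A + B))\<^sup>2 \<le> 2 * (L2 A)\<^sup>2 + 2 * (L2 B)\<^sup>2"
proof -
  have "(L2 (A + B))\<^sup>2 \<le> (L2 A + L2 B)\<^sup>2"
    by (intro power_mono L2_norm_triangle) (use assms in simp_all)
  also have "\<dots> \<le> 2 * (L2 A)\<^sup>2 + 2 * (L2 B)\<^sup>2"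
    using zero_le_power2[of "L2 A - L2 B"]
    unfolding power2_diff power2_sum by linarith
  finally show ?thesis .
qed

lemma L2_norm_square_diff_le:
  "A \<in> M \<Longrightarrow> B \<in> M \<Longrightarrow> (L2 (A - B))\<^sup>2 \<le> 2 * (L2 A)\<^sup>2 + 2 * (L2 B)\<^sup>2"
  using L2_norm_square_add_le[of A "- B"] by (simp add: L2_norm_uminus)

text \<open>Only squares \<open>C\<^sup>* C\<close> with \<open>C \<in> M\<close> are known to have nonnegative trace, so the
  positivity of \<open>r\<^sup>2 - A\<^sup>* A\<close> enters through its square root.\<close>

lemma L2_norm_mult_left:
  assumes A: "A \<in> M" and B: "B \<in> M"
  shows "L2 (A * B) \<le> norm A * L2 B"
proof -
  \<comment> \<open>The strict bound makes \<open>norm H < 1\<close>, as the binomial series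
    requires; \<open>r\<close> then decreases to \<open>norm A\<close>.\<close>
  have bound: "L2 (A * B) \<le> r * L2 B" if r: "r > norm A" for r
  proof -
    have r0: "r > 0" using r norm_ge_zero[of A] by linarith
    define H where "H = (1 / r\<^sup>2) *\<^sub>R (adj A * A)"
    have H: "H \<in> M" "adj H = H" using A by (simp_all add: H_def)
    have "norm (adj A * A) \<le> norm A * norm A"
      using norm_mult_ineq[of "adj A" A] by simp
    also have "\<dots> < r * r" using r r0 by (intro mult_strict_mono) auto
    finally have "norm H < 1" using r0 by (simp add: H_def power2_eq_square)
    then obtain C where C: "C \<in> M" "adj C = C" "C * C = 1 - H"
      using von_neumann_square_root[OF von_neumann H] by blast
    have "adj (C * B) * (C * B) = adj B * (C * C) * B"
      using C(1,2) by (simp add: mult.assoc)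
    also have "\<dots> = adj B * B - (1 / r\<^sup>2) *\<^sub>R (adj (A * B) * (A * B))"
      unfolding C(3) H_def by (simp add: algebra_simps)
    finally have "(L2 (C * B))\<^sup>2
        = (L2 B)\<^sup>2 - (1 / r\<^sup>2) * (L2 (A * B))\<^sup>2"
      using A B C by (simp add: L2_norm_square_Re trace_linear)
    then have "(1 / r\<^sup>2) * (L2 (A * B))\<^sup>2 \<le> (L2 B)\<^sup>2"
      by (metis diff_ge_0_iff_ge zero_le_power2)
    then have "(L2 (A * B))\<^sup>2 \<le> (r * L2 B)\<^sup>2"
      using r0 by (simp add: field_simps power_mult_distrib)
    then show ?thesis by (rule power2_le_imp_le) (use B r0 in simp)
  qed
  have "((\<lambda>r. r * L2 B) \<longlongrightarrow> norm A * L2 B) (at_right (norm A))"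
    by (intro tendsto_intros)
  then show ?thesis
    by (rule tendsto_lowerbound)
      (use bound in \<open>auto simp: eventually_at_filter\<close>)
qed

lemma L2_norm_mult_right:
  assumes "A \<in> M" "B \<in> M"
  shows "L2 (A * B) \<le> L2 A * norm B"
proof -
  have "L2 (A * B) = L2 (adj B * adj A)"
    using assms L2_norm_adj[of "A * B"] by simp
  also have "\<dots> \<le> norm B * L2 A"
    using L2_norm_mult_left[of "adj B" "adj A"] assms by simp
  finally show ?thesis by (simp add: mult.commute)
qed

lemma L2_norm_le_norm: "A \<in> M \<Longrightarrow> L2 A \<le> norm A"
  using L2_norm_mult_left[of A 1] by simp

lemma trace_le_L2_norm: "A \<in> M \<Longrightarrow> cmod (\<tau> A) \<le> L2 A"
  using trace_mult_le[of 1 A] by simp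

lemma trace_le_norm: "A \<in> M \<Longrightarrow> cmod (\<tau> A) \<le> norm A"
  using trace_le_L2_norm L2_norm_le_norm order_trans by blast

text \<open>Operator norms are spent on \<open>P\<close> and \<open>Q\<close> and \<open>L2\<close>
  norms on \<open>X\<close> and \<open>Y\<close>, since the increments of \<open>U\<close> scaled by
  \<open>1 / sqrt (u - t)\<close> are controlled here only in \<open>L2\<close>.\<close>

lemma trace_quad_le:
  assumes m: "P \<in> M" "X \<in> M" "Q \<in> M" "Y \<in> M"
    and le: "norm P \<le> p" "L2 X \<le> x" "norm Q \<le> q" "L2 Y \<le> y"
  shows "cmod (\<tau> (P * X * Q * Y)) \<le> p * x * q * y"
proof -
  have "cmod (\<tau> (P * X * Q * Y)) \<le> L2 (P * X * Q) * L2 Y"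
    using trace_mult_le[of "P * X * Q" Y] m by simp
  also have "\<dots> \<le> L2 (P * X) * norm Q * L2 Y"
    using m by (intro mult_right_mono L2_norm_mult_right) simp_all
  also have "\<dots> \<le> norm P * L2 X * norm Q * L2 Y"
    using m by (intro mult_right_mono L2_norm_mult_left) simp_all
  also have "\<dots> \<le> p * x * q * y"
  proof -
    have "0 \<le> p" "0 \<le> x" "0 \<le> q"
      using le(1,2,3) norm_ge_zero[of P] norm_ge_zero[of Q] L2_norm_nonneg[OF m(2)] by linarith+
    then show ?thesis
      using m by (intro mult_mono le) simp_all
  qed
  finally show ?thesis .
qed

lemma L2_norm_bound_shift:
  "X \<in> M \<Longrightarrow> X' \<in> M \<Longrightarrow> L2 X \<le> L2 (X - X') + L2 X'"
  using L2_norm_triangle[of "X - X'" X'] by simp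

section \<open>Limits of traces\<close>

lemma tendsto_trace:
  assumes "(X \<longlongrightarrow> L) F" "\<forall>\<^sub>F u in F. X u \<in> M" "L \<in> M"
  shows "((\<lambda>u. \<tau> (X u)) \<longlongrightarrow> \<tau> L) F"
proof (rule Lim_null[THEN iffD2], rule Lim_null_comparison)
  show "\<forall>\<^sub>F u in F. norm (\<tau> (X u) - \<tau> L) \<le> norm (X u - L)"
    using assms(2) by eventually_elim (use assms(3) trace_le_norm in \<open>simp flip: trace_diff\<close>)
  show "((\<lambda>u. norm (X u - L)) \<longlongrightarrow> 0) F"
    using assms(1) by (simp add: tendsto_norm_zero_iff Lim_null[of X L])
qed

text \<open>The comparison factors \<open>X'\<close> and \<open>Y'\<close> vary with
  \<open>u\<close> because the scaled increments of \<open>B\<close> stay bounded in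
  \<open>L2\<close> but need not converge themselves; only the trace of the product does.\<close>

lemma tendsto_trace_quad:
  assumes X: "((\<lambda>u. L2 (X u - X' u)) \<longlongrightarrow> 0) F"
    and Y: "((\<lambda>u. L2 (Y u - Y' u)) \<longlongrightarrow> 0) F"
    and P: "(P \<longlongrightarrow> P0) F" and Q: "(Q \<longlongrightarrow> Q0) F" and M0: "P0 \<in> M" "Q0 \<in> M"
    and ev: "\<forall>\<^sub>F u in F. X u \<in> M \<and> X' u \<in> M \<and> Y u \<in> M \<and> Y' u \<in> M \<and> P u \<in> M \<and> Q u \<in> M
      \<and> L2 (X' u) \<le> C \<and> L2 (Y' u) \<le> C"
    and lim: "((\<lambda>u. \<tau> (P0 * X' u * Q0 * Y' u)) \<longlongrightarrow> l) F"
  shows "((\<lambda>u. \<tau> (P u * X u * Q u * Y u)) \<longlongrightarrow> l) F"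
proof -
  \<comment> \<open>The error of exchanging \<open>P\<close>, \<open>Q\<close>, \<open>X\<close>,
    \<open>Y\<close> in this order, one at a time; each summand has one vanishing factor.\<close>
  define e where "e u = norm (P u - P0) * (L2 (X u - X' u) + C) * norm (Q u) * (L2 (Y u - Y' u) + C)
     + norm P0 * (L2 (X u - X' u) + C) * norm (Q u - Q0) * (L2 (Y u - Y' u) + C)
     + norm P0 * L2 (X u - X' u) * norm Q0 * (L2 (Y u - Y' u) + C)
     + norm P0 * C * norm Q0 * L2 (Y u - Y' u)" for u
  have P': "((\<lambda>u. norm (P u - P0)) \<longlongrightarrow> 0) F" and Q': "((\<lambda>u. norm (Q u - Q0)) \<longlongrightarrow> 0) F"
    using P Q by (simp_all add: tendsto_norm_zero_iff Lim_null[of P P0] Lim_null[of Q Q0])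
  have "(e \<longlongrightarrow> 0 * (0 + C) * norm Q0 * (0 + C) + norm P0 * (0 + C) * 0 * (0 + C)
      + norm P0 * 0 * norm Q0 * (0 + C) + norm P0 * C * norm Q0 * 0) F"
    unfolding e_def by (intro tendsto_intros X Y P' Q' Q)
  then have e0: "(e \<longlongrightarrow> 0) F" by simp
  have "((\<lambda>u. \<tau> (P u * X u * Q u * Y u) - \<tau> (P0 * X' u * Q0 * Y' u)) \<longlongrightarrow> 0) F"
  proof (rule Lim_null_comparison[OF _ e0])
    show "\<forall>\<^sub>F u in F. norm (\<tau> (P u * X u * Q u * Y u) - \<tau> (P0 * X' u * Q0 * Y' u)) \<le> e u"
      using ev
    proof eventually_elim
      case (elim u)
      then have m [simp]: "X u \<in> M" "X' u \<in> M" "Y u \<in> M" "Y' u \<in> M" "P u \<in> M" "Q u \<in> M"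
        and C: "L2 (X' u) \<le> C" "L2 (Y' u) \<le> C" by auto
      note M0 [simp]
      have tri: "cmod (a + b + c + d) \<le> cmod a + cmod b + cmod c + cmod d" for a b c d
        using norm_triangle_ineq[of "a + b + c" d] norm_triangle_ineq[of "a + b" c]
          norm_triangle_ineq[of a b] by linarith
      have x: "L2 (X u) \<le> L2 (X u - X' u) + C"
        and y: "L2 (Y u) \<le> L2 (Y u - Y' u) + C"
        using L2_norm_bound_shift[of "X u" "X' u"] L2_norm_bound_shift[of "Y u" "Y' u"] C by auto
      have "P u * X u * Q u * Y u - P0 * X' u * Q0 * Y' u
          = (P u - P0) * X u * Q u * Y u + P0 * X u * (Q u - Q0) * Y u
            + P0 * (X u - X' u) * Q0 * Y u + P0 * X' u * Q0 * (Y u - Y' u)"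
        by (simp add: algebra_simps)
      from arg_cong[OF this, of \<tau>]
      have "\<tau> (P u * X u * Q u * Y u) - \<tau> (P0 * X' u * Q0 * Y' u)
          = \<tau> ((P u - P0) * X u * Q u * Y u) + \<tau> (P0 * X u * (Q u - Q0) * Y u)
            + \<tau> (P0 * (X u - X' u) * Q0 * Y u) + \<tau> (P0 * X' u * Q0 * (Y u - Y' u))"
        by (simp add: add trace_diff)
      then have "cmod (\<tau> (P u * X u * Q u * Y u) - \<tau> (P0 * X' u * Q0 * Y' u))
          \<le> cmod (\<tau> ((P u - P0) * X u * Q u * Y u))
            + cmod (\<tau> (P0 * X u * (Q u - Q0) * Y u))
            + cmod (\<tau> (P0 * (X u - X' u) * Q0 * Y u)) + cmod (\<tau> (P0 * X' u * Q0 * (Y u - Y' u)))"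
        by (simp only: tri)
      also have "\<dots> \<le> e u"
        unfolding e_def
        by (rule add_mono, rule add_mono, rule add_mono;
            rule trace_quad_le; (rule m M0 diff_closed order_refl x y C)+)
      finally show ?case .
    qed
  qed
  from tendsto_add[OF this lim] show ?thesis by simp
qed

end

section \<open>Free stochastic integrals\<close>

subsection \<open>Moments of the semicircle law\<close>

lemma semicircle_mean:
  fixes v :: real
  shows "integral {- 2 * sqrt v .. 2 * sqrt v} (\<lambda>x. x ^ 1 * sqrt (4 * v - x\<^sup>2) / (2 * pi * v)) = 0"
    (is "integral _ ?f = 0")
proof -
  have "integral {- 2 * sqrt v .. 2 * sqrt v} (\<lambda>x. ?f (- x)) = integral {- 2 * sqrt v .. 2 * sqrt v} ?f"
    using Henstock_Kurzweil_Integration.integral_reflect_real[where a = "- 2 * sqrt v" and b = "2 * sqrt v" and f = ?f] by simp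
  moreover have "(\<lambda>x. ?f (- x)) = (\<lambda>x. - ?f x)" by simp
  ultimately show ?thesis by (simp only: integral_neg)
qed

lemma semicircle_variance:
  fixes v :: real
  assumes v: "v > 0"
  shows "integral {- 2 * sqrt v .. 2 * sqrt v} (\<lambda>x. x ^ 2 * sqrt (4 * v - x\<^sup>2) / (2 * pi * v)) = v"
proof -
  define r where "r = 2 * sqrt v"
  have r: "r > 0" "r\<^sup>2 = 4 * v" using v by (simp_all add: r_def power_mult_distrib)
  \<comment> \<open>An explicit primitive of
    \<open>x\<^sup>2 * sqrt (r\<^sup>2 - x\<^sup>2)\<close>. The \<open>sqrt\<close> and the
    \<open>arcsin\<close> in it are not differentiable at \<open>- r\<close> and \<open>r\<close>,
    hence the interior form of the fundamental theorem.\<close>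
  define G where "G x = x * (2 * x\<^sup>2 - r\<^sup>2) * sqrt (r\<^sup>2 - x\<^sup>2) / 8 + r ^ 4 / 8 * arcsin (x / r)" for x
  have "((\<lambda>x. x\<^sup>2 * sqrt (r\<^sup>2 - x\<^sup>2)) has_integral (G r - G (- r))) {- r..r}"
  proof (rule fundamental_theorem_of_calculus_interior)
    show "- r \<le> r" using r by simp
    show "continuous_on {- r..r} G"
      unfolding G_def using r
      by (intro continuous_intros continuous_on_arcsin) (auto simp: field_simps)
    fix x assume x: "x \<in> {- r<..<r}"
    define s where "s = sqrt (r\<^sup>2 - x\<^sup>2)"
    have "\<bar>x\<bar> < r" using x by auto
    then have "x\<^sup>2 < r\<^sup>2" using power_strict_mono[of "\<bar>x\<bar>" r 2] by simp
    then have s: "s > 0" "s\<^sup>2 = r\<^sup>2 - x\<^sup>2" by (simp_all add: s_def)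
    have "sqrt (1 - (x / r)\<^sup>2) = s / r"
    proof (rule real_sqrt_unique)
      show "(s / r)\<^sup>2 = 1 - (x / r)\<^sup>2"
        using r(1) s(2) by (simp add: power_divide diff_divide_distrib)
    qed (use r s in simp)
    then have arc: "((\<lambda>x. arcsin (x / r)) has_real_derivative (inverse (s / r) * (1 / r))) (at x)"
      using x r(1) by (auto intro!: derivative_eq_intros simp: divide_less_eq less_divide_eq)
    have sq: "((\<lambda>x. sqrt (r\<^sup>2 - x\<^sup>2)) has_real_derivative (- x / s)) (at x)"
      using \<open>x\<^sup>2 < r\<^sup>2\<close> by (auto intro!: derivative_eq_intros simp: s_def field_simps)
    have "(G has_real_derivative
        (((2 * x\<^sup>2 - r\<^sup>2) + x * (4 * x)) * s + x * (2 * x\<^sup>2 - r\<^sup>2) * (- x / s)) / 8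
          + r ^ 4 / 8 * (inverse (s / r) * (1 / r))) (at x)"
    proof -
      have "((\<lambda>x. x * (2 * x\<^sup>2 - r\<^sup>2)) has_real_derivative ((2 * x\<^sup>2 - r\<^sup>2) + x * (4 * x))) (at x)"
        by (auto intro!: derivative_eq_intros simp: power2_eq_square)
      from DERIV_add[OF DERIV_cdivide[OF DERIV_mult[OF this sq], of 8] DERIV_cmult[OF arc, of "r ^ 4 / 8"]]
      show ?thesis unfolding G_def by (simp add: s_def[symmetric] mult_ac)
    qed
    moreover have "(((2 * x\<^sup>2 - r\<^sup>2) + x * (4 * x)) * s + x * (2 * x\<^sup>2 - r\<^sup>2) * (- x / s)) / 8
          + r ^ 4 / 8 * (inverse (s / r) * (1 / r)) = x\<^sup>2 * s"
    proof -
      have "(((2 * x\<^sup>2 - r\<^sup>2) + x * (4 * x)) * s + x * (2 * x\<^sup>2 - r\<^sup>2) * (- x / s)) / 8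
          + r ^ 4 / 8 * (inverse (s / r) * (1 / r))
        = ((6 * x\<^sup>2 - r\<^sup>2) * s\<^sup>2 - x\<^sup>2 * (2 * x\<^sup>2 - r\<^sup>2) + r ^ 4) / (8 * s)"
        using s(1) r(1) by (simp add: field_simps power2_eq_square)
      also have "(6 * x\<^sup>2 - r\<^sup>2) * s\<^sup>2 - x\<^sup>2 * (2 * x\<^sup>2 - r\<^sup>2) + r ^ 4 = 8 * x\<^sup>2 * s\<^sup>2"
        unfolding s(2) by (simp add: algebra_simps power2_eq_square power4_eq_xxxx)
      also have "8 * x\<^sup>2 * s\<^sup>2 / (8 * s) = x\<^sup>2 * s"
        using s(1) by (simp add: power2_eq_square)
      finally show ?thesis .
    qed
    ultimately show "(G has_vector_derivative x\<^sup>2 * sqrt (r\<^sup>2 - x\<^sup>2)) (at x)"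
      by (simp add: s_def has_real_derivative_iff_has_vector_derivative)
  qed
  moreover have "G r - G (- r) = 2 * pi * v\<^sup>2"
  proof -
    have "r ^ 4 = 16 * v\<^sup>2"
      using arg_cong[OF r(2), of "\<lambda>x. x\<^sup>2"] by (simp add: power_mult_distrib flip: power_mult)
    then show ?thesis using r(1) by (simp add: G_def)
  qed
  ultimately have "((\<lambda>x. x\<^sup>2 * sqrt (r\<^sup>2 - x\<^sup>2)) has_integral (2 * pi * v\<^sup>2)) {- r..r}"
    by simp
  from integral_unique[OF has_integral_divide[OF this, of "2 * pi * v"]] show ?thesis
    unfolding r(2) using v by (simp add: r_def power2_eq_square)
qed

subsection \<open>Freeness of two families\<close>

context wstar_probability_space
begin

lemma freely_independent_word:
  assumes "freely_independent \<tau> X Y" "w \<noteq> []" "distinct_adj (map fst w)"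
    and "\<And>i A. (i, A) \<in> set w \<Longrightarrow> A \<in> star_algebra_generated (if i then X else Y) \<and> \<tau> A = 0"
  shows "\<tau> (prod_list (map snd w)) = 0"
  using assms(1)[unfolded freely_independent_def free_family_def, rule_format, of w] assms(2-4)
  by auto

definition centre :: "'h bop \<Rightarrow> 'h bop"
  where "centre A = A - scale_bop (\<tau> A) 1"

lemma trace_centre [simp]: "A \<in> M \<Longrightarrow> \<tau> (centre A) = 0"
  by (simp add: centre_def trace_linear)

lemma centre_closed:
  assumes "star_algebra N" "A \<in> N"
  shows "centre A \<in> N"
proof -
  interpret N: star_algebra N by fact
  show ?thesis using assms(2) by (simp add: centre_def)
qed

lemma centre_in_M [simp]: "A \<in> M \<Longrightarrow> centre A \<in> M"
  by (simp add: centre_def)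

context
  fixes X Y
  assumes free: "freely_independent \<tau> X Y" and XM: "X \<subseteq> M" and YM: "Y \<subseteq> M"
begin

private lemma in_M [simp]:
  "A \<in> star_algebra_generated X \<Longrightarrow> A \<in> M" "A \<in> star_algebra_generated Y \<Longrightarrow> A \<in> M"
  using generated_subset[OF XM] generated_subset[OF YM] by auto

lemma free_trace_mult:
  assumes a: "a \<in> star_algebra_generated X" and c: "c \<in> star_algebra_generated Y"
  shows "\<tau> (c * a) = \<tau> c * \<tau> a"
proof -
  have "\<tau> (prod_list (map snd [(False, centre c), (True, centre a)])) = 0"
    by (rule freely_independent_word[OF free])
      (use a c in \<open>auto intro: centre_closed[OF star_algebra_generated]\<close>)
  then have "\<tau> (centre c * centre a) = 0" by simp
  then show ?thesis
    using a c by (simp add: centre_def algebra_simps trace_linear scale_bop_mult)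
qed

text \<open>Ito's rule in algebraic form. Expanding the centred \<open>c\<close> and
  \<open>d\<close> leaves three shorter words; by traciality and \<open>free_trace_mult\<close> each
  equals the right-hand side, two with sign plus and one with sign minus.\<close>

lemma free_trace_mult4:
  assumes a: "a \<in> star_algebra_generated X" "\<tau> a = 0"
    and b: "b \<in> star_algebra_generated X" "\<tau> b = 0"
    and c: "c \<in> star_algebra_generated Y" and d: "d \<in> star_algebra_generated Y"
  shows "\<tau> (c * a * d * b) = \<tau> c * \<tau> d * \<tau> (a * b)"
proof -
  have "\<tau> (prod_list (map snd [(False, centre c), (True, a), (False, centre d), (True, b)])) = 0"
    by (rule freely_independent_word[OF free])
      (use a b c d in \<open>auto intro: centre_closed[OF star_algebra_generated]\<close>)
  then have 1: "\<tau> (centre c * a * centre d * b) = 0" by (simp add: mult.assoc)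
  have ab: "a * b \<in> star_algebra_generated X" "b * a \<in> star_algebra_generated X"
    using a b by (auto intro: star_algebra_generated.mult)
  have "\<tau> (c * a * d * b) = \<tau> (centre c * a * centre d * b) + \<tau> c * \<tau> (a * d * b)
      + \<tau> d * \<tau> (c * (a * b)) - \<tau> c * \<tau> d * \<tau> (a * b)"
    using a b c d by (simp add: centre_def algebra_simps trace_linear scale_bop_mult)
  moreover have "\<tau> (a * d * b) = \<tau> (d * (b * a))"
    using a b d tracial[of a "d * b"] by (simp add: mult.assoc)
  ultimately show ?thesis
    using free_trace_mult[OF ab(1) c] free_trace_mult[OF ab(2) d] a b tracial[of a b]
    by (simp add: 1)
qed

end

end

subsection \<open>Processes adapted to a free Brownian motion\<close>

locale free_unitary_diffusion = wstar_probability_space M \<tau>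
  for M :: "'h::complex_hilbert_space bop set" and \<tau> :: "'h bop \<Rightarrow> complex" +
  fixes F :: "real \<Rightarrow> 'h bop set" and B U :: "real \<Rightarrow> 'h bop"
  assumes filtration: "filtration M F"
    and brownian: "free_brownian_motion \<tau> F B"
    and SDE: "free_unitary_SDE \<tau> F B U"
begin

lemma F_algebra: "0 \<le> t \<Longrightarrow> star_algebra (F t)"
  using filtration by (simp add: filtration_def von_neumann_star_algebra)

lemma F_in_M: "0 \<le> t \<Longrightarrow> A \<in> F t \<Longrightarrow> A \<in> M"
  using filtration by (auto simp: filtration_def)

lemma F_mono: "0 \<le> s \<Longrightarrow> s \<le> t \<Longrightarrow> A \<in> F s \<Longrightarrow> A \<in> F t"
  using filtration unfolding filtration_def by blast

lemma F_mult: "0 \<le> t \<Longrightarrow> A \<in> F t \<Longrightarrow> A' \<in> F t \<Longrightarrow> A * A' \<in> F t"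
  by (rule star_algebra.mult_closed[OF F_algebra])

lemma F_diff: "0 \<le> t \<Longrightarrow> A \<in> F t \<Longrightarrow> A' \<in> F t \<Longrightarrow> A - A' \<in> F t"
  by (rule star_algebra.diff_closed[OF F_algebra])

lemma F_adj: "0 \<le> t \<Longrightarrow> A \<in> F t \<Longrightarrow> adj A \<in> F t"
  by (rule star_algebra.adj_closed[OF F_algebra])

lemma F_uminus: "0 \<le> t \<Longrightarrow> A \<in> F t \<Longrightarrow> - A \<in> F t"
  by (rule star_algebra.uminus_closed[OF F_algebra])

lemma B_in_F: "0 \<le> t \<Longrightarrow> B t \<in> F t"
  using brownian by (simp add: free_brownian_motion_def)

lemma adj_B: "0 \<le> t \<Longrightarrow> adj (B t) = B t"
  using brownian by (simp add: free_brownian_motion_def)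

lemma increment_in_F: "0 \<le> s \<Longrightarrow> s \<le> t \<Longrightarrow> B t - B s \<in> F t"
  by (intro F_diff B_in_F F_mono[OF _ _ B_in_F]) simp_all

lemma increment_in_M: "0 \<le> s \<Longrightarrow> s \<le> t \<Longrightarrow> B t - B s \<in> M"
  by (rule F_in_M[OF _ increment_in_F]) simp_all

lemma U_in_F: "0 \<le> t \<Longrightarrow> U t \<in> F t"
  using SDE by (simp add: free_unitary_SDE_def)

lemma U_in_M [simp]: "0 \<le> t \<Longrightarrow> U t \<in> M"
  by (rule F_in_M[OF _ U_in_F])

lemma increment_moments:
  assumes "0 \<le> s" "s \<le> t"
  shows "\<tau> (B t - B s) = 0" "\<tau> ((B t - B s) * (B t - B s)) = of_real (t - s)"
proof -
  have "\<tau> (B t - B s) = 0 \<and> \<tau> ((B t - B s) * (B t - B s)) = of_real (t - s)"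
  \<comment> \<open>Increments are semicircular by definition only for \<open>s < t\<close>; for
    \<open>s = t\<close> both moments are 0.\<close>
  proof (cases "s = t")
    case False
    then have "semicircular \<tau> (t - s) (B t - B s)"
      using assms brownian by (simp add: free_brownian_motion_def)
    then have m: "\<tau> ((B t - B s) ^ n) = of_real
        (integral {- 2 * sqrt (t - s) .. 2 * sqrt (t - s)} (\<lambda>x. x ^ n * sqrt (4 * (t - s) - x\<^sup>2) / (2 * pi * (t - s))))"
      for n by (simp add: semicircular_def)
    have ts: "t - s > 0" using assms False by simp
    show ?thesis
      using m[of 1] m[of 2] unfolding semicircle_mean semicircle_variance[OF ts]
      by (simp add: power2_eq_square)
  qed simp
  then show "\<tau> (B t - B s) = 0" "\<tau> ((B t - B s) * (B t - B s)) = of_real (t - s)" by auto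
qed

lemma increment_trace:
  assumes st: "0 \<le> s" "s \<le> t" and c: "c \<in> F s"
  shows "\<tau> (c * (B t - B s)) = 0"
proof (cases "s = t")
  case False
  then have "freely_independent \<tau> {B t - B s} (F s)"
    using st brownian by (simp add: free_brownian_motion_def)
  moreover have "{B t - B s} \<subseteq> M" "F s \<subseteq> M"
    using increment_in_M[OF st] F_in_M[OF st(1)] by auto
  ultimately have "\<tau> (c * (B t - B s)) = \<tau> c * \<tau> (B t - B s)"
    by (rule free_trace_mult) (simp_all add: c star_algebra_generated.gen)
  then show ?thesis using increment_moments[OF st] by simp
qed simp

lemma increment_trace2:
  assumes st: "0 \<le> s" "s \<le> t" and c: "c \<in> F s" and d: "d \<in> F s"
  shows "\<tau> (c * (B t - B s) * d * (B t - B s)) = of_real (t - s) * \<tau> c * \<tau> d"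
proof (cases "s = t")
  case False
  then have "freely_independent \<tau> {B t - B s} (F s)"
    using st brownian by (simp add: free_brownian_motion_def)
  moreover have "{B t - B s} \<subseteq> M" "F s \<subseteq> M"
    using increment_in_M[OF st] F_in_M[OF st(1)] by auto
  ultimately have "\<tau> (c * (B t - B s) * d * (B t - B s)) = \<tau> c * \<tau> d * \<tau> ((B t - B s) * (B t - B s))"
    by (rule free_trace_mult4)
      (simp_all add: c d star_algebra_generated.gen increment_moments[OF st])
  then show ?thesis using increment_moments[OF st] by simp
qed simp

text \<open>Only the overlap of the two intervals contributes. The part of the first increment
  before \<open>a'\<close> joins the past and is killed by the centred second increment; then
  whichever interval ends later is cut at the earlier end.\<close>

lemma increment_covariance_aux:
  assumes ab: "0 \<le> a" "a \<le> b" "a' \<le> b'" "a \<le> a'" and c: "c \<in> F a'"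
  shows "\<tau> ((B b - B a) * c * (B b' - B a')) = of_real (max 0 (min b b' - a')) * \<tau> c"
proof (cases "b \<le> a'")
  case True
  have "(B b - B a) * c \<in> F a'"
    using ab True c by (intro F_mult F_mono[OF _ True increment_in_F]) simp_all
  then show ?thesis
    using increment_trace[of a' b' "(B b - B a) * c"] ab True by simp
next
  case False
  have a': "0 \<le> a'" using ab by simp
  have m: "c \<in> M" "B a' - B a \<in> M" "B b - B a' \<in> M" "B b' - B a' \<in> M"
    using ab False a' F_in_M[OF a' c] by (auto intro: increment_in_M)
  have "(B a' - B a) * c \<in> F a'"
    using ab c by (intro F_mult increment_in_F) simp_all
  then have early: "\<tau> ((B a' - B a) * c * (B b' - B a')) = 0"
    using increment_trace[of a' b'] ab a' by simp
  have "(B b - B a) * c * (B b' - B a')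
      = (B a' - B a) * c * (B b' - B a') + (B b - B a') * c * (B b' - B a')"
    by (simp add: algebra_simps)
  then have "\<tau> ((B b - B a) * c * (B b' - B a'))
      = \<tau> ((B a' - B a) * c * (B b' - B a')) + \<tau> ((B b - B a') * c * (B b' - B a'))"
    using m by (simp add: add)
  then have split: "\<tau> ((B b - B a) * c * (B b' - B a')) = \<tau> ((B b - B a') * c * (B b' - B a'))"
    by (simp add: early)
  show ?thesis
  proof (cases "b \<le> b'")
    case True
    have "(B b - B a') * c \<in> F b"
      using a' False c by (intro F_mult increment_in_F F_mono[OF _ _ c]) simp_all
    then have late: "\<tau> ((B b - B a') * c * (B b' - B b)) = 0"
      using increment_trace[of b b'] True ab by simp
    have m': "B b' - B b \<in> M" using True ab by (intro increment_in_M) simp_all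
    have "(B b - B a') * c * (B b' - B a')
        = (B b - B a') * c * (B b' - B b) + 1 * (B b - B a') * c * (B b - B a')"
      by (simp add: algebra_simps)
    then have "\<tau> ((B b - B a') * c * (B b' - B a'))
        = \<tau> ((B b - B a') * c * (B b' - B b)) + \<tau> (1 * (B b - B a') * c * (B b - B a'))"
      using m m' by (simp add: add)
    also have "\<tau> (1 * (B b - B a') * c * (B b - B a')) = of_real (b - a') * \<tau> 1 * \<tau> c"
      using a' False c F_algebra[OF a']
      by (intro increment_trace2) (auto simp: star_algebra.one_closed)
    finally show ?thesis
      using False True by (simp add: late split unit)
  next
    case b': False
    have "c * (B b' - B a') \<in> F b'"
      using a' ab c by (intro F_mult increment_in_F F_mono[OF _ _ c]) simp_all
    then have late: "\<tau> (c * (B b' - B a') * (B b - B b')) = 0"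
      using increment_trace[of b' b] b' ab by simp
    have m': "B b - B b' \<in> M" using b' ab by (intro increment_in_M) simp_all
    have "(B b - B a') * c * (B b' - B a')
        = (B b - B b') * (c * (B b' - B a')) + 1 * (B b' - B a') * c * (B b' - B a')"
      by (simp add: algebra_simps)
    then have "\<tau> ((B b - B a') * c * (B b' - B a'))
        = \<tau> ((B b - B b') * (c * (B b' - B a'))) + \<tau> (1 * (B b' - B a') * c * (B b' - B a'))"
      using m m' by (simp add: add)
    also have "\<tau> (1 * (B b' - B a') * c * (B b' - B a')) = of_real (b' - a') * \<tau> 1 * \<tau> c"
      using a' ab c F_algebra[OF a']
      by (intro increment_trace2) (auto simp: star_algebra.one_closed)
    also have "\<tau> ((B b - B b') * (c * (B b' - B a'))) = 0"
      using late m m' tracial[of "B b - B b'" "c * (B b' - B a')"] by simp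
    finally show ?thesis
      using ab b' by (simp add: split unit)
  qed
qed

text \<open>The case \<open>a' < a\<close> is the previous one for adjoints, as the trace
  intertwines \<open>adj\<close> and \<open>cnj\<close>.\<close>

lemma increment_covariance:
  assumes ab: "0 \<le> a" "a \<le> b" "0 \<le> a'" "a' \<le> b'" and c: "c \<in> F (max a a')"
  shows "\<tau> ((B b - B a) * c * (B b' - B a')) = of_real (max 0 (min b b' - max a a')) * \<tau> c"
proof (cases "a \<le> a'")
  case True
  then show ?thesis
    using increment_covariance_aux[of a b a' b' c] ab c by (simp add: max_def)
next
  case False
  have cM: "c \<in> M" using F_in_M[OF _ c] ab by simp
  have cA: "adj c \<in> F a" using F_adj[OF _ c] ab False by simp
  have "\<tau> ((B b' - B a') * adj c * (B b - B a)) = of_real (max 0 (min b' b - a)) * \<tau> (adj c)"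
    by (rule increment_covariance_aux) (use ab False cA in auto)
  moreover have "\<tau> ((B b - B a) * c * (B b' - B a'))
      = cnj (\<tau> ((B b' - B a') * adj c * (B b - B a)))"
    using ab cM increment_in_M
    by (subst trace_adj[symmetric]) (simp_all add: adj_B mult.assoc)
  ultimately show ?thesis
    using False cM by (simp add: trace_adj max_def min.commute)
qed

subsection \<open>The Ito isometry for simple processes\<close>

abbreviation ito :: "(real \<times> real \<times> 'h bop) list \<Rightarrow> 'h bop"
  where "ito \<equiv> simple_integral B"

abbreviation proc :: "(real \<times> real \<times> 'h bop) list \<Rightarrow> real \<Rightarrow> 'h bop"
  where "proc \<equiv> simple_process"

abbreviation adapted :: "real \<Rightarrow> (real \<times> real \<times> 'h bop) list \<Rightarrow> bool"
  where "adapted \<equiv> simple_adapted F"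

lemma simple_adapted_Nil [simp]: "adapted t []"
  by (simp add: simple_adapted_def)

lemma simple_adapted_Cons [simp]:
  "adapted t ((a, b, Y) # P) \<longleftrightarrow> 0 \<le> a \<and> a \<le> b \<and> b \<le> t \<and> Y \<in> F a \<and> adapted t P"
  by (auto simp: simple_adapted_def)

lemma simple_adapted_append [simp]:
  "adapted t (P @ Q) \<longleftrightarrow> adapted t P \<and> adapted t Q"
  unfolding simple_adapted_def set_append by (rule ball_Un)

lemma simple_adapted_mono: "adapted s P \<Longrightarrow> s \<le> t \<Longrightarrow> adapted t P"
  unfolding simple_adapted_def by fastforce

lemma simple_process_Nil [simp]: "proc [] = (\<lambda>s. 0)"
  by (simp add: simple_process_def fun_eq_iff)

lemma simple_process_Cons [simp]:
  "proc ((a, b, Y) # P) = (\<lambda>s. indicator {a..<b} s *\<^sub>R Y + proc P s)"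
  by (simp add: simple_process_def fun_eq_iff)

lemma simple_process_append [simp]:
  "proc (P @ Q) s = proc P s + proc Q s"
  by (simp add: simple_process_def)

lemma simple_integral_Nil [simp]: "ito [] = 0"
  by (simp add: simple_integral_def)

lemma simple_integral_Cons [simp]:
  "ito ((a, b, Y) # P) = Y * (B b - B a) + ito P"
  by (simp add: simple_integral_def)

lemma simple_integral_append [simp]:
  "ito (P @ Q) = ito P + ito Q"
  by (simp add: simple_integral_def)

text \<open>With \<open>@\<close> as addition this gives differences of simple processes as lists,
  without common refinements of their intervals.\<close>

definition neg_process :: "(real \<times> real \<times> 'h bop) list \<Rightarrow> (real \<times> real \<times> 'h bop) list"
  where "neg_process P = map (\<lambda>(a, b, Y). (a, b, - Y)) P"

lemma simple_process_neg [simp]: "proc (neg_process P) s = - proc P s"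
  by (induction P) (auto simp: neg_process_def)

lemma simple_integral_neg [simp]: "ito (neg_process P) = - ito P"
  by (induction P) (auto simp: neg_process_def)

lemma simple_adapted_neg [simp]: "adapted t P \<Longrightarrow> adapted t (neg_process P)"
  by (auto simp: neg_process_def simple_adapted_def intro: F_uminus)

lemma simple_process_in_M: "adapted t P \<Longrightarrow> proc P s \<in> M"
  by (induction P) (auto intro!: add_closed scaleR_closed intro: F_in_M)

lemma simple_integral_in_M: "adapted t P \<Longrightarrow> ito P \<in> M"
  by (induction P) (auto intro!: add_closed mult_closed increment_in_M intro: F_in_M)

text \<open>The intervals are half-open, so the process already vanishes at \<open>t\<close>; this
  settles the end point in the pointwise estimates below.\<close>

lemma simple_process_after: "adapted t P \<Longrightarrow> t \<le> s \<Longrightarrow> proc P s = 0"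
  by (induction P) (auto simp: indicator_def)

lemma ito_isometry_single:
  assumes "0 \<le> a" "a \<le> b" "b \<le> t" "Y \<in> F a" "0 \<le> a'" "a' \<le> b'" "b' \<le> t" "Y' \<in> F a'"
  shows "((\<lambda>s. \<tau> (adj (indicator {a..<b} s *\<^sub>R Y) * (indicator {a'..<b'} s *\<^sub>R Y'))) has_integral
    \<tau> (adj (Y * (B b - B a)) * (Y' * (B b' - B a')))) {0..t}"
proof -
  let ?l = "max a a'" and ?u = "min b b'"
  have YM: "Y \<in> M" "Y' \<in> M" using assms F_in_M by blast+
  have Y_in: "Y \<in> F ?l" "Y' \<in> F ?l"
    using assms by (auto intro: F_mono)
  then have "adj Y * Y' \<in> F ?l"
    using assms by (auto intro!: F_mult F_adj)
  then have "\<tau> ((B b - B a) * (adj Y * Y') * (B b' - B a')) = of_real (max 0 (?u - ?l)) * \<tau> (adj Y * Y')"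
    using assms by (intro increment_covariance) auto
  then have rhs: "\<tau> (adj (Y * (B b - B a)) * (Y' * (B b' - B a'))) = max 0 (?u - ?l) *\<^sub>R \<tau> (adj Y * Y')"
    using assms by (simp add: adj_B mult.assoc scaleR_conv_of_real)
  have I: "((\<lambda>s. if s \<in> {?l..?u} then \<tau> (adj Y * Y') else 0) has_integral max 0 (?u - ?l) *\<^sub>R \<tau> (adj Y * Y')) {0..t}"
  proof (subst has_integral_restrict)
    show "{?l..?u} \<subseteq> {0..t}" using assms by auto
    show "((\<lambda>s. \<tau> (adj Y * Y')) has_integral max 0 (?u - ?l) *\<^sub>R \<tau> (adj Y * Y')) {?l..?u}"
      using has_integral_const_real[of "\<tau> (adj Y * Y')" ?l ?u] by (simp add: max_def)
  qed
  \<comment> \<open>The half-open and the closed overlap differ only at \<open>?u\<close>; if the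
    overlap is empty, both sides are 0.\<close>
  have E: "\<tau> (adj (indicator {a..<b} s *\<^sub>R Y) * (indicator {a'..<b'} s *\<^sub>R Y'))
      = (if s \<in> {?l..?u} then \<tau> (adj Y * Y') else 0)" if "s \<in> {0..t} - {?u}" for s
    using that by (auto simp: indicator_def)
  show ?thesis
    unfolding rhs by (rule has_integral_spike_finite[where S = "{?u}", OF _ E I]) simp_all
qed

text \<open>The intervals of a list may overlap, so an induction for the square alone would produce
  cross terms; the bilinear form absorbs them.\<close>

lemma ito_isometry_bilinear:
  assumes "adapted t P" "adapted t Q"
  shows "((\<lambda>s. \<tau> (adj (proc P s) * proc Q s)) has_integral
    \<tau> (adj (ito P) * ito Q)) {0..t}"
  using assms(1)
proof (induction P)
  case (Cons p P)
  obtain a b Y where p: "p = (a, b, Y)" by (cases p)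
  have 1: "0 \<le> a" "a \<le> b" "b \<le> t" "Y \<in> F a" and P: "adapted t P"
    using Cons.prems by (auto simp: p)
  have m1: "Y \<in> M" "B b - B a \<in> M" using 1 by (auto intro: F_in_M increment_in_M)
  have "((\<lambda>s. \<tau> (adj (indicator {a..<b} s *\<^sub>R Y) * proc Q s)) has_integral
    \<tau> (adj (Y * (B b - B a)) * ito Q)) {0..t}"
    using assms(2)
  proof (induction Q)
    case (Cons q Q)
    obtain a' b' Y' where q: "q = (a', b', Y')" by (cases q)
    have 2: "0 \<le> a'" "a' \<le> b'" "b' \<le> t" "Y' \<in> F a'" and Q: "adapted t Q"
      using Cons.prems by (auto simp: q)
    have m2: "Y' \<in> M" "B b' - B a' \<in> M" using 2 by (auto intro: F_in_M increment_in_M)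
    from has_integral_add[OF ito_isometry_single[OF 1 2] Cons.IH[OF Q]] show ?case
      using m1 m2 simple_process_in_M[OF Q] simple_integral_in_M[OF Q]
      by (simp add: q distrib_left add del: adj_mult adj_scaleR)
  qed simp
  from has_integral_add[OF this Cons.IH[OF P]] show ?case
    using m1 simple_process_in_M[OF P] simple_integral_in_M[OF P]
      simple_process_in_M[OF assms(2)] simple_integral_in_M[OF assms(2)]
    by (simp add: p distrib_right add del: adj_mult adj_scaleR)
qed simp

lemma ito_isometry:
  assumes "adapted t P"
  shows "((\<lambda>s. (L2 (proc P s))\<^sup>2) has_integral (L2 (ito P))\<^sup>2) {0..t}"
  unfolding L2_norm_square_Re[OF simple_process_in_M[OF assms]]
    L2_norm_square_Re[OF simple_integral_in_M[OF assms]]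
  by (rule has_integral_Re[OF ito_isometry_bilinear[OF assms assms]])

text \<open>Cutting the intervals of a simple process at \<open>s\<close> does not change traces against
  \<open>F s\<close>, because the increments after \<open>s\<close> are centred and free from \<open>F s\<close>.\<close>

lemma simple_process_cut:
  assumes "0 \<le> s" "s \<le> t" "adapted t P"
  obtains P' where "adapted s P'"
    "\<And>x. 0 \<le> x \<Longrightarrow> x < s \<Longrightarrow> proc P' x = proc P x"
    "\<And>c. c \<in> F s \<Longrightarrow> \<tau> (c * ito P') = \<tau> (c * ito P)"
proof -
  have "\<exists>P'. adapted s P' \<and> (\<forall>x. 0 \<le> x \<and> x < s \<longrightarrow> proc P' x = proc P x)
    \<and> (\<forall>c\<in>F s. \<tau> (c * ito P') = \<tau> (c * ito P))"
    using assms(3)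
  proof (induction P)
    case Nil
    show ?case by (rule exI[of _ "[]"]) simp
  next
    case (Cons p P)
    obtain a b Y where p: "p = (a, b, Y)" by (cases p)
    have 1: "0 \<le> a" "a \<le> b" "b \<le> t" "Y \<in> F a" and P: "adapted t P"
      using Cons.prems by (auto simp: p)
    have m1: "Y \<in> M" "B b - B a \<in> M" using 1 by (auto intro: F_in_M increment_in_M)
    obtain P' where P': "adapted s P'"
      "\<And>x. 0 \<le> x \<Longrightarrow> x < s \<Longrightarrow> proc P' x = proc P x"
      "\<And>c. c \<in> F s \<Longrightarrow> \<tau> (c * ito P') = \<tau> (c * ito P)"
      using Cons.IH[OF P] by blast
    note PM = simple_integral_in_M[OF P] simple_integral_in_M[OF P'(1)]
    have cM: "c \<in> M" if "c \<in> F s" for c using F_in_M[OF assms(1) that] .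
    show ?case
    proof (cases "a < s")
      case True
      have "\<tau> (c * (Y * (B (min b s) - B a))) = \<tau> (c * (Y * (B b - B a)))" if c: "c \<in> F s" for c
      proof (cases "b \<le> s")
        case False
        have "c * Y \<in> F s"
          using True 1 assms c by (intro F_mult F_mono[OF _ _ 1(4)]) simp_all
        then have "\<tau> (c * Y * (B b - B s)) = 0"
          using False assms by (intro increment_trace) simp_all
        moreover have "c * (Y * (B b - B a)) = c * Y * (B b - B s) + c * (Y * (B s - B a))"
          by (simp add: algebra_simps)
        moreover have "B b - B s \<in> M" "B s - B a \<in> M"
          using False assms True 1 by (auto intro: increment_in_M)
        ultimately show ?thesis
          using False m1 cM[OF c] by (simp add: add min_def)
      qed (simp add: min_def)
      moreover have "B (min b s) - B a \<in> M" using 1 True by (intro increment_in_M) auto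
      ultimately have "\<tau> (c * ito ((a, min b s, Y) # P')) = \<tau> (c * ito (p # P))"
        if "c \<in> F s" for c
        using that P'(3)[OF that] m1 PM cM[OF that]
        by (simp add: p distrib_left add)
      then show ?thesis
        using 1 P' True by (intro exI[of _ "(a, min b s, Y) # P'"]) (auto simp: p indicator_def)
    next
      case False
      have "\<tau> (c * (Y * (B b - B a))) = 0" if c: "c \<in> F s" for c
        using increment_trace[OF 1(1,2), of "c * Y"] False assms
        by (simp add: F_mult F_mono[OF _ _ c] 1 mult.assoc)
      then have "\<tau> (c * ito P') = \<tau> (c * ito (p # P))" if "c \<in> F s" for c
        using that P'(3)[OF that] m1 PM cM[OF that] by (simp add: p distrib_left add)
      then show ?thesis
        using P' False by (intro exI[of _ P']) (auto simp: p indicator_def)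
    qed
  qed
  then show thesis using that by blast
qed

subsection \<open>Increments of the solution\<close>

text \<open>The equation supplies \<open>Z\<close> and \<open>D\<close> at each time separately;
  choosing them as functions of time makes their increments available.\<close>

definition solution_integrals :: "(real \<Rightarrow> 'h bop) \<Rightarrow> (real \<Rightarrow> 'h bop) \<Rightarrow> bool"
  where "solution_integrals Z D \<longleftrightarrow>
    (\<forall>t\<ge>0. has_free_stochastic_integral \<tau> F B U t (Z t) \<and> (U has_integral D t) {0..t} \<and>
      U t = 1 + scale_bop \<i> (Z t) - (1/2) *\<^sub>R D t)"

lemma solution_integrals_exist: obtains Z D where "solution_integrals Z D"
proof -
  have "\<forall>t. \<exists>Z D. t \<ge> 0 \<longrightarrow> has_free_stochastic_integral \<tau> F B U t Z \<and> (U has_integral D) {0..t} \<and>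
      U t = 1 + scale_bop \<i> Z - (1/2) *\<^sub>R D"
    using SDE unfolding free_unitary_SDE_def by blast
  then obtain Z D where "\<forall>t. t \<ge> 0 \<longrightarrow> has_free_stochastic_integral \<tau> F B U t (Z t) \<and> (U has_integral D t) {0..t} \<and>
      U t = 1 + scale_bop \<i> (Z t) - (1/2) *\<^sub>R D t"
    by metis
  then have "solution_integrals Z D" by (simp only: solution_integrals_def)
  then show thesis by (rule that)
qed

lemma continuous_U: "continuous_on {0..} U"
  using SDE by (simp add: free_unitary_SDE_def)

context
  fixes Z D
  assumes ZD: "solution_integrals Z D"
begin

lemma Z_in_F: "0 \<le> t \<Longrightarrow> Z t \<in> F t"
  using ZD by (simp add: solution_integrals_def has_free_stochastic_integral_def)

lemma Z_in_M [simp]: "0 \<le> t \<Longrightarrow> Z t \<in> M"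
  by (rule F_in_M[OF _ Z_in_F])

lemma U_eq: "0 \<le> t \<Longrightarrow> U t = 1 + scale_bop \<i> (Z t) - (1/2) *\<^sub>R D t"
  using ZD by (simp add: solution_integrals_def)

lemma D_eq: "0 \<le> t \<Longrightarrow> D t = 2 *\<^sub>R (1 + scale_bop \<i> (Z t) - U t)"
proof -
  assume "0 \<le> t"
  then have "1 + scale_bop \<i> (Z t) - U t = (1/2) *\<^sub>R D t" using U_eq[of t] by simp
  then show ?thesis by simp
qed

lemma D_in_M [simp]: "0 \<le> t \<Longrightarrow> D t \<in> M"
  by (simp add: D_eq)

lemma D_integral: "0 \<le> t \<Longrightarrow> (U has_integral D t) {0..t}"
  using ZD by (simp add: solution_integrals_def)

lemma Z_approx:
  assumes "0 \<le> t"
  obtains P e where "\<And>n. adapted t (P n)"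
    "\<And>n::nat. ((\<lambda>s. (L2 (proc (P n) s - U s))\<^sup>2) has_integral e n) {0..t}"
    "e \<longlonglongrightarrow> 0" "(\<lambda>n. L2 (ito (P n) - Z t)) \<longlonglongrightarrow> 0"
  using ZD assms unfolding solution_integrals_def has_free_stochastic_integral_def by blast

text \<open>Martingale property. The approximating sequences for \<open>Z u\<close> and
  \<open>Z t\<close> are unrelated; after the first is cut at \<open>t\<close>, both are close to
  \<open>U\<close> on \<open>{0..t}\<close>, and the isometry bounds the difference of their
  integrals.\<close>

lemma Z_increment_trace:
  assumes tu: "0 \<le> t" "t \<le> u" and c: "c \<in> F t"
  shows "\<tau> (c * (Z u - Z t)) = 0"
proof -
  have u: "0 \<le> u" using tu by simp
  have cM: "c \<in> M" using F_in_M[OF tu(1) c] .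
  obtain P e where P: "\<And>n. adapted u (P n)"
    "\<And>n::nat. ((\<lambda>s. (L2 (proc (P n) s - U s))\<^sup>2) has_integral e n) {0..u}"
    "e \<longlonglongrightarrow> 0" "(\<lambda>n. L2 (ito (P n) - Z u)) \<longlonglongrightarrow> 0"
    using Z_approx[OF u] by blast
  obtain Q d where Q: "\<And>n. adapted t (Q n)"
    "\<And>n::nat. ((\<lambda>s. (L2 (proc (Q n) s - U s))\<^sup>2) has_integral d n) {0..t}"
    "d \<longlonglongrightarrow> 0" "(\<lambda>n. L2 (ito (Q n) - Z t)) \<longlonglongrightarrow> 0"
    using Z_approx[OF tu(1)] by blast
  note PM = simple_integral_in_M[OF P(1)] simple_integral_in_M[OF Q(1)]
  have bound: "cmod (\<tau> (c * (ito (P n) - ito (Q n))))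
      \<le> L2 c * sqrt (2 * e n + 2 * d n)" for n
  proof -
    obtain P' where P': "adapted t P'"
      "\<And>x. 0 \<le> x \<Longrightarrow> x < t \<Longrightarrow> proc P' x = proc (P n) x"
      "\<And>c. c \<in> F t \<Longrightarrow> \<tau> (c * ito P') = \<tau> (c * ito (P n))"
      using simple_process_cut[OF tu P(1)] by blast
    define H where "H = P' @ neg_process (Q n)"
    have H: "adapted t H" using P'(1) Q(1) by (simp add: H_def)
    have P'M: "ito P' \<in> M" by (rule simple_integral_in_M[OF P'(1)])
    have int: "(\<lambda>s. (L2 (proc (P n) s - U s))\<^sup>2) integrable_on {0..t}"
      by (rule integrable_subinterval_real[of _ 0 u]) (use P(2) tu in \<open>auto simp: integrable_on_def\<close>)
    have "integral {0..t} (\<lambda>s. (L2 (proc (P n) s - U s))\<^sup>2)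
        \<le> integral {0..u} (\<lambda>s. (L2 (proc (P n) s - U s))\<^sup>2)"
      by (rule integral_subset_le) (use P(2) int tu in \<open>auto simp: integrable_on_def\<close>)
    also have "\<dots> = e n" by (rule integral_unique[OF P(2)])
    finally have le: "integral {0..t} (\<lambda>s. (L2 (proc (P n) s - U s))\<^sup>2) \<le> e n" .
    have "(L2 (ito H))\<^sup>2
      \<le> 2 * integral {0..t} (\<lambda>s. (L2 (proc (P n) s - U s))\<^sup>2) + 2 * d n"
    proof (rule has_integral_le[OF ito_isometry[OF H]])
      show "((\<lambda>s. 2 * (L2 (proc (P n) s - U s))\<^sup>2
          + 2 * (L2 (proc (Q n) s - U s))\<^sup>2) has_integral
          2 * integral {0..t} (\<lambda>s. (L2 (proc (P n) s - U s))\<^sup>2) + 2 * d n) {0..t}"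
        by (intro has_integral_add has_integral_mult_right integrable_integral int Q)
      fix s assume s: "s \<in> {0..t}"
      show "(L2 (proc H s))\<^sup>2 \<le> 2 * (L2 (proc (P n) s - U s))\<^sup>2
          + 2 * (L2 (proc (Q n) s - U s))\<^sup>2"
      proof (cases "s < t")
        case True
        then have "proc H s = (proc (P n) s - U s) - (proc (Q n) s - U s)"
          using s P'(2) by (simp add: H_def)
        then show ?thesis
          using s simple_process_in_M[OF P(1)] simple_process_in_M[OF Q(1)]
          by (simp only: L2_norm_square_diff_le diff_closed U_in_M atLeastAtMost_iff)
      next
        case False
        then show ?thesis using simple_process_after[OF H] by simp
      qed
    qed
    then have "(L2 (ito H))\<^sup>2 \<le> 2 * e n + 2 * d n"
      using le by simp
    then have "L2 (ito H) \<le> sqrt (2 * e n + 2 * d n)"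
      by (rule real_le_rsqrt)
    moreover have "\<tau> (c * (ito (P n) - ito (Q n))) = \<tau> (c * ito H)"
      using P'(3)[OF c] cM PM P'M by (simp add: H_def algebra_simps trace_linear)
    moreover have "cmod (\<tau> (c * ito H)) \<le> L2 c * L2 (ito H)"
      by (rule trace_mult_le[OF cM simple_integral_in_M[OF H]])
    ultimately show ?thesis
      using mult_left_mono[of "L2 (ito H)" "sqrt (2 * e n + 2 * d n)" "L2 c"] cM
      by simp
  qed
  have main: "cmod (\<tau> (c * (Z u - Z t))) \<le> L2 c * L2 (ito (P n) - Z u)
    + L2 c * L2 (ito (Q n) - Z t) + L2 c * sqrt (2 * e n + 2 * d n)" for n
  proof -
    have "\<tau> (c * (Z u - Z t)) = \<tau> (c * (ito (P n) - ito (Q n)))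
      - \<tau> (c * (ito (P n) - Z u)) + \<tau> (c * (ito (Q n) - Z t))"
      using cM PM u tu by (simp add: algebra_simps trace_linear)
    moreover have "cmod (\<tau> (c * (ito (P n) - Z u))) \<le> L2 c * L2 (ito (P n) - Z u)"
      "cmod (\<tau> (c * (ito (Q n) - Z t))) \<le> L2 c * L2 (ito (Q n) - Z t)"
      using cM PM u tu by (simp_all add: trace_mult_le)
    moreover have "cmod (x - y + z) \<le> cmod x + cmod y + cmod z" for x y z
      using norm_triangle_ineq[of "x - y" z] norm_triangle_ineq4[of x y] by linarith
    ultimately show ?thesis using bound[of n] by (smt (verit))
  qed
  have "(\<lambda>n. L2 c * L2 (ito (P n) - Z u)
    + L2 c * L2 (ito (Q n) - Z t) + L2 c * sqrt (2 * e n + 2 * d n))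
    \<longlonglongrightarrow> L2 c * 0 + L2 c * 0 + L2 c * sqrt (2 * 0 + 2 * 0)"
    by (intro tendsto_intros P Q)
  then have "cmod (\<tau> (c * (Z u - Z t))) \<le> L2 c * 0 + L2 c * 0 + L2 c * sqrt (2 * 0 + 2 * 0)"
    by (rule LIMSEQ_le_const) (use main in blast)
  then show ?thesis by simp
qed

text \<open>Freezing the integrand at \<open>Y\<close> on \<open>{t..u}\<close>: by the isometry the
  error is the distance of \<open>U\<close> from \<open>Y\<close> over that interval. The factor
  \<open>sqrt 2\<close> is the price of \<open>(a - b)^2 \<le> 2 * a^2 + 2 * b^2\<close>.\<close>

lemma Z_increment_approx:
  assumes tu: "0 \<le> t" "t \<le> u" and Y: "Y \<in> F t"
    and k: "\<And>s. t \<le> s \<Longrightarrow> s \<le> u \<Longrightarrow> L2 (U s - Y) \<le> k" "k \<ge> 0"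
  shows "L2 (Z u - Z t - Y * (B u - B t)) \<le> sqrt 2 * k * sqrt (u - t)"
proof -
  have u: "0 \<le> u" using tu by simp
  have YM: "Y \<in> M" using F_in_M[OF tu(1) Y] .
  note BM = increment_in_M[OF tu]
  obtain P e where P: "\<And>n. adapted u (P n)"
    "\<And>n::nat. ((\<lambda>s. (L2 (proc (P n) s - U s))\<^sup>2) has_integral e n) {0..u}"
    "e \<longlonglongrightarrow> 0" "(\<lambda>n. L2 (ito (P n) - Z u)) \<longlonglongrightarrow> 0"
    using Z_approx[OF u] by blast
  obtain Q d where Q: "\<And>n. adapted t (Q n)"
    "\<And>n::nat. ((\<lambda>s. (L2 (proc (Q n) s - U s))\<^sup>2) has_integral d n) {0..t}"
    "d \<longlonglongrightarrow> 0" "(\<lambda>n. L2 (ito (Q n) - Z t)) \<longlonglongrightarrow> 0"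
    using Z_approx[OF tu(1)] by blast
  note PM = simple_integral_in_M[OF P(1)] simple_integral_in_M[OF Q(1)]
  let ?W = "\<lambda>n. ito (P n) - ito (Q n) - Y * (B u - B t)"
  have bound: "L2 (?W n) \<le> sqrt (2 * e n + 2 * (d n + (u - t) * k\<^sup>2))" for n
  proof -
    define H where "H = P n @ neg_process (Q n) @ [(t, u, - Y)]"
    have H: "adapted u H"
      using P(1) simple_adapted_mono[OF Q(1) tu(2)] tu F_uminus[OF tu(1) Y] by (simp add: H_def)
    \<comment> \<open>Dominates the squared norm of \<open>J\<close> below: the error of
      \<open>Q n\<close> before \<open>t\<close>, the freezing error from \<open>t\<close>
      on.\<close>
    define g where "g s = (if s < t then (L2 (proc (Q n) s - U s))\<^sup>2 else k\<^sup>2)" for s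
    have g1: "(g has_integral d n) {0..t}"
      by (rule has_integral_spike_finite[OF _ _ Q(2), of "{t}"]) (auto simp: g_def)
    have "((\<lambda>s. k\<^sup>2) has_integral (u - t) * k\<^sup>2) {t..u}"
      using has_integral_const_real[of "k\<^sup>2" t u] tu by simp
    then have "(g has_integral (u - t) * k\<^sup>2) {t..u}"
      by (rule has_integral_eq[rotated]) (auto simp: g_def)
    with g1 have g: "(g has_integral (d n + (u - t) * k\<^sup>2)) {0..u}"
      by (rule has_integral_combine[OF tu])
    have "(L2 (ito H))\<^sup>2 \<le> 2 * e n + 2 * (d n + (u - t) * k\<^sup>2)"
    proof (rule has_integral_le[OF ito_isometry[OF H]])
      show "((\<lambda>s. 2 * (L2 (proc (P n) s - U s))\<^sup>2 + 2 * g s)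
        has_integral 2 * e n + 2 * (d n + (u - t) * k\<^sup>2)) {0..u}"
        by (intro has_integral_add has_integral_mult_right P g)
      fix s assume s: "s \<in> {0..u}"
      define J where "J = proc (Q n) s + indicator {t..<u} s *\<^sub>R Y - U s"
      have m: "proc (P n) s \<in> M" "proc (Q n) s \<in> M" "U s \<in> M"
        using simple_process_in_M[OF P(1)] simple_process_in_M[OF Q(1)] s by auto
      have J: "J \<in> M" using m YM by (simp add: J_def)
      show "(L2 (proc H s))\<^sup>2 \<le> 2 * (L2 (proc (P n) s - U s))\<^sup>2 + 2 * g s"
      proof (cases "s < u")
        case True
        have "proc H s = (proc (P n) s - U s) - J"
          by (simp add: H_def J_def)
        then have "(L2 (proc H s))\<^sup>2
            \<le> 2 * (L2 (proc (P n) s - U s))\<^sup>2 + 2 * (L2 J)\<^sup>2"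
          using m J by (simp only: L2_norm_square_diff_le diff_closed)
        moreover have "(L2 J)\<^sup>2 \<le> g s"
        proof (cases "s < t")
          case False
          then have "J = Y - U s"
            using True simple_process_after[OF Q(1)] by (simp add: J_def)
          then have "L2 J \<le> k"
            using k(1)[of s] False True L2_norm_minus_commute[OF YM m(3)] by simp
          then show ?thesis using False J by (simp add: g_def power_mono)
        qed (simp add: g_def J_def)
        ultimately show ?thesis by simp
      next
        case False
        then show ?thesis using simple_process_after[OF H] by (simp add: g_def)
      qed
    qed
    moreover have "ito H = ?W n" by (simp add: H_def)
    ultimately show ?thesis by (simp add: real_le_rsqrt)
  qed
  have main: "L2 (Z u - Z t - Y * (B u - B t)) \<le> L2 (ito (P n) - Z u)
    + L2 (ito (Q n) - Z t) + sqrt (2 * e n + 2 * (d n + (u - t) * k\<^sup>2))" for n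
  proof -
    let ?p = "ito (P n) - Z u" and ?q = "ito (Q n) - Z t"
    have m: "?p \<in> M" "?q \<in> M" "?W n \<in> M" using PM u tu YM BM by simp_all
    have "L2 (Z u - Z t - Y * (B u - B t)) = L2 ((?W n + ?q) - ?p)"
      by (rule arg_cong[of _ _ "L2"]) (simp add: algebra_simps)
    moreover have "L2 ((?W n + ?q) - ?p) \<le> L2 (?W n + ?q) + L2 ?p"
      by (intro L2_norm_triangle_diff add_closed m)
    moreover have "L2 (?W n + ?q) \<le> L2 (?W n) + L2 ?q"
      by (intro L2_norm_triangle m)
    ultimately show ?thesis using bound[of n] by linarith
  qed
  have "(\<lambda>n. L2 (ito (P n) - Z u)
    + L2 (ito (Q n) - Z t) + sqrt (2 * e n + 2 * (d n + (u - t) * k\<^sup>2)))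
    \<longlonglongrightarrow> 0 + 0 + sqrt (2 * 0 + 2 * (0 + (u - t) * k\<^sup>2))"
    by (intro tendsto_intros P Q)
  then have "L2 (Z u - Z t - Y * (B u - B t)) \<le> 0 + 0 + sqrt (2 * 0 + 2 * (0 + (u - t) * k\<^sup>2))"
    by (rule LIMSEQ_le_const) (use main in blast)
  also have "\<dots> = sqrt 2 * k * sqrt (u - t)"
    using k(2) by (simp add: real_sqrt_mult)
  finally show ?thesis .
qed

end

end

section \<open>Right derivatives\<close>

lemma has_vector_derivative_right_iff:
  "(g has_vector_derivative G) (at t within {t<..}) \<longleftrightarrow>
    ((\<lambda>u. (1 / (u - t)) *\<^sub>R (g u - g t)) \<longlongrightarrow> G) (at_right t)"
proof -
  have "(1 / h) *\<^sub>R (a - (b + h *\<^sub>R c)) = (1 / h) *\<^sub>R (a - b) - c" if "h \<noteq> 0" for h and a b c :: 'a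
    using that by (simp add: algebra_simps)
  then have eq: "\<forall>\<^sub>F u in at_right t. (1 / norm (u - t)) *\<^sub>R (g u - (g t + (u - t) *\<^sub>R G))
      = (1 / (u - t)) *\<^sub>R (g u - g t) - G"
    unfolding eventually_at_filter
    by (intro always_eventually) auto
  have "(g has_vector_derivative G) (at t within {t<..}) \<longleftrightarrow>
    ((\<lambda>u. (1 / norm (u - t)) *\<^sub>R (g u - (g t + (u - t) *\<^sub>R G))) \<longlongrightarrow> 0) (at_right t)"
    by (simp add: has_vector_derivative_def has_derivative_within bounded_linear_scaleR_left)
  also have "\<dots> \<longleftrightarrow> ((\<lambda>u. (1 / (u - t)) *\<^sub>R (g u - g t) - G) \<longlongrightarrow> 0) (at_right t)"
    by (rule tendsto_cong[OF eq])
  finally show ?thesis by (simp add: Lim_null[of _ G])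
qed

text \<open>With vector values and only a right derivative, a continuation argument takes the place
  of the mean value theorem: the estimate \<open>norm (g y - g 0) \<le> e * y\<close> propagates
  from 0 to a last point, which cannot lie before \<open>T\<close>.\<close>

lemma constant_of_right_derivative_zero:
  fixes g :: "real \<Rightarrow> 'a::real_normed_vector"
  assumes cont: "continuous_on {0..} g"
    and der: "\<And>t. t \<ge> 0 \<Longrightarrow> ((\<lambda>u. (1 / (u - t)) *\<^sub>R (g u - g t)) \<longlongrightarrow> 0) (at_right t)"
    and T: "T \<ge> 0"
  shows "g T = g 0"
proof -
  have bound: "norm (g T - g 0) \<le> e * T" if e: "e > 0" for e
  proof -
    define C where "C = {y \<in> {0..T}. norm (g y - g 0) \<le> e * y}"
    have "closed C"
      unfolding C_def
      by (rule continuous_on_closed_Collect_le)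
        (auto intro!: continuous_intros continuous_on_subset[OF cont])
    define S where "S = {x \<in> {0..T}. {0..x} \<subseteq> C}"
    have S0: "0 \<in> S" using T by (auto simp: S_def C_def)
    have S_bdd: "bdd_above S" by (rule bdd_aboveI[of _ T]) (auto simp: S_def)
    define s where "s = Sup S"
    have s: "0 \<le> s" "s \<le> T"
      unfolding s_def
      by (rule cSup_upper[OF S0 S_bdd], rule cSup_least) (use S0 in \<open>auto simp: S_def\<close>)
    have below: "{0..<s} \<subseteq> C"
    proof
      fix y assume y: "y \<in> {0..<s}"
      then obtain x where "x \<in> S" "y < x"
        using less_cSup_iff[of S y] S0 S_bdd by (auto simp: s_def)
      then show "y \<in> C" using y by (auto simp: S_def)
    qed
    have "{0..s} \<subseteq> C"
    proof (cases "s = 0")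
      case False
      then have "closure {0..<s} = {0..s}" using s by simp
      then show ?thesis using closure_minimal[OF below \<open>closed C\<close>] by simp
    qed (use S0 in \<open>auto simp: S_def\<close>)
    then have sC: "s \<in> C" using s by auto
    have "s = T"
    proof (rule ccontr)
      assume "s \<noteq> T"
      then have "s < T" using s by simp
      have "\<forall>\<^sub>F u in at_right s. norm ((1 / (u - s)) *\<^sub>R (g u - g s)) < e"
        using tendstoD[OF der[OF s(1)] e] by simp
      then obtain d where d: "d > s" "\<And>u. s < u \<Longrightarrow> u < d \<Longrightarrow> norm ((1 / (u - s)) *\<^sub>R (g u - g s)) < e"
        by (auto simp: eventually_at_right_field)
      define x where "x = min T ((s + d) / 2)"
      have x: "s < x" "x \<le> T" "x < d"
        using \<open>s < T\<close> d(1) by (auto simp: x_def min_less_iff_disj)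
      have "{0..x} \<subseteq> C"
      proof
        fix u assume u: "u \<in> {0..x}"
        show "u \<in> C"
        proof (cases "u \<le> s")
          case True
          then show ?thesis using \<open>{0..s} \<subseteq> C\<close> u by auto
        next
          case False
          then have "norm (g u - g s) < e * (u - s)"
            using d(2)[of u] u x by (simp add: divide_less_eq mult.commute)
          moreover have "norm (g s - g 0) \<le> e * s" using sC by (simp add: C_def)
          moreover have "norm (g u - g 0) \<le> norm (g u - g s) + norm (g s - g 0)"
            using norm_triangle_ineq[of "g u - g s" "g s - g 0"] by simp
          ultimately have "norm (g u - g 0) \<le> e * u" by (simp add: algebra_simps)
          then show ?thesis using u x by (simp add: C_def)
        qed
      qed
      then have "x \<in> S" using x s by (simp add: S_def)
      then have "x \<le> s" unfolding s_def by (rule cSup_upper[OF _ S_bdd])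
      then show False using x by simp
    qed
    then show ?thesis using sC by (simp add: C_def)
  qed
  have "norm (g T - g 0) \<le> 0"
  proof (rule field_le_epsilon)
    fix e :: real assume e: "e > 0"
    \<comment> \<open>The \<open>+ 1\<close> keeps the divisor positive for
      \<open>T = 0\<close>.\<close>
    have "norm (g T - g 0) \<le> e / (T + 1) * T" using T e by (intro bound) simp
    also have "\<dots> \<le> e" using T e by (simp add: field_simps)
    finally show "norm (g T - g 0) \<le> 0 + e" by simp
  qed
  then show ?thesis by simp
qed

text \<open>Subtracting the primitive \<open>I\<close> of \<open>G\<close> leaves a function with
  right derivative 0, hence a constant; so \<open>g\<close> inherits the full derivative of
  \<open>I\<close>.\<close>

lemma has_vector_derivative_of_right_derivative:
  fixes g :: "real \<Rightarrow> 'a::banach"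
  assumes cont: "continuous_on {0..} g" and contG: "continuous_on {0..} G"
    and der: "\<And>t. t \<ge> 0 \<Longrightarrow> ((\<lambda>u. (1 / (u - t)) *\<^sub>R (g u - g t)) \<longlongrightarrow> G t) (at_right t)"
    and t: "t \<ge> 0"
  shows "(g has_vector_derivative G t) (at t within {0..})"
proof -
  define I where "I t = integral {0..t} G" for t
  have I: "(I has_vector_derivative G t) (at t within {0..})" if "t \<ge> 0" for t
  proof -
    have "(I has_vector_derivative G t) (at t within {0..t+1})"
      unfolding I_def using that
      by (intro integral_has_vector_derivative continuous_on_subset[OF contG]) auto
    moreover have "at t within {0..t+1} = at t within {0..}"
      by (rule at_within_nhd[of _ "{..<t+1}"]) auto
    ultimately show ?thesis by simp
  qed
  define h where "h t = g t - I t" for t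
  have "continuous_on {0..} I"
    unfolding continuous_on_eq_continuous_within
    by (auto intro: has_vector_derivative_continuous[OF I])
  then have "continuous_on {0..} h"
    unfolding h_def by (intro continuous_intros cont)
  moreover have "((\<lambda>u. (1 / (u - t)) *\<^sub>R (h u - h t)) \<longlongrightarrow> 0) (at_right t)" if "t \<ge> 0" for t
  proof -
    have "(I has_vector_derivative G t) (at t within {t<..})"
      by (rule has_vector_derivative_within_subset[OF I[OF that]]) (use that in auto)
    moreover have "(g has_vector_derivative G t) (at t within {t<..})"
      using der[OF that] by (simp add: has_vector_derivative_right_iff)
    ultimately have "(h has_vector_derivative (G t - G t)) (at t within {t<..})"
      unfolding h_def by (intro has_vector_derivative_diff)
    then show ?thesis by (simp add: has_vector_derivative_right_iff)
  qed
  ultimately have "h t = h 0" if "t \<ge> 0" for t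
    using constant_of_right_derivative_zero that by blast
  then have g: "g s = h 0 + I s" if "s \<ge> 0" for s
    using that by (simp add: h_def algebra_simps)
  have "((\<lambda>s. h 0 + I s) has_vector_derivative (0 + G t)) (at t within {0..})"
    by (intro has_vector_derivative_add has_vector_derivative_const I t)
  then have "((\<lambda>s. h 0 + I s) has_vector_derivative G t) (at t within {0..})"
    by simp
  then show ?thesis
    by (rule has_vector_derivative_transform[rotated 2]) (simp_all add: t g)
qed

section \<open>The free unitary Brownian motion\<close>

context free_unitary_diffusion
begin

text \<open>\<open>\<tau>\<close> is linear on \<open>M\<close> only and not on the whole type, so
  the rule for bounded linear maps does not apply to it; the difference quotient is treated
  directly.\<close>

lemma trace_has_vector_derivative:
  assumes G: "(G has_vector_derivative G') (at x within S)"
    and M: "\<And>y. y \<in> S \<Longrightarrow> G y \<in> M" "G x \<in> M" "G' \<in> M"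
  shows "((\<lambda>y. \<tau> (G y)) has_vector_derivative \<tau> G') (at x within S)"
proof -
  have S: "\<forall>\<^sub>F y in at x within S. y \<in> S"
    by (auto simp: eventually_at_filter)
  have "((\<lambda>y. (1 / norm (y - x)) *\<^sub>R (G y - (G x + (y - x) *\<^sub>R G'))) \<longlongrightarrow> 0) (at x within S)"
    using G by (simp add: has_vector_derivative_def has_derivative_within)
  then have "((\<lambda>y. \<tau> ((1 / norm (y - x)) *\<^sub>R (G y - (G x + (y - x) *\<^sub>R G')))) \<longlongrightarrow> \<tau> 0) (at x within S)"
    by (rule tendsto_trace) (use S in eventually_elim, simp_all add: M)
  moreover have "\<forall>\<^sub>F y in at x within S. \<tau> ((1 / norm (y - x)) *\<^sub>R (G y - (G x + (y - x) *\<^sub>R G')))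
      = (1 / norm (y - x)) *\<^sub>R (\<tau> (G y) - (\<tau> (G x) + (y - x) *\<^sub>R \<tau> G'))"
    using S by eventually_elim (simp add: M trace_linear scaleR_conv_of_real)
  ultimately show ?thesis
    by (simp add: has_vector_derivative_def has_derivative_within bounded_linear_scaleR_left
        tendsto_cong)
qed

lemma U_diff:
  assumes "solution_integrals Z D" "0 \<le> t" "0 \<le> u"
  shows "U u - U t = scale_bop \<i> (Z u - Z t) - (1/2) *\<^sub>R (D u - D t)"
  by (simp add: U_eq[OF assms(1)] assms(2,3) algebra_simps scale_bop_diff_right)

text \<open>Against an element of \<open>F t\<close> the stochastic integral drops out by the
  martingale property, so \<open>\<tau> (b * U s)\<close> solves \<open>y' = - y / 2\<close>. In
  effect the conditional expectation of \<open>U u\<close> is \<open>exp (- (u - t) / 2)\<close>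
  times \<open>U t\<close>.\<close>

lemma trace_U:
  assumes tu: "0 \<le> t" "t \<le> u" and b: "b \<in> F t"
  shows "\<tau> (b * U u) = of_real (exp (- (u - t) / 2)) * \<tau> (b * U t)"
proof -
  obtain Z D where ZD: "solution_integrals Z D" using solution_integrals_exist .
  have bM: "b \<in> M" using F_in_M[OF tu(1) b] .
  have g: "\<tau> (b * U s) = \<tau> (b * U t) - (1/2) * (\<tau> (b * D s) - \<tau> (b * D t))" if s: "t \<le> s" for s
  proof -
    have "b * (U s - U t) = scale_bop \<i> (b * (Z s - Z t)) - (1/2) *\<^sub>R (b * D s - b * D t)"
      using U_diff[OF ZD, of t s] s tu
      by (simp add: scale_bop_mult_right right_diff_distrib)
    then have "b * U s = b * U t + scale_bop \<i> (b * (Z s - Z t)) - (1/2) *\<^sub>R (b * D s - b * D t)"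
      by (simp add: right_diff_distrib diff_eq_eq algebra_simps)
    moreover have "\<tau> (b * (Z s - Z t)) = 0" by (rule Z_increment_trace[OF ZD tu(1) s b])
    ultimately show ?thesis
      using bM s tu Z_in_M[OF ZD] D_in_M[OF ZD] by (simp add: trace_linear)
  qed
  have D: "(D has_vector_derivative U s) (at s within {t..u})" if s: "s \<in> {t..u}" for s
  proof -
    have "((\<lambda>s. integral {0..s} U) has_vector_derivative U s) (at s within {0..u})"
      using s tu by (intro integral_has_vector_derivative continuous_on_subset[OF continuous_U]) auto
    then have "((\<lambda>s. integral {0..s} U) has_vector_derivative U s) (at s within {t..u})"
      by (rule has_vector_derivative_within_subset) (use tu in auto)
    then show ?thesis
      by (rule has_vector_derivative_transform[OF s, rotated])
        (use tu in \<open>auto simp: integral_unique[OF D_integral[OF ZD]]\<close>)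
  qed
  have der: "((\<lambda>s. \<tau> (b * U s)) has_vector_derivative - (1/2) * \<tau> (b * U s)) (at s within {t..u})"
    if s: "s \<in> {t..u}" for s
  proof -
    have "((\<lambda>s. b * D s) has_vector_derivative b * U s) (at s within {t..u})"
      by (rule bounded_linear.has_vector_derivative[OF bounded_linear_mult_right D[OF s]])
    then have "((\<lambda>s. \<tau> (b * D s)) has_vector_derivative \<tau> (b * U s)) (at s within {t..u})"
      by (rule trace_has_vector_derivative) (use bM s tu D_in_M[OF ZD] in auto)
    then have "((\<lambda>s. \<tau> (b * U t) - (1/2) * (\<tau> (b * D s) - \<tau> (b * D t))) has_vector_derivative
        - (1/2) * \<tau> (b * U s)) (at s within {t..u})"
      by (auto intro!: derivative_eq_intros)
    then show ?thesis
      by (rule has_vector_derivative_transform[OF s, rotated]) (rule g, simp)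
  qed
  have z: "((\<lambda>s. exp ((s - t) / 2) *\<^sub>R \<tau> (b * U s)) has_vector_derivative 0) (at s within {t..u})"
    if s: "s \<in> {t..u}" for s
  proof -
    have "((\<lambda>s. exp ((s - t) / 2)) has_real_derivative (exp ((s - t) / 2) * (1/2))) (at s within {t..u})"
      by (auto intro!: derivative_eq_intros)
    from has_vector_derivative_scaleR[OF this der[OF s]] show ?thesis
      by (simp add: scaleR_conv_of_real)
  qed
  obtain c where c: "\<And>s. s \<in> {t..u} \<Longrightarrow> exp ((s - t) / 2) *\<^sub>R \<tau> (b * U s) = c"
    using has_vector_derivative_zero_constant[OF convex_real_interval(5) z] by blast
  have "exp ((u - t) / 2) *\<^sub>R \<tau> (b * U u) = c" "exp ((t - t) / 2) *\<^sub>R \<tau> (b * U t) = c"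
    by (rule c, use tu in simp)+
  then have eq: "exp ((u - t) / 2) *\<^sub>R \<tau> (b * U u) = \<tau> (b * U t)"
    by simp
  have "exp (- (u - t) / 2) * exp ((u - t) / 2) = 1"
    by (simp add: field_simps flip: exp_add)
  then have "\<tau> (b * U u) = exp (- (u - t) / 2) *\<^sub>R (exp ((u - t) / 2) *\<^sub>R \<tau> (b * U u))"
    by (simp only: scaleR_scaleR scaleR_one)
  then have "\<tau> (b * U u) = exp (- (u - t) / 2) *\<^sub>R \<tau> (b * U t)"
    by (simp only: eq)
  then show ?thesis
    by (simp only: scaleR_conv_of_real)
qed

text \<open>The free analogue of a standard Gaussian increment, with \<open>L2\<close> norm 1, so
  that traces with two of them are of order one.\<close>

definition gauss :: "real \<Rightarrow> real \<Rightarrow> 'h bop"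
  where "gauss t u = (1 / sqrt (u - t)) *\<^sub>R (B u - B t)"

lemma gauss_in_M [simp]: "0 \<le> t \<Longrightarrow> t \<le> u \<Longrightarrow> gauss t u \<in> M"
  by (simp add: gauss_def increment_in_M)

lemma adj_gauss: "0 \<le> t \<Longrightarrow> t \<le> u \<Longrightarrow> adj (gauss t u) = gauss t u"
  by (simp add: gauss_def adj_B)

lemma gauss_trace2:
  assumes "0 \<le> t" "t < u" "c \<in> F t" "d \<in> F t"
  shows "\<tau> (c * gauss t u * d * gauss t u) = \<tau> c * \<tau> d"
proof -
  have M: "c \<in> M" "d \<in> M" "B u - B t \<in> M" using assms F_in_M[OF assms(1)] increment_in_M[of t u] by auto
  have "c * gauss t u * d * gauss t u = (1 / (u - t)) *\<^sub>R (c * (B u - B t) * d * (B u - B t))"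
    using assms by (simp add: gauss_def)
  then show ?thesis
    using M assms increment_trace2[of t u c d] by (simp add: trace_scaleR flip: of_real_diff)
qed

lemma L2_norm_gauss: "0 \<le> t \<Longrightarrow> t < u \<Longrightarrow> L2 (gauss t u) = 1"
  using gauss_trace2[of t u 1 1] star_algebra.one_closed[OF F_algebra, of t]
  by (simp add: L2_norm_def adj_gauss unit)

lemma eventually_gt: "\<forall>\<^sub>F u in at_right t. t < u" for t :: real
  by (auto simp: eventually_at_filter)

text \<open>On the scale \<open>sqrt (u - t)\<close> the drift, of order \<open>u - t\<close>,
  disappears, and freezing the integrand at \<open>U t\<close> costs an arbitrarily small multiple
  because \<open>U\<close> is norm continuous.\<close>

lemma U_increment_approx:
  assumes t: "0 \<le> t"
  shows "((\<lambda>u. L2 ((1 / sqrt (u - t)) *\<^sub>R (U u - U t) - scale_bop \<i> (U t * gauss t u))) \<longlongrightarrow> 0) (at_right t)"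
proof -
  obtain Z D where ZD: "solution_integrals Z D" using solution_integrals_exist .
  let ?E = "\<lambda>u. L2 ((1 / sqrt (u - t)) *\<^sub>R (U u - U t) - scale_bop \<i> (U t * gauss t u))"
  have bound: "\<forall>\<^sub>F u in at_right t. ?E u \<le> sqrt 2 * e + (1/2) * (norm (U t) + e) * sqrt (u - t)" if e: "e > 0" for e
  proof -
    have "(U \<longlongrightarrow> U t) (at t within {0..})"
      using continuous_U t by (simp add: continuous_on_def)
    then have "(U \<longlongrightarrow> U t) (at_right t)"
      by (rule tendsto_within_subset) (use t in auto)
    from tendstoD[OF this e] obtain d where d: "d > t" "\<And>s. t < s \<Longrightarrow> s < d \<Longrightarrow> dist (U s) (U t) < e"
      by (auto simp: eventually_at_right_field)
    have close: "norm (U s - U t) \<le> e" if "t \<le> s" "s < d" for s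
      using d(2)[of s] that e by (cases "s = t") (auto simp: dist_norm)
    have "\<forall>\<^sub>F u in at_right t. t < u \<and> u < d"
      using d(1) by (auto simp: eventually_at_right_field)
    then show ?thesis
    proof eventually_elim
      case (elim u)
      then have tu: "t < u" "u < d" by auto
      define r where "r = sqrt (u - t)"
      have r: "r > 0" "u - t = r * r" using tu by (simp_all add: r_def)
      have M: "U u \<in> M" "U t \<in> M" "Z u \<in> M" "Z t \<in> M" "D u \<in> M" "D t \<in> M" "B u - B t \<in> M"
        using t tu Z_in_M[OF ZD] D_in_M[OF ZD] increment_in_M[of t u] by simp_all
      let ?X = "Z u - Z t - U t * (B u - B t)"
      have X: "L2 ?X \<le> sqrt 2 * e * r"
        unfolding r_def
      proof (rule Z_increment_approx[OF ZD t _ U_in_F[OF t]])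
        show "L2 (U s - U t) \<le> e" if "t \<le> s" "s \<le> u" for s
          using close[of s] L2_norm_le_norm[of "U s - U t"] that tu t by simp
      qed (use tu e in auto)
      have DD: "norm (D u - D t) \<le> (norm (U t) + e) * (u - t)"
      proof -
        have "D u = D t + integral {t..u} U"
        proof -
          have "U integrable_on {0..u}" using D_integral[OF ZD, of u] t tu by (auto simp: integrable_on_def)
          from Henstock_Kurzweil_Integration.integral_combine[OF _ _ this, of t]
          show ?thesis
            using t tu D_integral[OF ZD, of u] D_integral[OF ZD, of t] by (simp add: integral_unique)
        qed
        moreover have "norm (integral {t..u} U) \<le> (norm (U t) + e) * (u - t)"
        proof (rule integral_bound)
          show "continuous_on {t..u} U" by (rule continuous_on_subset[OF continuous_U]) (use t in auto)
          show "norm (U s) \<le> norm (U t) + e" if "s \<in> {t..u}" for s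
            using close[of s] norm_triangle_sub[of "U s" "U t"] that tu by simp
        qed (use tu in auto)
        ultimately show ?thesis by simp
      qed
      have "scale_bop \<i> (U t * gauss t u) = (1 / r) *\<^sub>R scale_bop \<i> (U t * (B u - B t))"
        by (simp add: gauss_def r_def scale_bop_scaleR)
      then have "(1 / r) *\<^sub>R (U u - U t) - scale_bop \<i> (U t * gauss t u)
          = scale_bop \<i> ((1 / r) *\<^sub>R ?X) - (1 / r) *\<^sub>R (1/2) *\<^sub>R (D u - D t)"
        using U_diff[OF ZD, of t u] t tu
        by (simp add: scale_bop_diff_right scale_bop_scaleR scaleR_diff_right)
      then have "?E u \<le> L2 (scale_bop \<i> ((1 / r) *\<^sub>R ?X)) + L2 ((1 / r) *\<^sub>R (1/2) *\<^sub>R (D u - D t))"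
        using M by (simp only: r_def[symmetric]) (intro L2_norm_triangle_diff, simp_all)
      also have "\<dots> = (1 / r) * L2 ?X + (1 / r) * (1/2) * L2 (D u - D t)"
        using M r by (simp add: L2_norm_scale L2_norm_scaleR)
      also have "\<dots> \<le> (1 / r) * (sqrt 2 * e * r) + (1 / r) * (1/2) * ((norm (U t) + e) * (r * r))"
        using X DD r L2_norm_le_norm[of "D u - D t"] M
        by (intro add_mono mult_left_mono) auto
      also have "\<dots> = sqrt 2 * e + (1/2) * (norm (U t) + e) * r" using r by simp
      finally show ?case by (simp add: r_def)
    qed
  qed
  show ?thesis
  proof (rule tendstoI)
    fix e :: real assume e: "e > 0"
    \<comment> \<open>With \<open>e / 2\<close> the first summand is
      \<open>sqrt 2 * (e / 2) < e\<close>, which leaves room for the second, vanishing one.\<close>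
    have lim: "((\<lambda>u. sqrt 2 * (e / 2) + (1/2) * (norm (U t) + e / 2) * sqrt (u - t)) \<longlongrightarrow>
        sqrt 2 * (e / 2) + (1/2) * (norm (U t) + e / 2) * sqrt (t - t)) (at_right t)"
      by (intro tendsto_intros)
    have "sqrt 2 < 2" using real_sqrt_less_mono[of 2 4] by simp
    then have "sqrt 2 * (e / 2) < e" using e by simp
    then have "\<forall>\<^sub>F u in at_right t. sqrt 2 * (e / 2) + (1/2) * (norm (U t) + e / 2) * sqrt (u - t) < e"
      by (intro order_tendstoD(2)[OF lim]) simp
    moreover have "\<forall>\<^sub>F u in at_right t. ?E u \<le> sqrt 2 * (e / 2) + (1/2) * (norm (U t) + e / 2) * sqrt (u - t)"
      by (rule bound) (use e in simp)
    ultimately show "\<forall>\<^sub>F u in at_right t. dist (?E u) 0 < e"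
      using eventually_gt[of t]
    proof eventually_elim
      case (elim u)
      have "?E u \<ge> 0" using t elim(3) by (intro L2_norm_nonneg) simp
      then show ?case using elim by (simp add: dist_real_def)
    qed
  qed
qed

end

context wstar_probability_space
begin

lemma continuous_on_trace:
  assumes "continuous_on S G" "\<And>x. x \<in> S \<Longrightarrow> G x \<in> M"
  shows "continuous_on S (\<lambda>x. \<tau> (G x))"
  unfolding continuous_on_def
proof
  fix x assume x: "x \<in> S"
  show "((\<lambda>x. \<tau> (G x)) \<longlongrightarrow> \<tau> (G x)) (at x within S)"
  proof (rule tendsto_trace)
    show "(G \<longlongrightarrow> G x) (at x within S)" using assms(1) x by (simp add: continuous_on_def)
    show "\<forall>\<^sub>F u in at x within S. G u \<in> M"
      using assms(2) by (auto simp: eventually_at_filter)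
    show "G x \<in> M" by (rule assms(2)[OF x])
  qed
qed

end

lemma exp_difference_quotient:
  "((\<lambda>u. (exp (- (u - t) / 2) - 1) / (u - t)) \<longlongrightarrow> - 1 / 2) (at_right (t :: real))"
proof -
  have "((\<lambda>u. exp (- (u - t) / 2)) has_real_derivative (- 1 / 2)) (at t within {t<..})"
    by (auto intro!: derivative_eq_intros)
  then show ?thesis by (simp add: has_field_derivative_iff)
qed

lemma scale_bop_zero_right [simp]: "scale_bop c 0 = 0"
  by (metis scale_bop_scale_bop scale_bop_zero mult_zero_right)

context free_unitary_diffusion
begin

subsection \<open>Unitarity\<close>

text \<open>Adapted simple processes up to time 0 live on empty intervals, so their integrals vanish
  and with them the limit \<open>Z 0\<close>.\<close>

lemma U_0: "U 0 = 1"
proof -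
  obtain Z D where ZD: "solution_integrals Z D" using solution_integrals_exist .
  have int0: "ito P = 0" if "adapted 0 P" for P
    using that
  proof (induction P)
    case (Cons p P)
    obtain a b Y where p: "p = (a, b, Y)" by (cases p)
    have "a = b" using Cons.prems by (simp add: p)
    then show ?case using Cons by (simp add: p)
  qed simp
  obtain P :: "nat \<Rightarrow> _" where P: "\<And>n. adapted 0 (P n)"
    "(\<lambda>n. L2 (ito (P n) - Z 0)) \<longlonglongrightarrow> 0"
    using Z_approx[OF ZD order_refl] by metis
  have "L2 (Z 0) = 0"
    using P(2) Z_in_M[OF ZD order_refl]
    by (simp add: int0[OF P(1)] L2_norm_uminus LIMSEQ_const_iff)
  then have "Z 0 = 0" using L2_norm_eq_0 Z_in_M[OF ZD] by blast
  moreover have "D 0 = 0"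
    using D_integral[OF ZD, of 0] has_integral_null_real[of 0 0] by (auto dest: has_integral_unique)
  ultimately show ?thesis using U_eq[OF ZD, of 0] by simp
qed

lemma tendsto_U_right: "0 \<le> t \<Longrightarrow> (U \<longlongrightarrow> U t) (at_right t)"
  using continuous_U by (auto simp: continuous_on_def intro: tendsto_within_subset)

lemma trace_increment_quotient:
  assumes t: "0 \<le> t" and b: "b \<in> F t"
  shows "((\<lambda>u. \<tau> (b * (U u - U t)) / of_real (u - t)) \<longlongrightarrow> - (1/2) * \<tau> (b * U t)) (at_right t)"
proof -
  have bM: "b \<in> M" using F_in_M[OF t b] .
  have "((\<lambda>u. of_real ((exp (- (u - t) / 2) - 1) / (u - t)) * \<tau> (b * U t)) \<longlongrightarrow>
      of_real (- 1 / 2) * \<tau> (b * U t)) (at_right t)"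
    by (intro tendsto_intros tendsto_of_real exp_difference_quotient)
  moreover have "\<forall>\<^sub>F u in at_right t. of_real ((exp (- (u - t) / 2) - 1) / (u - t)) * \<tau> (b * U t)
      = \<tau> (b * (U u - U t)) / of_real (u - t)"
    using eventually_gt[of t]
  proof eventually_elim
    case (elim u)
    have "\<tau> (b * (U u - U t)) = (of_real (exp (- (u - t) / 2)) - 1) * \<tau> (b * U t)"
      using trace_U[OF t _ b, of u] elim t bM by (simp add: right_diff_distrib trace_linear left_diff_distrib)
    then show ?case by simp
  qed
  ultimately have "((\<lambda>u. \<tau> (b * (U u - U t)) / of_real (u - t)) \<longlongrightarrow>
      of_real (- 1 / 2) * \<tau> (b * U t)) (at_right t)"
    by (simp only: tendsto_cong)
  then show ?thesis by simp
qed

text \<open>Ito's formula for the product of \<open>U\<close> and \<open>adj U\<close>, in two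
  strengths. At order \<open>sqrt (u - t)\<close> the noise terms cancel since \<open>gauss\<close>
  is self-adjoint and \<open>\<i>\<close> is imaginary; at order \<open>u - t\<close>, tested
  against the past, the two drifts \<open>- 1/2\<close> cancel the quadratic variation.\<close>

lemma U_adj_U_increment:
  assumes t: "0 \<le> t"
  defines "K \<equiv> \<lambda>u. U u * adj (U u)"
  shows "((\<lambda>u. L2 ((1 / sqrt (u - t)) *\<^sub>R (K u - K t))) \<longlongrightarrow> 0) (at_right t)"
    and "c \<in> F t \<Longrightarrow> ((\<lambda>u. \<tau> (c * (K u - K t)) / of_real (u - t)) \<longlongrightarrow> 0) (at_right t)"
proof -
  define X where "X u = (1 / sqrt (u - t)) *\<^sub>R (U u - U t)" for u
  define V where "V u = scale_bop \<i> (U t * gauss t u)" for u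
  have XV: "((\<lambda>u. L2 (X u - V u)) \<longlongrightarrow> 0) (at_right t)"
    unfolding X_def V_def by (rule U_increment_approx[OF t])
  have XM: "X u \<in> M" and VM: "V u \<in> M" if "t < u" for u
    using that t by (simp_all add: X_def V_def)
  have UM: "U t \<in> M" using t by simp
  have VC: "L2 (V u) \<le> norm (U t)" if "t < u" for u
    using L2_norm_mult_left[of "U t" "gauss t u"] that t by (simp add: V_def L2_norm_scale L2_norm_gauss)
  have dU: "((\<lambda>u. norm (U u - U t)) \<longlongrightarrow> 0) (at_right t)"
    using tendsto_U_right[OF t] by (simp add: tendsto_norm_zero_iff Lim_null[of U])
  show "((\<lambda>u. L2 ((1 / sqrt (u - t)) *\<^sub>R (K u - K t))) \<longlongrightarrow> 0) (at_right t)"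
  proof (rule Lim_null_comparison)
    have "((\<lambda>u. 2 * norm (U t) * L2 (X u - V u) + (L2 (X u - V u) + norm (U t)) * norm (U u - U t)) \<longlongrightarrow>
      2 * norm (U t) * 0 + (0 + norm (U t)) * 0) (at_right t)"
      by (intro tendsto_intros XV dU)
    then show "((\<lambda>u. 2 * norm (U t) * L2 (X u - V u) + (L2 (X u - V u) + norm (U t)) * norm (U u - U t)) \<longlongrightarrow> 0) (at_right t)"
      by simp
    show "\<forall>\<^sub>F u in at_right t. norm (L2 ((1 / sqrt (u - t)) *\<^sub>R (K u - K t)))
        \<le> 2 * norm (U t) * L2 (X u - V u) + (L2 (X u - V u) + norm (U t)) * norm (U u - U t)"
      using eventually_gt[of t]
    proof eventually_elim
      case (elim u)
      note m = XM[OF elim] VM[OF elim] UM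
      have uM: "U u \<in> M" using elim t by simp
      let ?A = "(X u - V u) * adj (U t)" and ?A' = "U t * adj (X u - V u)" and ?C = "X u * adj (U u - U t)"
      have cancel: "V u * adj (U t) + U t * adj (V u) = 0"
        using t elim by (simp add: V_def scale_bop_mult_left scale_bop_mult_right scale_bop_minus_left
            adj_gauss mult.assoc)
      have "K u - K t = (U u - U t) * adj (U t) + U t * adj (U u - U t) + (U u - U t) * adj (U u - U t)"
        by (simp add: K_def algebra_simps)
      then have "(1 / sqrt (u - t)) *\<^sub>R (K u - K t) = X u * adj (U t) + U t * adj (X u) + ?C"
        by (simp add: X_def scaleR_add_right del: adj_diff)
      also have "\<dots> = ?A + ?A' + ?C + (V u * adj (U t) + U t * adj (V u))"
        by (simp add: algebra_simps)
      finally have eq: "(1 / sqrt (u - t)) *\<^sub>R (K u - K t) = ?A + ?A' + ?C" by (simp add: cancel)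
      have "L2 (?A + ?A' + ?C) \<le> L2 (?A + ?A') + L2 ?C"
        using m uM by (intro L2_norm_triangle) simp_all
      moreover have "L2 (?A + ?A') \<le> L2 ?A + L2 ?A'"
        using m uM by (intro L2_norm_triangle) simp_all
      moreover have "L2 ?A \<le> norm (U t) * L2 (X u - V u)"
        using L2_norm_mult_right[of "X u - V u" "adj (U t)"] m by (simp add: mult.commute)
      moreover have "L2 ?A' \<le> norm (U t) * L2 (X u - V u)"
        using L2_norm_mult_left[of "U t" "adj (X u - V u)"] L2_norm_adj[of "X u - V u"] m
        by (simp del: adj_diff)
      moreover have "L2 ?C \<le> L2 (X u) * norm (U u - U t)"
        using L2_norm_mult_right[of "X u" "adj (U u - U t)"] m uM by (simp del: adj_diff)
      moreover have "L2 (X u) * norm (U u - U t) \<le> (L2 (X u - V u) + norm (U t)) * norm (U u - U t)"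
        using L2_norm_bound_shift[of "X u" "V u"] m VC[OF elim] by (intro mult_right_mono) auto
      moreover have "L2 (?A + ?A' + ?C) \<ge> 0" using m uM by (intro L2_norm_nonneg) simp
      ultimately have "\<bar>L2 (?A + ?A' + ?C)\<bar>
          \<le> 2 * norm (U t) * L2 (X u - V u) + (L2 (X u - V u) + norm (U t)) * norm (U u - U t)"
        by linarith
      then show ?case unfolding eq by simp
    qed
  qed
  assume c: "c \<in> F t"
  have cM: "c \<in> M" using F_in_M[OF t c] .
  define l where "l = \<tau> (adj (U t) * c * U t)"
  have cF: "adj (U t) * c \<in> F t" "adj (U t) * adj c \<in> F t"
    using t c by (auto intro!: F_mult F_adj U_in_F)
  have 1: "((\<lambda>u. \<tau> (adj (U t) * c * (U u - U t)) / of_real (u - t)) \<longlongrightarrow> - (1/2) * l) (at_right t)"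
    unfolding l_def by (rule trace_increment_quotient[OF t cF(1)])
  have "((\<lambda>u. cnj (\<tau> (adj (U t) * adj c * (U u - U t)) / of_real (u - t))) \<longlongrightarrow>
      cnj (- (1/2) * \<tau> (adj (U t) * adj c * U t))) (at_right t)"
    by (intro tendsto_cnj trace_increment_quotient[OF t cF(2)])
  moreover have "cnj (\<tau> (adj (U t) * adj c * U t)) = l"
    using UM cM by (subst trace_adj[symmetric]) (simp_all add: l_def mult.assoc)
  ultimately have 2: "((\<lambda>u. cnj (\<tau> (adj (U t) * adj c * (U u - U t)) / of_real (u - t))) \<longlongrightarrow> - (1/2) * l) (at_right t)"
    by simp
  \<comment> \<open>The quadratic variation: its limit is the same \<open>l\<close> that the two
    drift terms contribute with factor \<open>- 1/2\<close> each.\<close>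
  have 3: "((\<lambda>u. \<tau> (c * X u * 1 * adj (X u))) \<longlongrightarrow> l) (at_right t)"
  proof (rule tendsto_trace_quad[where X' = V and Y' = "\<lambda>u. adj (V u)" and C = "norm (U t)"])
    show "((\<lambda>u. L2 (adj (X u) - adj (V u))) \<longlongrightarrow> 0) (at_right t)"
    proof (rule Lim_transform_eventually[OF XV])
      show "\<forall>\<^sub>F u in at_right t. L2 (X u - V u) = L2 (adj (X u) - adj (V u))"
        using eventually_gt[of t]
        by eventually_elim (use XM VM L2_norm_adj in \<open>simp flip: adj_diff\<close>)
    qed
    show "\<forall>\<^sub>F u in at_right t. X u \<in> M \<and> V u \<in> M \<and> adj (X u) \<in> M \<and> adj (V u) \<in> M \<and> c \<in> M \<and> 1 \<in> M
        \<and> L2 (V u) \<le> norm (U t) \<and> L2 (adj (V u)) \<le> norm (U t)"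
      using eventually_gt[of t]
      by eventually_elim (use XM VM VC cM in simp)
    have "\<forall>\<^sub>F u in at_right t. \<tau> (c * V u * 1 * adj (V u)) = l"
      using eventually_gt[of t]
    proof eventually_elim
      case (elim u)
      let ?G = "gauss t u"
      have G: "?G \<in> M" using elim t by simp
      have "c * V u * 1 * adj (V u) = (c * U t * ?G * ?G) * adj (U t)"
        using t elim by (simp add: V_def scale_bop_mult
            adj_gauss mult.assoc)
      then have "\<tau> (c * V u * 1 * adj (V u)) = \<tau> (adj (U t) * (c * U t * ?G * ?G))"
        using tracial[of "c * U t * ?G * ?G" "adj (U t)"] cM UM G by simp
      also have "\<dots> = \<tau> ((adj (U t) * c * U t) * ?G * 1 * ?G)" by (simp add: mult.assoc)
      also have "\<dots> = l"
        using gauss_trace2[of t u "adj (U t) * c * U t" 1] t elim cF U_in_F[OF t] F_algebra[OF t]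
        by (simp add: l_def unit F_mult star_algebra.one_closed)
      finally show ?case .
    qed
    then show "((\<lambda>u. \<tau> (c * V u * 1 * adj (V u))) \<longlongrightarrow> l) (at_right t)"
      by (simp add: tendsto_eventually)
  qed (use XV cM in simp_all)
  have "((\<lambda>u. \<tau> (adj (U t) * c * (U u - U t)) / of_real (u - t)
      + cnj (\<tau> (adj (U t) * adj c * (U u - U t)) / of_real (u - t)) + \<tau> (c * X u * 1 * adj (X u))) \<longlongrightarrow>
      - (1/2) * l + - (1/2) * l + l) (at_right t)"
    by (intro tendsto_add 1 2 3)
  moreover have "\<forall>\<^sub>F u in at_right t. \<tau> (adj (U t) * c * (U u - U t)) / of_real (u - t)
      + cnj (\<tau> (adj (U t) * adj c * (U u - U t)) / of_real (u - t)) + \<tau> (c * X u * 1 * adj (X u))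
      = \<tau> (c * (K u - K t)) / of_real (u - t)"
    using eventually_gt[of t]
  proof eventually_elim
    case (elim u)
    define E where "E = U u - U t"
    have EM: "E \<in> M" using elim t by (simp add: E_def)
    have "c * (K u - K t) = c * E * adj (U t) + c * U t * adj E + c * E * adj E"
      by (simp add: K_def E_def algebra_simps)
    then have "\<tau> (c * (K u - K t)) = \<tau> (c * E * adj (U t)) + \<tau> (c * U t * adj E) + \<tau> (c * E * adj E)"
      using EM UM cM by (simp add: add)
    moreover have "\<tau> (c * E * adj (U t)) = \<tau> (adj (U t) * c * E)"
      using tracial[of "c * E" "adj (U t)"] EM UM cM by (simp add: mult.assoc)
    moreover have "cnj (\<tau> (adj (U t) * adj c * E)) = \<tau> (c * U t * adj E)"
    proof -
      have "cnj (\<tau> (adj (U t) * adj c * E)) = \<tau> (adj E * (c * U t))"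
        using EM UM cM by (subst trace_adj[symmetric]) (simp_all add: mult.assoc)
      then show ?thesis using tracial[of "adj E" "c * U t"] EM UM cM by simp
    qed
    moreover have "\<tau> (c * X u * 1 * adj (X u)) = \<tau> (c * E * adj E) / of_real (u - t)"
    proof -
      have "c * X u * 1 * adj (X u) = (1 / (u - t)) *\<^sub>R (c * E * adj E)"
        using elim by (simp add: X_def E_def[symmetric] del: adj_diff)
      then show ?thesis using EM cM by (simp add: trace_scaleR)
    qed
    ultimately show ?case
      by (simp add: E_def[symmetric] add_divide_distrib)
  qed
  ultimately show "((\<lambda>u. \<tau> (c * (K u - K t)) / of_real (u - t)) \<longlongrightarrow> 0) (at_right t)"
    by (simp add: tendsto_cong)
qed

text \<open>The trace of \<open>(K - 1) * (K - 1)\<close> starts at 0 and has right derivative 0: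
  its increment is twice the trace of \<open>K t - 1\<close> against the increment of
  \<open>K\<close>, plus the trace of the squared increment, both of smaller order than
  \<open>u - t\<close>. Faithfulness then gives \<open>K t = 1\<close>.\<close>

lemma U_adj_U:
  assumes "0 \<le> t"
  shows "U t * adj (U t) = 1"
proof -
  define K where "K = (\<lambda>u. U u * adj (U u))"
  define g where "g u = \<tau> ((K u - 1) * (K u - 1))" for u
  have KM: "K u \<in> M" if "0 \<le> u" for u using that by (simp add: K_def)
  have "continuous_on {0..} K"
    unfolding K_def
    by (intro continuous_intros continuous_U bounded_linear.continuous_on[OF bounded_linear_adj])
  then have "continuous_on {0..} g"
    unfolding g_def by (intro continuous_on_trace continuous_intros) (simp_all add: KM)
  moreover have "((\<lambda>u. (1 / (u - t)) *\<^sub>R (g u - g t)) \<longlongrightarrow> 0) (at_right t)" if t: "0 \<le> t" for t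
  proof -
    define Y where "Y u = (1 / sqrt (u - t)) *\<^sub>R (K u - K t)" for u
    have Y0: "((\<lambda>u. L2 (Y u)) \<longlongrightarrow> 0) (at_right t)"
      unfolding Y_def K_def by (rule U_adj_U_increment(1)[OF t])
    have YY: "((\<lambda>u. \<tau> (Y u * Y u)) \<longlongrightarrow> 0) (at_right t)"
    proof (rule Lim_null_comparison)
      show "\<forall>\<^sub>F u in at_right t. norm (\<tau> (Y u * Y u)) \<le> L2 (Y u) * L2 (Y u)"
        using eventually_gt[of t]
        by eventually_elim (rule trace_mult_le; use t KM in \<open>simp add: Y_def\<close>)
      show "((\<lambda>u. L2 (Y u) * L2 (Y u)) \<longlongrightarrow> 0) (at_right t)"
        using tendsto_mult[OF Y0 Y0] by simp
    qed
    have "K t - 1 \<in> F t"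
      unfolding K_def using t star_algebra.one_closed[OF F_algebra[OF t]]
      by (intro F_diff F_mult F_adj U_in_F) simp_all
    from U_adj_U_increment(2)[OF t this]
    have "((\<lambda>u. \<tau> ((K t - 1) * (K u - K t)) / of_real (u - t)) \<longlongrightarrow> 0) (at_right t)"
      by (simp add: K_def)
    then have "((\<lambda>u. \<tau> (Y u * Y u) + 2 * (\<tau> ((K t - 1) * (K u - K t)) / of_real (u - t))) \<longlongrightarrow> 0 + 2 * 0) (at_right t)"
      by (intro tendsto_intros YY)
    moreover have "\<forall>\<^sub>F u in at_right t. \<tau> (Y u * Y u) + 2 * (\<tau> ((K t - 1) * (K u - K t)) / of_real (u - t))
        = (1 / (u - t)) *\<^sub>R (g u - g t)"
      using eventually_gt[of t]
    proof eventually_elim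
      case (elim u)
      define E where "E = K u - K t"
      define L where "L = K t - 1"
      have m: "E \<in> M" "L \<in> M" using KM t elim by (simp_all add: E_def L_def)
      have "K u - 1 = L + E" by (simp add: E_def L_def)
      then have "g u = \<tau> ((L + E) * (L + E))" by (simp add: g_def)
      also have "\<dots> = g t + 2 * \<tau> (L * E) + \<tau> (E * E)"
        using m tracial[of E L] by (simp add: g_def L_def[symmetric] algebra_simps add)
      finally have "g u - g t = 2 * \<tau> (L * E) + \<tau> (E * E)" by simp
      moreover have "Y u * Y u = (1 / (u - t)) *\<^sub>R (E * E)"
        using elim by (simp add: Y_def E_def[symmetric])
      then have "\<tau> (Y u * Y u) = \<tau> (E * E) / of_real (u - t)"
        using m by (simp add: trace_scaleR)
      ultimately show ?case
        by (simp add: E_def[symmetric] L_def[symmetric] scaleR_conv_of_real add_divide_distrib)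
    qed
    ultimately show ?thesis by (simp add: tendsto_cong)
  qed
  ultimately have "g t = g 0"
    using constant_of_right_derivative_zero assms by blast
  also have "g 0 = 0" by (simp add: g_def K_def U_0)
  finally have "\<tau> (adj (K t - 1) * (K t - 1)) = 0" by (simp add: g_def K_def)
  then have "K t - 1 = 0" using faithful[of "K t - 1"] KM[OF assms] by simp
  then show ?thesis by (simp add: K_def)
qed

text \<open>In the presence of a faithful trace a one-sided inverse is two-sided: \<open>p\<close>
  is a projection, and traciality gives it trace 0.\<close>

lemma adj_U_U:
  assumes "0 \<le> t"
  shows "adj (U t) * U t = 1"
proof -
  define p where "p = 1 - adj (U t) * U t"
  have pM: "p \<in> M" using assms by (simp add: p_def)
  have "adj (U t) * U t * (adj (U t) * U t) = adj (U t) * (U t * adj (U t)) * U t"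
    by (simp add: mult.assoc)
  then have "adj p * p = p"
    by (simp add: p_def U_adj_U[OF assms] algebra_simps)
  moreover have "\<tau> p = 0"
    using assms tracial[of "adj (U t)" "U t"] by (simp add: p_def trace_linear U_adj_U)
  ultimately have "p = 0" using faithful[OF pM] by simp
  then show ?thesis by (simp add: p_def)
qed

end

section \<open>Amalgamation over a subalgebra\<close>

lemma (in star_algebra) prod_list_closed: "(\<And>A. A \<in> set As \<Longrightarrow> A \<in> N) \<Longrightarrow> prod_list As \<in> N"
  by (induction As) simp_all

text \<open>The algebra generated by \<open>N\<close> and \<open>Y\<close> splits as \<open>N + amalgam\<close>, where the second summand is
  spanned by the words \<open>b y\<^sub>1 b\<^sub>1 y\<^sub>2 \<dots> y\<^sub>k b'\<close> with centred letters between the outer factors; the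
  projection onto \<open>N\<close> plays the role of a conditional expectation.\<close>

locale free_pair = wstar_probability_space M \<tau>
  for M :: "'h::complex_hilbert_space bop set" and \<tau> :: "'h bop \<Rightarrow> complex" +
  fixes X Y N :: "'h bop set"
  assumes free: "freely_independent \<tau> X Y" and X_M: "X \<subseteq> M" and Y_M: "Y \<subseteq> M"
    and N_algebra: "star_algebra N" and N_X: "N \<subseteq> star_algebra_generated X"
begin

abbreviation "AX \<equiv> star_algebra_generated X"
abbreviation "AY \<equiv> star_algebra_generated Y"

lemma AX_M: "A \<in> AX \<Longrightarrow> A \<in> M"
  using generated_subset[OF X_M] by auto

lemma AY_M: "A \<in> AY \<Longrightarrow> A \<in> M"
  using generated_subset[OF Y_M] by auto

lemma N_M: "A \<in> N \<Longrightarrow> A \<in> M"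
  using N_X AX_M by auto

text \<open>Tag \<open>False\<close> marks letters from \<open>AY\<close>. Words begin and end with
  such letters so that the outer factors from \<open>N\<close> in \<open>amalgam\<close> may be
  arbitrary and not only centred.\<close>

definition reduced_word :: "(bool \<times> 'h bop) list \<Rightarrow> bool"
  where "reduced_word w \<longleftrightarrow> w \<noteq> [] \<and> distinct_adj (map fst w) \<and> \<not> fst (hd w) \<and> \<not> fst (last w) \<and>
    (\<forall>(i, A)\<in>set w. \<tau> A = 0 \<and> A \<in> (if i then N else AY))"

abbreviation word :: "(bool \<times> 'h bop) list \<Rightarrow> 'h bop"
  where "word w \<equiv> prod_list (map snd w)"

inductive_set amalgam :: "'h bop set"
  where
    word: "reduced_word w \<Longrightarrow> b \<in> N \<Longrightarrow> b' \<in> N \<Longrightarrow> b * word w * b' \<in> amalgam"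
  | add: "k \<in> amalgam \<Longrightarrow> k' \<in> amalgam \<Longrightarrow> k + k' \<in> amalgam"
  | scale: "k \<in> amalgam \<Longrightarrow> scale_bop c k \<in> amalgam"

lemma reduced_word_letter:
  assumes "reduced_word w" "(i, A) \<in> set w"
  shows "\<tau> A = 0" "A \<in> star_algebra_generated (if i then X else Y)" "A \<in> M"
proof -
  have "\<forall>(i, A)\<in>set w. \<tau> A = 0 \<and> A \<in> (if i then N else AY)"
    using assms(1) by (simp add: reduced_word_def)
  from bspec[OF this assms(2)] have *: "\<tau> A = 0" "A \<in> (if i then N else AY)"
    by simp_all
  show "\<tau> A = 0" by (rule *)
  show A: "A \<in> star_algebra_generated (if i then X else Y)"
    using *(2) N_X by (cases i) auto
  show "A \<in> M" using A by (cases i) (auto intro: AX_M AY_M)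
qed

lemma reduced_word_letter_AX: "reduced_word w \<Longrightarrow> (True, A) \<in> set w \<Longrightarrow> A \<in> AX"
  using reduced_word_letter(2)[of w True A] by simp

lemma reduced_word_letter_AY: "reduced_word w \<Longrightarrow> (False, A) \<in> set w \<Longrightarrow> A \<in> AY"
  using reduced_word_letter(2)[of w False A] by simp

lemmas reduced_word_letters = reduced_word_letter(1) reduced_word_letter_AX reduced_word_letter_AY

lemma word_M:
  assumes "reduced_word w"
  shows "word w \<in> M"
proof -
  have "A \<in> M" if "(i, A) \<in> set w" for i A
    by (rule reduced_word_letter(3)[OF assms that])
  then show ?thesis
    by (intro prod_list_closed) auto
qed

lemma amalgam_M: "k \<in> amalgam \<Longrightarrow> k \<in> M"
  by (induction rule: amalgam.induct) (auto intro!: mult_closed intro: N_M word_M)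

section \<open>Traces of alternating words\<close>

lemma trace_word_append:
  assumes w: "reduced_word w" and x: "x \<in> AX" "\<tau> x = 0"
  shows "\<tau> (word w * x) = 0"
proof -
  have "\<tau> (word (w @ [(True, x)])) = 0"
  proof (rule freely_independent_word[OF free])
    show "distinct_adj (map fst (w @ [(True, x)]))"
      using w by (simp add: reduced_word_def distinct_adj_append_iff last_map)
  qed (use x in \<open>auto intro: reduced_word_letters[OF w]\<close>)
  then show ?thesis by simp
qed

lemma trace_word:
  assumes w: "reduced_word w"
  shows "\<tau> (word w) = 0"
proof (rule freely_independent_word[OF free])
  show "w \<noteq> []" "distinct_adj (map fst w)" using w by (simp_all add: reduced_word_def)
qed (use reduced_word_letter[OF w] in blast)

lemma trace_word_append2:
  assumes w: "reduced_word w" "reduced_word w'" and x: "x \<in> AX" "\<tau> x = 0" and y: "y \<in> AX" "\<tau> y = 0"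
  shows "\<tau> (word w * x * word w' * y) = 0"
proof -
  have "\<tau> (word (w @ (True, x) # w' @ [(True, y)])) = 0"
  proof (rule freely_independent_word[OF free])
    show "distinct_adj (map fst (w @ (True, x) # w' @ [(True, y)]))"
      using w by (simp add: reduced_word_def distinct_adj_append_iff distinct_adj_Cons last_map
          hd_append hd_map)
  qed (use x y in \<open>auto intro: reduced_word_letters[OF w(1)] reduced_word_letters[OF w(2)]\<close>)
  then show ?thesis by (simp add: mult.assoc)
qed

lemma AX_mult: "x \<in> AX \<Longrightarrow> b \<in> N \<Longrightarrow> b' \<in> N \<Longrightarrow> b * x * b' \<in> AX"
  using N_X by (intro star_algebra_generated.mult) auto

text \<open>By traciality the outer factors and \<open>x\<close> merge into one element of
  \<open>AX\<close>, whose centred part extends the word and whose scalar part leaves the word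
  itself. Testing against all of \<open>AX\<close>, not only \<open>N\<close>, will admit later
  values of \<open>U\<close> as \<open>x\<close>.\<close>

lemma trace_amalgam:
  assumes k: "k \<in> amalgam" and x: "x \<in> AX"
  shows "\<tau> (k * x) = 0"
  using k
proof (induction rule: amalgam.induct)
  case (word w b b')
  define e where "e = b' * x * b"
  have e: "e \<in> AX" unfolding e_def by (rule AX_mult[OF x word(3,2)])
  have m: "b \<in> M" "b' \<in> M" "x \<in> M" "word w \<in> M" "e \<in> M"
    using word x e by (auto intro: N_M AX_M word_M)
  have "\<tau> (b * word w * b' * x) = \<tau> (word w * e)"
    using m tracial[of b "word w * b' * x"] by (simp add: e_def mult.assoc)
  also have "word w * e = word w * centre e + scale_bop (\<tau> e) (word w)"
    by (simp add: centre_def right_diff_distrib scale_bop_mult_right)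
  also have "\<tau> \<dots> = \<tau> (word w * centre e) + \<tau> e * \<tau> (word w)"
    using m by (simp add: trace_linear)
  also have "\<tau> (word w * centre e) = 0"
    by (rule trace_word_append[OF word(1)])
      (use e m in \<open>auto intro: centre_closed[OF star_algebra_generated]\<close>)
  finally show ?case by (simp add: trace_word[OF word(1)])
next
  case (add k k')
  then show ?case using amalgam_M AX_M[OF x] by (simp add: distrib_right trace_linear)
next
  case (scale k c)
  then show ?case using amalgam_M AX_M[OF x] by (simp add: scale_bop_mult_left trace_linear)
qed

text \<open>Orthogonality of \<open>x\<close> and \<open>y\<close> to \<open>N\<close> makes
  \<open>b' * x * c\<close> and \<open>c' * y * b\<close> centred for all coefficients from
  \<open>N\<close>, so that the product is, up to a cyclic shift, a single alternating word.\<close>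

lemma trace_amalgam2:
  assumes k: "k \<in> amalgam" and k': "k' \<in> amalgam"
    and x: "x \<in> AX" "\<And>b. b \<in> N \<Longrightarrow> \<tau> (b * x) = 0"
    and y: "y \<in> AX" "\<And>b. b \<in> N \<Longrightarrow> \<tau> (b * y) = 0"
  shows "\<tau> (k * x * k' * y) = 0"
  using k
proof (induction rule: amalgam.induct)
  case (word w b b')
  note w = word
  show ?case
    using k'
  proof (induction rule: amalgam.induct)
    case (word w' c c')
    interpret N: star_algebra N by (rule N_algebra)
    have m: "b \<in> M" "b' \<in> M" "x \<in> M" "word w \<in> M" "c \<in> M" "c' \<in> M" "y \<in> M" "word w' \<in> M"
      using w word x y by (auto intro: N_M AX_M word_M)
    have xc: "\<tau> (b' * x * c) = 0"
      using x(2)[of "c * b'"] w word m tracial[of "b' * x" c] by (simp add: mult.assoc)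
    have yb: "\<tau> (c' * y * b) = 0"
      using y(2)[of "b * c'"] w word m tracial[of "c' * y" b] by (simp add: mult.assoc)
    have "\<tau> (b * word w * b' * x * (c * word w' * c') * y)
        = \<tau> (word w * (b' * x * c) * word w' * (c' * y * b))"
      using m tracial[of b "word w * b' * x * (c * word w' * c') * y"] by (simp add: mult.assoc)
    also have "\<dots> = 0"
      using w word x y by (intro trace_word_append2 AX_mult xc yb)
    finally show ?case .
  next
    case (add k k')
    then show ?case
      using amalgam_M AX_M[OF x(1)] AX_M[OF y(1)] w word_M[OF w(1)] N_M
      by (simp add: distrib_left distrib_right trace_linear)
  next
    case (scale k c)
    then show ?case
      using amalgam_M AX_M[OF x(1)] AX_M[OF y(1)] w word_M[OF w(1)] N_M
      by (simp add: scale_bop_mult_left scale_bop_mult_right trace_linear)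
  qed
next
  case (add k1 k2)
  then show ?case
    using amalgam_M k' AX_M[OF x(1)] AX_M[OF y(1)] by (simp add: distrib_right trace_linear)
next
  case (scale k1 c)
  then show ?case
    using amalgam_M k' AX_M[OF x(1)] AX_M[OF y(1)] by (simp add: scale_bop_mult_left trace_linear)
qed

section \<open>The sum of \<open>N\<close> and \<open>amalgam\<close>, and its stability under left
  multiplication\<close>

definition sum_algebra :: "'h bop set"
  where "sum_algebra = {b + k | b k. b \<in> N \<and> k \<in> amalgam}"

text \<open>The letter 0 is centred, so a one-letter word supplies the zero element.\<close>

lemma zero_amalgam: "0 \<in> amalgam"
proof -
  have "1 * word [(False, 0)] * 1 \<in> amalgam"
    using star_algebra.one_closed[OF N_algebra] star_algebra.zero_closed[OF star_algebra_generated]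
    by (intro amalgam.word) (simp_all add: reduced_word_def)
  then show ?thesis by simp
qed

lemma amalgam_mult_N: "k \<in> amalgam \<Longrightarrow> c \<in> N \<Longrightarrow> c * k \<in> amalgam"
proof (induction k rule: amalgam.induct)
  case (word w b b')
  then have "c * b * word w * b' \<in> amalgam"
    by (intro amalgam.word star_algebra.mult_closed[OF N_algebra])
  then show ?case by (simp add: mult.assoc)
qed (auto simp: distrib_left scale_bop_mult_right intro: amalgam.add amalgam.scale)

lemma sum_algebra_N: "b \<in> N \<Longrightarrow> b \<in> sum_algebra"
  unfolding sum_algebra_def using zero_amalgam by force

lemma sum_algebra_amalgam: "k \<in> amalgam \<Longrightarrow> k \<in> sum_algebra"
  unfolding sum_algebra_def using star_algebra.zero_closed[OF N_algebra] by force

lemma sum_algebra_add: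
  assumes "a \<in> sum_algebra" "a' \<in> sum_algebra"
  shows "a + a' \<in> sum_algebra"
proof -
  obtain b k b' k' where "a = b + k" "a' = b' + k'" "b \<in> N" "b' \<in> N" "k \<in> amalgam" "k' \<in> amalgam"
    using assms by (auto simp: sum_algebra_def)
  moreover from this have "a + a' = (b + b') + (k + k')" by (simp add: algebra_simps)
  ultimately show ?thesis
    unfolding sum_algebra_def
    by (blast intro: star_algebra.add_closed[OF N_algebra] amalgam.add)
qed

lemma sum_algebra_scale:
  assumes "a \<in> sum_algebra"
  shows "scale_bop c a \<in> sum_algebra"
proof -
  obtain b k where "a = b + k" "b \<in> N" "k \<in> amalgam"
    using assms by (auto simp: sum_algebra_def)
  moreover from this have "scale_bop c a = scale_bop c b + scale_bop c k"
    by (simp add: scale_bop_add_right)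
  ultimately show ?thesis
    unfolding sum_algebra_def
    by (blast intro: star_algebra.scale_closed[OF N_algebra] amalgam.scale)
qed

lemma sum_algebra_mult_N: "c \<in> N \<Longrightarrow> a \<in> sum_algebra \<Longrightarrow> c * a \<in> sum_algebra"
proof -
  assume c: "c \<in> N" and "a \<in> sum_algebra"
  then obtain b k where "a = b + k" "b \<in> N" "k \<in> amalgam" by (auto simp: sum_algebra_def)
  moreover from this have "c * a = c * b + c * k" by (simp add: distrib_left)
  ultimately show ?thesis
    unfolding sum_algebra_def
    by (blast intro: star_algebra.mult_closed[OF N_algebra c] amalgam_mult_N[OF _ c])
qed

text \<open>Prepending \<open>y\<close> to \<open>b * word w * b'\<close> keeps the word alternating
  only for centred \<open>b\<close>. Centring \<open>b\<close> and \<open>y\<close> gives a longer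
  word and \<open>w\<close> with a new outer factor; the scalar part of \<open>b\<close> lets
  \<open>y\<close> merge with the first letter of \<open>w\<close>.\<close>

lemma mult_word_sum_algebra:
  assumes w: "reduced_word w" and b: "b \<in> N" "b' \<in> N" and y: "y \<in> AY"
  shows "y * (b * word w * b') \<in> sum_algebra"
proof -
  interpret N: star_algebra N by (rule N_algebra)
  have split: "y * (b * word w * b') = centre y * centre b * word w * b'
      + scale_bop (\<tau> y) (centre b * word w * b') + scale_bop (\<tau> b) (y * word w * b')"
    by (simp add: centre_def algebra_simps scale_bop_mult_left scale_bop_mult_right
        scale_bop_diff_right scale_bop_scale_bop)
  have cb: "centre b \<in> N" by (rule centre_closed[OF N_algebra b(1)])
  have cy: "centre y \<in> AY" by (rule centre_closed[OF star_algebra_generated y])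
  have "reduced_word ((False, centre y) # (True, centre b) # w)"
    using w cb cy b y N_M AY_M by (auto simp: reduced_word_def distinct_adj_Cons hd_map)
  from amalgam.word[OF this N.one_closed b(2)]
  have 1: "centre y * centre b * word w * b' \<in> sum_algebra"
    by (simp add: mult.assoc sum_algebra_amalgam)
  have 2: "scale_bop (\<tau> y) (centre b * word w * b') \<in> sum_algebra"
    by (intro sum_algebra_scale sum_algebra_amalgam amalgam.word w cb b)
  obtain y1 rest where w_eq: "w = (False, y1) # rest"
    using w by (cases w) (auto simp: reduced_word_def)
  have y1: "y1 \<in> AY" using w by (auto simp: w_eq reduced_word_def)
  \<comment> \<open>\<open>e\<close> need not be centred; its scalar part erases the first
    letter.\<close>
  define e where "e = y * y1"
  have e: "e \<in> AY" "centre e \<in> AY"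
    using y y1 by (auto simp: e_def intro: star_algebra_generated.mult centre_closed[OF star_algebra_generated])
  have "y * word w * b' = e * word rest * b'"
    by (simp add: e_def w_eq mult.assoc)
  also have "\<dots> = 1 * (centre e * word rest) * b' + scale_bop (\<tau> e) (word rest * b')"
    by (simp add: centre_def algebra_simps scale_bop_mult_left)
  also have "\<dots> \<in> sum_algebra"
  proof (intro sum_algebra_add sum_algebra_scale)
    have "reduced_word ((False, centre e) # rest)"
      using w e AY_M by (auto simp: reduced_word_def w_eq distinct_adj_Cons)
    from amalgam.word[OF this N.one_closed b(2)]
    show "1 * (centre e * word rest) * b' \<in> sum_algebra"
      by (simp add: sum_algebra_amalgam)
    show "word rest * b' \<in> sum_algebra"
    \<comment> \<open>Without its first letter the word is empty, which leaves an element of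
      \<open>N\<close>, or it starts with a letter of \<open>N\<close>, which becomes the outer
      factor.\<close>
    proof (cases rest)
      case Nil
      then show ?thesis using b by (simp add: sum_algebra_N)
    next
      case (Cons p rest')
      then obtain b1 where p: "p = (True, b1)"
        using w by (cases p) (auto simp: w_eq reduced_word_def)
      have "reduced_word rest'" and b1: "b1 \<in> N"
        using w by (auto simp: w_eq Cons p reduced_word_def distinct_adj_Cons hd_map split: if_splits)
      then have "b1 * word rest' * b' \<in> amalgam"
        using b by (intro amalgam.word)
      then show ?thesis by (simp add: Cons p mult.assoc sum_algebra_amalgam)
    qed
  qed
  finally have 3: "y * word w * b' \<in> sum_algebra" .
  show ?thesis
    unfolding split by (intro sum_algebra_add sum_algebra_scale 1 2 3)
qed

lemma sum_algebra_mult_AY: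
  assumes y: "y \<in> AY" and a: "a \<in> sum_algebra"
  shows "y * a \<in> sum_algebra"
proof -
  interpret N: star_algebra N by (rule N_algebra)
  obtain b k where a_eq: "a = b + k" and b: "b \<in> N" and k: "k \<in> amalgam"
    using a by (auto simp: sum_algebra_def)
  have "reduced_word [(False, centre y)]"
    using y centre_closed[OF star_algebra_generated y] AY_M by (simp add: reduced_word_def)
  from amalgam.word[OF this N.one_closed b] have "centre y * b \<in> sum_algebra"
    by (simp add: sum_algebra_amalgam)
  moreover have "y * b = centre y * b + scale_bop (\<tau> y) b"
    by (simp add: centre_def left_diff_distrib scale_bop_mult_left)
  ultimately have "y * b \<in> sum_algebra"
    using b by (simp add: sum_algebra_add sum_algebra_scale sum_algebra_N)
  moreover have "y * k \<in> sum_algebra"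
    using k
  proof (induction rule: amalgam.induct)
    case (word w b b')
    then show ?case by (rule mult_word_sum_algebra[OF _ _ _ y])
  qed (auto simp: distrib_left scale_bop_mult_right intro: sum_algebra_add sum_algebra_scale)
  ultimately show ?thesis by (simp add: a_eq distrib_left sum_algebra_add)
qed

text \<open>\<open>b\<close> acts as the conditional expectation of \<open>a\<close> onto
  \<open>N\<close>. The membership of \<open>a - b\<close> is recorded as well because traces with
  two such factors are not determined by traces with one.\<close>

lemma sum_algebra_trace:
  assumes "a \<in> sum_algebra"
  obtains b where "b \<in> N" "\<And>x. x \<in> AX \<Longrightarrow> \<tau> (a * x) = \<tau> (b * x)"
    "a - b \<in> amalgam"
proof -
  obtain b k where *: "a = b + k" "b \<in> N" "k \<in> amalgam"
    using assms by (auto simp: sum_algebra_def)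
  have "\<tau> (a * x) = \<tau> (b * x)" if "x \<in> AX" for x
    using * that trace_amalgam[of k x] N_M AX_M amalgam_M by (simp add: distrib_right trace_linear)
  with * that[of b] show thesis by simp
qed

text \<open>Writing \<open>a = b + k\<close>, a term with one factor from \<open>amalgam\<close>
  vanishes against \<open>AX\<close>, and the term with two of them by
  \<open>trace_amalgam2\<close>.\<close>

lemma sum_algebra_trace2:
  assumes "b \<in> N" "b' \<in> N" "a - b \<in> amalgam" "a' - b' \<in> amalgam"
    and x: "x \<in> AX" "\<And>b. b \<in> N \<Longrightarrow> \<tau> (b * x) = 0"
    and y: "y \<in> AX" "\<And>b. b \<in> N \<Longrightarrow> \<tau> (b * y) = 0"
  shows "\<tau> (a * x * a' * y) = \<tau> (b * x * b' * y)"
proof -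
  define k k' where "k = a - b" and "k' = a' - b'"
  have k: "k \<in> amalgam" "k' \<in> amalgam" and a: "a = b + k" "a' = b' + k'"
    using assms by (simp_all add: k_def k'_def)
  have m: "b \<in> M" "b' \<in> M" "k \<in> M" "k' \<in> M" "x \<in> M" "y \<in> M"
    using assms k x y N_M amalgam_M AX_M by auto
  have bX: "b \<in> AX" "b' \<in> AX" using assms N_X by auto
  have "\<tau> (a * x * a' * y) = \<tau> (b * x * b' * y) + \<tau> (b * x * k' * y) + \<tau> (k * x * b' * y) + \<tau> (k * x * k' * y)"
    using m by (simp add: a algebra_simps trace_linear)
  moreover have "\<tau> (b * x * k' * y) = \<tau> (k' * (y * b * x))"
    using m tracial[of "b * x" "k' * y"] by (simp add: mult.assoc)
  moreover have "\<tau> (k' * (y * b * x)) = 0" "\<tau> (k * (x * b' * y)) = 0"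
    using k x y bX by (auto intro!: trace_amalgam star_algebra_generated.mult)
  ultimately show ?thesis
    using trace_amalgam2[OF k x y] by (simp add: mult.assoc)
qed

end

section \<open>The moments of \<open>R U S U\<^sup>*\<close>\<close>

text \<open>The powers of \<open>A\<close> stand to the left of the difference and those of
  \<open>Q\<close> to the right; expanding the latter once more will give an exact second order
  expansion.\<close>

lemma power_diff_telescope:
  fixes Q A :: "'a::{ring,monoid_mult}"
  shows "Q ^ n - A ^ n = (\<Sum>i<n. A ^ i * (Q - A) * Q ^ (n - 1 - i))"
proof (induction n)
  case (Suc n)
  have "(\<Sum>i<Suc n. A ^ i * (Q - A) * Q ^ (Suc n - 1 - i))
      = (\<Sum>i<n. A ^ i * (Q - A) * Q ^ (n - 1 - i) * Q) + A ^ n * (Q - A)"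
  proof -
    have "A ^ i * (Q - A) * Q ^ (n - i) = A ^ i * (Q - A) * Q ^ (n - 1 - i) * Q" if "i < n" for i
      using that by (simp add: mult.assoc Suc_diff_Suc flip: power_Suc2)
    then show ?thesis by simp
  qed
  also have "\<dots> = (Q ^ n - A ^ n) * Q + A ^ n * (Q - A)"
    by (simp only: Suc.IH sum_distrib_right)
  also have "\<dots> = Q ^ Suc n - A ^ Suc n"
    by (simp only: power_Suc2 left_diff_distrib right_diff_distrib) simp
  finally show ?case by simp
qed simp

text \<open>Reflection turns the row \<open>j < n - i\<close> into \<open>i \<le> j < n\<close>, the
  complement of the row \<open>j < i\<close>; so two copies of the triangle fill
  \<open>Suc n\<close> complete rows.\<close>

lemma sum_triangle_symmetric:
  fixes g :: "nat \<Rightarrow> complex"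
  assumes sym: "\<And>j. j < n \<Longrightarrow> g (n - 1 - j) = g j"
  shows "2 * (\<Sum>i<Suc n. \<Sum>j<n - i. g j) = of_nat (Suc n) * (\<Sum>j<n. g j)"
proof -
  have "(\<Sum>i<Suc n. \<Sum>j<n - i. g j) = (\<Sum>i<Suc n. \<Sum>j<i. g j)"
    using sum.nat_diff_reindex[of "\<lambda>i. \<Sum>j<i. g j" "Suc n"] by simp
  moreover have flip: "(\<Sum>j<n - i. g j) = (\<Sum>j\<in>{i..<n}. g j)" if "i \<le> n" for i
    by (rule sum.reindex_bij_witness[of _ "\<lambda>j. n - 1 - j" "\<lambda>j. n - 1 - j"])
      (use that sym in auto)
  have "(\<Sum>i<Suc n. \<Sum>j<n - i. g j) = (\<Sum>i<Suc n. \<Sum>j\<in>{i..<n}. g j)"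
    by (rule sum.cong[OF refl], rule flip) simp
  ultimately have "2 * (\<Sum>i<Suc n. \<Sum>j<n - i. g j) = (\<Sum>i<Suc n. (\<Sum>j<i. g j) + (\<Sum>j\<in>{i..<n}. g j))"
    unfolding sum.distrib by simp
  also have "\<dots> = (\<Sum>i<Suc n. \<Sum>j<n. g j)"
  proof (rule sum.cong)
    fix i assume "i \<in> {..<Suc n}"
    then have "{..<n} = {..<i} \<union> {i..<n}" by auto
    moreover have "sum g ({..<i} \<union> {i..<n}) = sum g {..<i} + sum g {i..<n}"
      by (rule sum.union_disjoint) auto
    ultimately show "(\<Sum>j<i. g j) + (\<Sum>j\<in>{i..<n}. g j) = (\<Sum>j<n. g j)"
      by simp
  qed simp
  finally show ?thesis by simp
qed

lemma sum_alternating: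
  "(\<Sum>j<2 * m + 1. if even j then a else b) = of_nat (m + 1) * a + of_nat m * (b :: complex)"
  by (induction m) (simp_all add: algebra_simps)

locale liberation = free_unitary_diffusion M \<tau> F B U
  for M :: "'h::complex_hilbert_space bop set" and \<tau> :: "'h bop \<Rightarrow> complex"
    and F :: "real \<Rightarrow> 'h bop set" and B U :: "real \<Rightarrow> 'h bop" +
  fixes R S :: "'h bop"
  assumes R_M [simp]: "R \<in> M" and R_sym: "symmetry R"
    and S_M [simp]: "S \<in> M" and S_sym: "symmetry S"
    and free_RS: "freely_independent \<tau> (U ` {0..}) {R, S}"
begin

lemma R_props: "adj R = R" "R * R = 1" and S_props: "adj S = S" "S * S = 1"
  using R_sym S_sym by (auto simp: symmetry_def)

definition moment :: "nat \<Rightarrow> real \<Rightarrow> complex"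
  where "moment n t = \<tau> ((R * U t * S * adj (U t)) ^ n)"

text \<open>Lying in the algebra of \<open>U\<close> gives freeness from \<open>{R, S}\<close>, and
  lying in \<open>F t\<close> gives freeness from the later increments of \<open>B\<close>; the
  coefficients must have both.\<close>

definition present :: "real \<Rightarrow> 'h bop set"
  where "present t = star_algebra_generated (U ` {0..}) \<inter> F t"

lemma free_pair_present: "0 \<le> t \<Longrightarrow> free_pair M \<tau> (U ` {0..}) {R, S} (present t)"
  by unfold_locales
    (use free_RS F_algebra[of t] star_algebra_generated[of "U ` {0..}"] in
      \<open>auto simp: present_def intro: star_algebra.add_closed star_algebra.mult_closed
        star_algebra.one_closed star_algebra.scale_closed star_algebra.adj_closed\<close>)

context
  fixes t :: real
  assumes t: "0 \<le> t"
begin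

interpretation free_pair M \<tau> "U ` {0..}" "{R, S}" "present t"
  by (rule free_pair_present[OF t])

definition V :: "real \<Rightarrow> 'h bop" where "V u = adj (U t) * U u"
definition R' :: "'h bop" where "R' = adj (U t) * R * U t"
definition A :: "'h bop" where "A = R' * S"
definition Q :: "real \<Rightarrow> 'h bop" where "Q u = R' * V u * S * adj (V u)"
definition X :: "real \<Rightarrow> 'h bop" where "X u = (1 / sqrt (u - t)) *\<^sub>R (V u - 1)"
text \<open>Unlike \<open>X u\<close>, this is exactly orthogonal to \<open>present t\<close>, as
  the scalar is the conditional mean of \<open>V u\<close>; the two differ by a scalar of order
  \<open>sqrt (u - t)\<close>.\<close>

definition W :: "real \<Rightarrow> 'h bop"
  where "W u = (1 / sqrt (u - t)) *\<^sub>R (V u - exp (- (u - t) / 2) *\<^sub>R 1)"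

lemma UU: "adj (U t) * U t = 1" "U t * adj (U t) = 1"
  using adj_U_U[OF t] U_adj_U[OF t] .

lemma UU': "adj (U t) * (U t * x) = x" "U t * (adj (U t) * x) = x"
  using UU by (simp_all flip: mult.assoc)

lemma R'_props: "adj R' = R'" "R' * R' = 1"
proof -
  show "adj R' = R'" by (simp add: R'_def R_props mult.assoc)
  have "R' * R' = adj (U t) * (R * (U t * adj (U t)) * R) * U t"
    by (simp add: R'_def mult.assoc)
  then show "R' * R' = 1" by (simp add: UU R_props)
qed

lemma R'_M [simp]: "R' \<in> M"
  using t by (simp add: R'_def)

lemma A_M [simp]: "A \<in> M"
  by (simp add: A_def)

lemma V_AX: "0 \<le> u \<Longrightarrow> V u \<in> AX"
  unfolding V_def using t
  by (intro star_algebra_generated.mult star_algebra_generated.adj star_algebra_generated.gen) auto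

lemma V_M [simp]: "0 \<le> u \<Longrightarrow> V u \<in> M"
  by (rule AX_M[OF V_AX])

lemma Q_M [simp]: "0 \<le> u \<Longrightarrow> Q u \<in> M"
  by (simp add: Q_def)

lemma U_present: "U t \<in> present t"
  using t U_in_F[OF t] by (auto simp: present_def intro: star_algebra_generated.gen)

lemma one_present: "1 \<in> present t"
  by (rule star_algebra.one_closed[OF N_algebra])

lemma mult_R'_sum_algebra: "a \<in> sum_algebra \<Longrightarrow> R' * a \<in> sum_algebra"
  unfolding R'_def mult.assoc
  by (intro sum_algebra_mult_N sum_algebra_mult_AY star_algebra.adj_closed[OF N_algebra] U_present
      star_algebra_generated.gen) auto

lemma mult_S_sum_algebra: "a \<in> sum_algebra \<Longrightarrow> S * a \<in> sum_algebra"
  by (intro sum_algebra_mult_AY star_algebra_generated.gen) auto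

lemma one_sum_algebra: "1 \<in> sum_algebra"
  by (rule sum_algebra_N[OF one_present])

lemma mult_A_sum_algebra: "a \<in> sum_algebra \<Longrightarrow> A ^ k * a \<in> sum_algebra"
  by (induction k) (simp_all add: mult.assoc A_def mult_R'_sum_algebra mult_S_sum_algebra)

lemma words_sum_algebra:
  "A ^ k \<in> sum_algebra" "A ^ k * R' \<in> sum_algebra" "S * A ^ k \<in> sum_algebra"
  "S * A ^ k * R' \<in> sum_algebra" "R' \<in> sum_algebra" "S \<in> sum_algebra"
  using mult_A_sum_algebra[OF one_sum_algebra, of k] mult_R'_sum_algebra[OF one_sum_algebra]
    mult_A_sum_algebra[OF mult_R'_sum_algebra[OF one_sum_algebra], of k]
    mult_S_sum_algebra[OF one_sum_algebra]
    mult_S_sum_algebra[OF mult_A_sum_algebra[OF mult_R'_sum_algebra[OF one_sum_algebra], of k]]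
    mult_S_sum_algebra[OF mult_A_sum_algebra[OF one_sum_algebra, of k]]
  by (simp_all add: mult.assoc)

lemma sum_algebra_M: "a \<in> sum_algebra \<Longrightarrow> a \<in> M"
  unfolding sum_algebra_def by (auto intro!: add_closed intro: N_M amalgam_M)

subsection \<open>First and second order expansions\<close>

lemma present_V_trace:
  assumes "t \<le> u" "b \<in> present t"
  shows "\<tau> (b * (V u - exp (- (u - t) / 2) *\<^sub>R 1)) = 0"
proof -
  have b: "b \<in> F t" "b \<in> M" using assms N_M by (auto simp: present_def)
  have "\<tau> (b * V u) = of_real (exp (- (u - t) / 2)) * \<tau> (b * adj (U t) * U t)"
    using trace_U[OF t assms(1), of "b * adj (U t)"] b t
    by (simp add: V_def mult.assoc F_mult F_adj U_in_F)
  then have "\<tau> (b * V u) = of_real (exp (- (u - t) / 2)) * \<tau> b"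
    by (simp add: mult.assoc UU)
  then show ?thesis
    using assms t b by (simp add: right_diff_distrib trace_linear)
qed

section \<open>Increments orthogonal to the past of \<open>U\<close>\<close>

definition orth :: "'h bop \<Rightarrow> bool"
  where "orth x \<longleftrightarrow> x \<in> AX \<and> (\<forall>b\<in>present t. \<tau> (b * x) = 0)"

lemma orth_V:
  assumes "t \<le> u"
  shows "orth (V u - exp (- (u - t) / 2) *\<^sub>R 1)"
  unfolding orth_def
proof (intro conjI ballI present_V_trace[OF assms])
  show "V u - exp (- (u - t) / 2) *\<^sub>R 1 \<in> AX"
    using assms t
    by (intro star_algebra.diff_closed[OF star_algebra_generated] V_AX
        star_algebra.scaleR_closed[OF star_algebra_generated]
        star_algebra.one_closed[OF star_algebra_generated]) simp
qed

lemma orth_adj: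
  assumes "orth x"
  shows "orth (adj x)"
  unfolding orth_def
proof (intro conjI ballI)
  have x: "x \<in> AX" using assms by (simp add: orth_def)
  show "adj x \<in> AX" using x by (rule star_algebra_generated.adj)
  fix b assume b: "b \<in> present t"
  have "\<tau> (b * adj x) = cnj (\<tau> (x * adj b))"
    using AX_M[OF x] N_M[OF b] by (subst trace_adj[symmetric]) simp_all
  also have "\<tau> (x * adj b) = \<tau> (adj b * x)"
    using AX_M[OF x] N_M[OF b] by (intro tracial) simp_all
  also have "\<dots> = 0"
    using assms star_algebra.adj_closed[OF N_algebra b] by (simp add: orth_def)
  finally show "\<tau> (b * adj x) = 0" by simp
qed

lemma orth_scaleR:
  assumes "orth x"
  shows "orth (r *\<^sub>R x)"
  using assms AX_M N_M star_algebra.scaleR_closed[OF star_algebra_generated]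
  by (auto simp: orth_def trace_scaleR)

lemma orth_trace:
  assumes "a \<in> sum_algebra" "orth x"
  shows "\<tau> (a * x) = 0"
proof -
  obtain b where "b \<in> present t" "\<And>x. x \<in> AX \<Longrightarrow> \<tau> (a * x) = \<tau> (b * x)"
    using sum_algebra_trace[OF assms(1)] by blast
  then show ?thesis using assms(2) by (simp add: orth_def)
qed

text \<open>Two approximations instead of one: \<open>w\<close> lies in the algebra of
  \<open>U\<close> and is orthogonal to \<open>present t\<close>, which gives access to the freeness
  of \<open>{R, S}\<close>; the multiple of \<open>gauss\<close> need not lie in that algebra, but
  is free from \<open>F t\<close>.\<close>

definition noise :: "complex \<Rightarrow> (real \<Rightarrow> 'h bop) \<Rightarrow> bool"
  where "noise e Y \<longleftrightarrow> (\<forall>u>t. Y u \<in> M) \<and> (\<exists>w. (\<forall>u>t. orth (w u)) \<and>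
    ((\<lambda>u. L2 (Y u - w u)) \<longlongrightarrow> 0) (at_right t) \<and>
    ((\<lambda>u. L2 (w u - scale_bop e (gauss t u))) \<longlongrightarrow> 0) (at_right t))"

lemma orth_M: "orth x \<Longrightarrow> x \<in> M"
  by (auto simp: orth_def intro: AX_M)

text \<open>Read from the limit outwards: freeness of \<open>gauss\<close> evaluates the trace with
  the projections \<open>b\<close>, \<open>d\<close> as coefficients; then \<open>w1\<close>,
  \<open>w2\<close> replace \<open>gauss\<close>; for them \<open>b\<close>, \<open>d\<close> may be
  exchanged for \<open>p\<close>, \<open>q\<close> without error; finally \<open>Y1\<close>,
  \<open>Y2\<close> replace \<open>w1\<close>, \<open>w2\<close>.\<close>

lemma noise_pair:
  assumes Y1: "noise e1 Y1" and Y2: "noise e2 Y2" and P: "p \<in> sum_algebra" "q \<in> sum_algebra"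
  shows "((\<lambda>u. \<tau> (p * Y1 u * q * Y2 u)) \<longlongrightarrow> e1 * e2 * \<tau> p * \<tau> q) (at_right t)"
proof -
  obtain w1 where w1: "\<And>u. u > t \<Longrightarrow> orth (w1 u)"
    "((\<lambda>u. L2 (Y1 u - w1 u)) \<longlongrightarrow> 0) (at_right t)"
    "((\<lambda>u. L2 (w1 u - scale_bop e1 (gauss t u))) \<longlongrightarrow> 0) (at_right t)"
    using Y1 by (auto simp: noise_def)
  obtain w2 where w2: "\<And>u. u > t \<Longrightarrow> orth (w2 u)"
    "((\<lambda>u. L2 (Y2 u - w2 u)) \<longlongrightarrow> 0) (at_right t)"
    "((\<lambda>u. L2 (w2 u - scale_bop e2 (gauss t u))) \<longlongrightarrow> 0) (at_right t)"
    using Y2 by (auto simp: noise_def)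
  obtain b where b: "b \<in> present t" "\<And>x. x \<in> AX \<Longrightarrow> \<tau> (p * x) = \<tau> (b * x)" "p - b \<in> amalgam"
    using sum_algebra_trace[OF P(1)] by blast
  obtain d where d: "d \<in> present t" "\<And>x. x \<in> AX \<Longrightarrow> \<tau> (q * x) = \<tau> (d * x)" "q - d \<in> amalgam"
    using sum_algebra_trace[OF P(2)] by blast
  have bd: "\<tau> p = \<tau> b" "\<tau> q = \<tau> d"
    using b(2)[of 1] d(2)[of 1] by (simp_all add: star_algebra_generated.one)
  have m: "b \<in> M" "d \<in> M" "p \<in> M" "q \<in> M" using b d P N_M sum_algebra_M by auto
  define C where "C = 1 + cmod e1 + cmod e2"
  have L2G: "L2 (scale_bop e (gauss t u)) = cmod e" if "t < u" for u e
    using that t by (simp add: L2_norm_scale L2_norm_gauss)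
  have base: "((\<lambda>u. \<tau> (b * w1 u * d * w2 u)) \<longlongrightarrow> e1 * e2 * \<tau> p * \<tau> q) (at_right t)"
  proof (rule tendsto_trace_quad[OF w1(3) w2(3) tendsto_const tendsto_const m(1,2)])
    show "\<forall>\<^sub>F u in at_right t. w1 u \<in> M \<and> scale_bop e1 (gauss t u) \<in> M \<and> w2 u \<in> M \<and>
        scale_bop e2 (gauss t u) \<in> M \<and> b \<in> M \<and> d \<in> M \<and>
        L2 (scale_bop e1 (gauss t u)) \<le> C \<and> L2 (scale_bop e2 (gauss t u)) \<le> C"
      using eventually_gt[of t]
      by eventually_elim (use w1(1) w2(1) orth_M t m L2G in \<open>simp add: C_def\<close>)
    have "\<forall>\<^sub>F u in at_right t. \<tau> (b * scale_bop e1 (gauss t u) * d * scale_bop e2 (gauss t u)) = e1 * e2 * \<tau> p * \<tau> q"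
      using eventually_gt[of t]
    proof eventually_elim
      case (elim u)
      have "b * scale_bop e1 (gauss t u) * d * scale_bop e2 (gauss t u)
          = scale_bop (e1 * e2) (b * gauss t u * d * gauss t u)"
        by (simp add: scale_bop_mult mult.commute)
      then show ?case
        using gauss_trace2[OF t elim, of b d] b d m elim t
        by (simp add: trace_linear bd present_def)
    qed
    then show "((\<lambda>u. \<tau> (b * scale_bop e1 (gauss t u) * d * scale_bop e2 (gauss t u))) \<longlongrightarrow>
        e1 * e2 * \<tau> p * \<tau> q) (at_right t)"
      by (simp add: tendsto_eventually)
  qed
  have bound: "\<forall>\<^sub>F u in at_right t. L2 (w u) \<le> 1 + cmod e"
    if w: "\<And>u. u > t \<Longrightarrow> orth (w u)"
      "((\<lambda>u. L2 (w u - scale_bop e (gauss t u))) \<longlongrightarrow> 0) (at_right t)" for w e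
    using order_tendstoD(2)[OF w(2), of 1, simplified] eventually_gt[of t]
  proof eventually_elim
    case (elim u)
    have "L2 (w u) \<le> L2 (w u - scale_bop e (gauss t u)) + L2 (scale_bop e (gauss t u))"
      using elim t orth_M[OF w(1)] by (intro L2_norm_bound_shift) simp_all
    then show ?case using elim L2G by simp
  qed
  have b1: "\<forall>\<^sub>F u in at_right t. L2 (w1 u) \<le> 1 + cmod e1"
    by (rule bound[OF w1(1,3)])
  have b2: "\<forall>\<^sub>F u in at_right t. L2 (w2 u) \<le> 1 + cmod e2"
    by (rule bound[OF w2(1,3)])
  show ?thesis
  proof (rule tendsto_trace_quad[OF w1(2) w2(2) tendsto_const tendsto_const m(3,4)])
    show "\<forall>\<^sub>F u in at_right t. Y1 u \<in> M \<and> w1 u \<in> M \<and> Y2 u \<in> M \<and> w2 u \<in> M \<and> p \<in> M \<and> q \<in> M \<and>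
        L2 (w1 u) \<le> C \<and> L2 (w2 u) \<le> C"
      using b1 b2 eventually_gt[of t]
      by eventually_elim
        (use w1(1) w2(1) orth_M m Y1 Y2 norm_ge_zero[of e1] norm_ge_zero[of e2] in
          \<open>simp add: noise_def C_def del: norm_ge_zero\<close>)
    have "\<forall>\<^sub>F u in at_right t. \<tau> (b * w1 u * d * w2 u) = \<tau> (p * w1 u * q * w2 u)"
      using eventually_gt[of t]
    proof eventually_elim
      case (elim u)
      then show ?case
        using w1(1)[OF elim] w2(1)[OF elim] unfolding orth_def
        by (intro sum_algebra_trace2[symmetric] b d) auto
    qed
    from Lim_transform_eventually[OF base this]
    show "((\<lambda>u. \<tau> (p * w1 u * q * w2 u)) \<longlongrightarrow> e1 * e2 * \<tau> p * \<tau> q) (at_right t)" .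
  qed
qed


lemma exp_quotient_sqrt:
  "((\<lambda>u. \<bar>exp (- (u - t) / 2) - 1\<bar> / sqrt (u - t)) \<longlongrightarrow> 0) (at_right t)"
proof -
  have "((\<lambda>u. \<bar>(exp (- (u - t) / 2) - 1) / (u - t)\<bar> * sqrt (u - t)) \<longlongrightarrow> \<bar>- 1 / 2\<bar> * sqrt (t - t)) (at_right t)"
    by (intro tendsto_intros exp_difference_quotient)
  moreover have "\<forall>\<^sub>F u in at_right t. \<bar>(exp (- (u - t) / 2) - 1) / (u - t)\<bar> * sqrt (u - t)
      = \<bar>exp (- (u - t) / 2) - 1\<bar> / sqrt (u - t)"
    using eventually_gt[of t]
  proof eventually_elim
    case (elim u)
    define r where "r = sqrt (u - t)"
    have "r > 0" "u - t = r * r" using elim by (simp_all add: r_def)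
    then show ?case by (simp add: r_def[symmetric] abs_divide abs_mult)
  qed
  ultimately show ?thesis by (simp add: tendsto_cong)
qed

lemma X_M [simp]: "t < u \<Longrightarrow> X u \<in> M"
  using t by (simp add: X_def)

lemma V_minus_one: "V u - 1 = adj (U t) * (U u - U t)"
  by (simp add: V_def right_diff_distrib UU)

text \<open>Multiplying by \<open>adj (U t)\<close> removes the coefficient \<open>U t\<close> of
  the noise, by unitarity.\<close>

lemma X_gauss: "((\<lambda>u. L2 (X u - scale_bop \<i> (gauss t u))) \<longlongrightarrow> 0) (at_right t)"
proof (rule Lim_null_comparison)
  let ?e = "\<lambda>u. L2 ((1 / sqrt (u - t)) *\<^sub>R (U u - U t) - scale_bop \<i> (U t * gauss t u))"
  show "((\<lambda>u. norm (adj (U t)) * ?e u) \<longlongrightarrow> 0) (at_right t)"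
    using tendsto_mult[OF tendsto_const U_increment_approx[OF t]] by simp
  show "\<forall>\<^sub>F u in at_right t. norm (L2 (X u - scale_bop \<i> (gauss t u))) \<le> norm (adj (U t)) * ?e u"
    using eventually_gt[of t]
  proof eventually_elim
    case (elim u)
    let ?Y = "(1 / sqrt (u - t)) *\<^sub>R (U u - U t) - scale_bop \<i> (U t * gauss t u)"
    have m: "?Y \<in> M" "adj (U t) \<in> M" using elim t by simp_all
    have "X u - scale_bop \<i> (gauss t u) = adj (U t) * ?Y"
      unfolding X_def V_minus_one
      by (simp add: right_diff_distrib[of "adj (U t)" "(1 / sqrt (u - t)) *\<^sub>R (U u - U t)"]
          scale_bop_mult_right UU')
    moreover have "L2 (adj (U t) * ?Y) \<le> norm (adj (U t)) * L2 ?Y"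
      by (rule L2_norm_mult_left[OF m(2,1)])
    moreover have "L2 (adj (U t) * ?Y) \<ge> 0" using m by (intro L2_norm_nonneg) simp
    ultimately show ?case by simp
  qed
qed

lemma noise_X: "noise \<i> X"
  unfolding noise_def
proof (intro conjI exI[of _ W] allI impI)
  show "X u \<in> M" if "t < u" for u using that by simp
  show "orth (W u)" if "t < u" for u
    unfolding W_def using that by (intro orth_scaleR orth_V) simp
  then have WM: "W u \<in> M" if "t < u" for u using that orth_M by blast
  have XW: "L2 (X u - W u) = \<bar>exp (- (u - t) / 2) - 1\<bar> / sqrt (u - t)" if "t < u" for u
  proof -
    have "X u - W u = ((exp (- (u - t) / 2) - 1) / sqrt (u - t)) *\<^sub>R 1"
      by (simp add: X_def W_def scaleR_diff_right diff_divide_distrib scaleR_diff_left)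
    then show ?thesis using that by (simp add: L2_norm_scaleR)
  qed
  show XW0: "((\<lambda>u. L2 (X u - W u)) \<longlongrightarrow> 0) (at_right t)"
  proof (rule Lim_transform_eventually[OF exp_quotient_sqrt])
    show "\<forall>\<^sub>F u in at_right t. \<bar>exp (- (u - t) / 2) - 1\<bar> / sqrt (u - t) = L2 (X u - W u)"
      using eventually_gt[of t] by eventually_elim (simp only: XW)
  qed
  show "((\<lambda>u. L2 (W u - scale_bop \<i> (gauss t u))) \<longlongrightarrow> 0) (at_right t)"
  proof (rule Lim_null_comparison)
    show "((\<lambda>u. L2 (X u - scale_bop \<i> (gauss t u)) + L2 (X u - W u)) \<longlongrightarrow> 0) (at_right t)"
      using tendsto_add[OF X_gauss XW0] by simp
    show "\<forall>\<^sub>F u in at_right t. norm (L2 (W u - scale_bop \<i> (gauss t u)))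
        \<le> L2 (X u - scale_bop \<i> (gauss t u)) + L2 (X u - W u)"
      using eventually_gt[of t]
    proof eventually_elim
      case (elim u)
      have m: "X u - scale_bop \<i> (gauss t u) \<in> M" "X u - W u \<in> M" "W u - scale_bop \<i> (gauss t u) \<in> M"
        using elim t WM[OF elim] by simp_all
      have "W u - scale_bop \<i> (gauss t u) = (X u - scale_bop \<i> (gauss t u)) - (X u - W u)" by simp
      then show ?case
        using L2_norm_triangle_diff[OF m(1,2)] L2_norm_nonneg[OF m(3)] by simp
    qed
  qed
qed

text \<open>\<open>gauss\<close> is self-adjoint and \<open>orth\<close> is stable under
  \<open>adj\<close>, so only the coefficient is conjugated.\<close>

lemma noise_adj:
  assumes "noise e Y"
  shows "noise (cnj e) (\<lambda>u. adj (Y u))"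
proof -
  obtain w where w: "\<And>u. u > t \<Longrightarrow> orth (w u)"
    "((\<lambda>u. L2 (Y u - w u)) \<longlongrightarrow> 0) (at_right t)"
    "((\<lambda>u. L2 (w u - scale_bop e (gauss t u))) \<longlongrightarrow> 0) (at_right t)"
    using assms by (auto simp: noise_def)
  have YM: "Y u \<in> M" if "t < u" for u using assms that by (simp add: noise_def)
  have "\<forall>\<^sub>F u in at_right t. L2 (Y u - w u) = L2 (adj (Y u) - adj (w u))"
    using eventually_gt[of t]
  proof eventually_elim
    case (elim u)
    then show ?case using L2_norm_adj[of "Y u - w u"] YM orth_M[OF w(1)] by simp
  qed
  from Lim_transform_eventually[OF w(2) this]
  have 1: "((\<lambda>u. L2 (adj (Y u) - adj (w u))) \<longlongrightarrow> 0) (at_right t)" .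
  have "\<forall>\<^sub>F u in at_right t. L2 (w u - scale_bop e (gauss t u))
      = L2 (adj (w u) - scale_bop (cnj e) (gauss t u))"
    using eventually_gt[of t]
  proof eventually_elim
    case (elim u)
    then show ?case
      using L2_norm_adj[of "w u - scale_bop e (gauss t u)"] orth_M[OF w(1)] t
      by (simp add: adj_gauss)
  qed
  from Lim_transform_eventually[OF w(3) this]
  have 2: "((\<lambda>u. L2 (adj (w u) - scale_bop (cnj e) (gauss t u))) \<longlongrightarrow> 0) (at_right t)" .
  show ?thesis
    unfolding noise_def
    by (intro conjI allI impI exI[of _ "\<lambda>u. adj (w u)"] 1 2 orth_adj w(1) adj_closed YM)
qed

lemma noise_adj_X: "noise (- \<i>) (\<lambda>u. adj (X u))"
  using noise_adj[OF noise_X] by simp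

lemma trace_V_minus_one:
  assumes "a \<in> sum_algebra" "t \<le> u"
  shows "\<tau> (a * (V u - 1)) = of_real (exp (- (u - t) / 2) - 1) * \<tau> a"
    and "\<tau> (a * adj (V u - 1)) = of_real (exp (- (u - t) / 2) - 1) * \<tau> a"
proof -
  have m: "a \<in> M" "V u \<in> M" using assms sum_algebra_M t by auto
  define c where "c = exp (- (u - t) / 2)"
  have o: "orth (V u - c *\<^sub>R 1)" unfolding c_def by (rule orth_V[OF assms(2)])
  show "\<tau> (a * (V u - 1)) = of_real (exp (- (u - t) / 2) - 1) * \<tau> a"
    using orth_trace[OF assms(1) o] m unfolding c_def[symmetric]
    by (simp add: right_diff_distrib trace_linear left_diff_distrib)
  show "\<tau> (a * adj (V u - 1)) = of_real (exp (- (u - t) / 2) - 1) * \<tau> a"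
    using orth_trace[OF assms(1) orth_adj[OF o]] m unfolding c_def[symmetric]
    by (simp add: right_diff_distrib trace_linear left_diff_distrib)
qed

section \<open>Limits of the quadratic terms and the right derivative\<close>

definition \<mu> :: "nat \<Rightarrow> complex" where "\<mu> k = \<tau> (A ^ k)"
text \<open>Words of odd length, with an extra \<open>R'\<close> or \<open>S\<close>; cyclicity will
  collapse them to the trace of \<open>R\<close> or \<open>S\<close>.\<close>

definition \<rho> :: "nat \<Rightarrow> complex" where "\<rho> k = \<tau> (A ^ k * R')"
definition \<sigma> :: "nat \<Rightarrow> complex" where "\<sigma> k = \<tau> (S * A ^ k)"

lemma trace_S_A_R': "\<tau> (S * A ^ k * R') = \<mu> (Suc k)"
  using tracial[of S "A ^ k * R'"] by (simp add: \<mu>_def A_def mult.assoc power_Suc2 del: power_Suc)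

text \<open>The part of \<open>E u\<close> linear in \<open>X u\<close> and its adjoint. What is
  left has the extra factor \<open>adj (V u - 1)\<close>, which tends to 0 in norm while
  \<open>X u\<close> stays bounded in \<open>L2\<close>.\<close>

definition D :: "real \<Rightarrow> 'h bop" where "D u = R' * X u * S + R' * S * adj (X u)"
definition E :: "real \<Rightarrow> 'h bop" where "E u = (1 / sqrt (u - t)) *\<^sub>R (Q u - A)"

lemma D_M [simp]: "t < u \<Longrightarrow> D u \<in> M"
  by (simp add: D_def)

lemma E_M [simp]: "t < u \<Longrightarrow> E u \<in> M"
  using t by (simp add: E_def)

lemma Q_minus_A: "Q u - A = R' * (V u - 1) * S + R' * S * adj (V u - 1) + R' * (V u - 1) * S * adj (V u - 1)"
  by (simp add: Q_def A_def algebra_simps)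

lemma E_minus_D: "E u - D u = R' * X u * S * adj (V u - 1)"
  unfolding E_def Q_minus_A D_def X_def
  by (simp add: scaleR_add_right del: adj_diff)

lemma X_bound: "\<forall>\<^sub>F u in at_right t. L2 (X u) \<le> 2"
  using order_tendstoD(2)[OF X_gauss, of 1, simplified] eventually_gt[of t]
proof eventually_elim
  case (elim u)
  have "L2 (X u) \<le> L2 (X u - scale_bop \<i> (gauss t u)) + L2 (scale_bop \<i> (gauss t u))"
    using elim t by (intro L2_norm_bound_shift) simp_all
  then show ?case using elim t by (simp add: L2_norm_scale L2_norm_gauss)
qed

lemma V_tendsto: "(V \<longlongrightarrow> 1) (at_right t)"
proof -
  have "((\<lambda>u. adj (U t) * U u) \<longlongrightarrow> adj (U t) * U t) (at_right t)"
    by (intro tendsto_intros tendsto_U_right t)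
  then show ?thesis by (simp add: V_def[abs_def] UU)
qed

lemma Q_tendsto: "(Q \<longlongrightarrow> A) (at_right t)"
proof -
  have "((\<lambda>u. R' * V u * S * adj (V u)) \<longlongrightarrow> R' * 1 * S * adj 1) (at_right t)"
    by (intro tendsto_intros V_tendsto bounded_linear.tendsto[OF bounded_linear_adj])
  then show ?thesis by (simp add: Q_def[abs_def] A_def)
qed

lemma E_approx_D: "((\<lambda>u. L2 (E u - D u)) \<longlongrightarrow> 0) (at_right t)"
proof (rule Lim_null_comparison)
  have "((\<lambda>u. norm R' * 2 * norm S * norm (V u - 1)) \<longlongrightarrow> norm R' * 2 * norm S * norm (1 - 1 :: 'h bop)) (at_right t)"
    by (intro tendsto_intros V_tendsto)
  then show "((\<lambda>u. norm R' * 2 * norm S * norm (V u - 1)) \<longlongrightarrow> 0) (at_right t)" by simp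
  show "\<forall>\<^sub>F u in at_right t. norm (L2 (E u - D u)) \<le> norm R' * 2 * norm S * norm (V u - 1)"
    using X_bound eventually_gt[of t]
  proof eventually_elim
    case (elim u)
    have m: "V u - 1 \<in> M" "X u \<in> M" using elim t by simp_all
    have "L2 (R' * X u * S * adj (V u - 1)) \<le> L2 (R' * X u * S) * norm (V u - 1)"
      using L2_norm_mult_right[of "R' * X u * S" "adj (V u - 1)"] m by (simp del: adj_diff)
    also have "\<dots> \<le> L2 (R' * X u) * norm S * norm (V u - 1)"
      using m by (intro mult_right_mono L2_norm_mult_right) simp_all
    also have "\<dots> \<le> norm R' * L2 (X u) * norm S * norm (V u - 1)"
      using m by (intro mult_right_mono L2_norm_mult_left) simp_all
    also have "\<dots> \<le> norm R' * 2 * norm S * norm (V u - 1)"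
      using elim by (intro mult_right_mono mult_left_mono) simp_all
    finally show ?case
      using L2_norm_nonneg[of "R' * X u * S * adj (V u - 1)"] m by (simp add: E_minus_D del: adj_diff)
  qed
qed

text \<open>The limit of \<open>\<tau> (A ^ k * D u * A ^ j * D u)\<close>. The mixed products of
  \<open>X u\<close> and its adjoint carry the sign of \<open>\<i> * - \<i> = 1\<close>; the two
  unmixed ones carry \<open>\<i> * \<i> = - 1\<close> and coincide, whence the factor 2.\<close>

definition m :: "nat \<Rightarrow> nat \<Rightarrow> complex"
  where "m k j = \<rho> k * \<sigma> (Suc j) + \<sigma> (Suc k) * \<rho> j - 2 * \<mu> (Suc k) * \<mu> (Suc j)"

lemma D_pair_limit: "((\<lambda>u. \<tau> (A ^ k * D u * A ^ j * D u)) \<longlongrightarrow> m k j) (at_right t)"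
proof -
  note w = words_sum_algebra
  have 1: "((\<lambda>u. \<tau> ((S * A ^ k * R') * X u * (S * A ^ j * R') * X u)) \<longlongrightarrow>
      \<i> * \<i> * \<tau> (S * A ^ k * R') * \<tau> (S * A ^ j * R')) (at_right t)"
    by (rule noise_pair[OF noise_X noise_X w(4) w(4)])
  have 2: "((\<lambda>u. \<tau> ((A ^ k * R') * X u * (S * A ^ Suc j) * adj (X u))) \<longlongrightarrow>
      \<i> * - \<i> * \<tau> (A ^ k * R') * \<tau> (S * A ^ Suc j)) (at_right t)"
    by (rule noise_pair[OF noise_X noise_adj_X w(2) w(3)])
  have 3: "((\<lambda>u. \<tau> ((S * A ^ Suc k) * adj (X u) * (A ^ j * R') * X u)) \<longlongrightarrow>
      - \<i> * \<i> * \<tau> (S * A ^ Suc k) * \<tau> (A ^ j * R')) (at_right t)"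
    by (rule noise_pair[OF noise_adj_X noise_X w(3) w(2)])
  have 4: "((\<lambda>u. \<tau> (A ^ Suc k * adj (X u) * A ^ Suc j * adj (X u))) \<longlongrightarrow>
      - \<i> * - \<i> * \<tau> (A ^ Suc k) * \<tau> (A ^ Suc j)) (at_right t)"
    by (rule noise_pair[OF noise_adj_X noise_adj_X w(1) w(1)])
  have "((\<lambda>u. \<tau> ((S * A ^ k * R') * X u * (S * A ^ j * R') * X u)
      + \<tau> ((A ^ k * R') * X u * (S * A ^ Suc j) * adj (X u))
      + \<tau> ((S * A ^ Suc k) * adj (X u) * (A ^ j * R') * X u)
      + \<tau> (A ^ Suc k * adj (X u) * A ^ Suc j * adj (X u))) \<longlongrightarrow>
      \<i> * \<i> * \<tau> (S * A ^ k * R') * \<tau> (S * A ^ j * R') + \<i> * - \<i> * \<tau> (A ^ k * R') * \<tau> (S * A ^ Suc j)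
      + - \<i> * \<i> * \<tau> (S * A ^ Suc k) * \<tau> (A ^ j * R') + - \<i> * - \<i> * \<tau> (A ^ Suc k) * \<tau> (A ^ Suc j)) (at_right t)"
    by (intro tendsto_add 1 2 3 4)
  moreover have "\<forall>\<^sub>F u in at_right t. \<tau> ((S * A ^ k * R') * X u * (S * A ^ j * R') * X u)
      + \<tau> ((A ^ k * R') * X u * (S * A ^ Suc j) * adj (X u))
      + \<tau> ((S * A ^ Suc k) * adj (X u) * (A ^ j * R') * X u)
      + \<tau> (A ^ Suc k * adj (X u) * A ^ Suc j * adj (X u)) = \<tau> (A ^ k * D u * A ^ j * D u)"
    using eventually_gt[of t]
  proof eventually_elim
    case (elim u)
    have A_Suc: "A ^ Suc i = A ^ i * R' * S" for i
      by (simp add: A_def power_Suc2 mult.assoc del: power_Suc)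
    have XM: "X u \<in> M" using elim by simp
    \<comment> \<open>A trailing \<open>S\<close> is moved to the front by traciality, so that each
      of the four products has the shape required by \<open>noise_pair\<close>.\<close>
    have "A ^ k * D u * A ^ j * D u
        = (A ^ k * R' * X u * S * A ^ j * R' * X u) * S
        + (A ^ k * R') * X u * (S * A ^ Suc j) * adj (X u)
        + (A ^ Suc k * adj (X u) * (A ^ j * R') * X u) * S
        + A ^ Suc k * adj (X u) * A ^ Suc j * adj (X u)"
      unfolding D_def A_Suc by (simp add: distrib_left distrib_right mult.assoc)
    moreover have "\<tau> ((A ^ k * R' * X u * S * A ^ j * R' * X u) * S)
        = \<tau> ((S * A ^ k * R') * X u * (S * A ^ j * R') * X u)"
      using tracial[of "A ^ k * R' * X u * S * A ^ j * R' * X u" S] XM by (simp add: mult.assoc)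
    moreover have "\<tau> ((A ^ Suc k * adj (X u) * (A ^ j * R') * X u) * S)
        = \<tau> ((S * A ^ Suc k) * adj (X u) * (A ^ j * R') * X u)"
      using tracial[of "A ^ Suc k * adj (X u) * (A ^ j * R') * X u" S] XM
      by (simp add: mult.assoc del: power_Suc)
    ultimately show ?case
      using XM by (simp add: trace_linear del: power_Suc)
  qed
  ultimately have "((\<lambda>u. \<tau> (A ^ k * D u * A ^ j * D u)) \<longlongrightarrow>
      \<i> * \<i> * \<tau> (S * A ^ k * R') * \<tau> (S * A ^ j * R') + \<i> * - \<i> * \<tau> (A ^ k * R') * \<tau> (S * A ^ Suc j)
      + - \<i> * \<i> * \<tau> (S * A ^ Suc k) * \<tau> (A ^ j * R') + - \<i> * - \<i> * \<tau> (A ^ Suc k) * \<tau> (A ^ Suc j)) (at_right t)"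
    by (rule Lim_transform_eventually)
  then show ?thesis
    unfolding trace_S_A_R' by (simp add: m_def \<mu>_def[symmetric] \<rho>_def[symmetric] \<sigma>_def[symmetric] mult_ac del: power_Suc)
qed

text \<open>\<open>P\<close> varies because the exact expansion still contains powers of
  \<open>Q u\<close>, which are the third and higher order terms in disguise.\<close>

lemma E_pair_limit:
  assumes P: "(P \<longlongrightarrow> A ^ k) (at_right t)" "\<And>u. t < u \<Longrightarrow> P u \<in> M"
  shows "((\<lambda>u. \<tau> (P u * E u * A ^ j * E u)) \<longlongrightarrow> m k j) (at_right t)"
proof (rule tendsto_trace_quad[OF E_approx_D E_approx_D P(1) tendsto_const _ _ _ D_pair_limit])
  show "\<forall>\<^sub>F u in at_right t. E u \<in> M \<and> D u \<in> M \<and> E u \<in> M \<and> D u \<in> M \<and> P u \<in> M \<and> A ^ j \<in> M \<and>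
      L2 (D u) \<le> norm R' * 2 * norm S + norm (R' * S) * 2 \<and>
      L2 (D u) \<le> norm R' * 2 * norm S + norm (R' * S) * 2"
    using X_bound eventually_gt[of t]
  proof eventually_elim
    case (elim u)
    have XM: "X u \<in> M" using elim by simp
    have "L2 (D u) \<le> L2 (R' * X u * S) + L2 (R' * S * adj (X u))"
      unfolding D_def using XM by (intro L2_norm_triangle) simp_all
    moreover have "L2 (R' * S * adj (X u)) \<le> norm (R' * S) * 2"
      using L2_norm_mult_left[of "R' * S" "adj (X u)"] XM
        mult_left_mono[OF elim(1), of "norm (R' * S)"] by simp
    moreover have "L2 (R' * X u * S) \<le> L2 (R' * X u) * norm S"
      using XM by (intro L2_norm_mult_right) simp_all
    moreover have "L2 (R' * X u) * norm S \<le> norm R' * 2 * norm S"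
      using L2_norm_mult_left[of R' "X u"] XM mult_left_mono[OF elim(1), of "norm R'"]
      by (intro mult_right_mono) simp_all
    ultimately have "L2 (D u) \<le> norm R' * 2 * norm S + norm (R' * S) * 2" by linarith
    then show ?case using elim P(2) by simp
  qed
qed simp_all

text \<open>The two linear terms of \<open>Q u - A\<close> each give the drift \<open>- 1/2\<close>.
  The bilinear one survives at order \<open>u - t\<close> with the sign
  \<open>\<i> * - \<i> = 1\<close>, the \<open>S\<close> between its increments being averaged to a
  scalar.\<close>

lemma first_order_limit:
  "((\<lambda>u. \<tau> (A ^ n * (Q u - A)) / of_real (u - t)) \<longlongrightarrow> \<rho> n * \<sigma> 0 - \<mu> (Suc n)) (at_right t)"
proof -
  let ?c = "\<lambda>u. complex_of_real ((exp (- (u - t) / 2) - 1) / (u - t))"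
  have "((\<lambda>u. \<tau> ((A ^ n * R') * X u * S * adj (X u))) \<longlongrightarrow> \<i> * - \<i> * \<tau> (A ^ n * R') * \<tau> S) (at_right t)"
    by (rule noise_pair[OF noise_X noise_adj_X words_sum_algebra(2,6)])
  then have 1: "((\<lambda>u. \<tau> ((A ^ n * R') * X u * S * adj (X u))) \<longlongrightarrow> \<rho> n * \<sigma> 0) (at_right t)"
    by (simp add: \<rho>_def \<sigma>_def)
  have "((\<lambda>u. \<tau> ((A ^ n * R') * X u * S * adj (X u)) + 2 * (?c u * \<mu> (Suc n))) \<longlongrightarrow>
      \<rho> n * \<sigma> 0 + 2 * (of_real (- 1 / 2) * \<mu> (Suc n))) (at_right t)"
    by (intro tendsto_add 1 tendsto_mult tendsto_const tendsto_of_real exp_difference_quotient)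
  moreover have "\<forall>\<^sub>F u in at_right t. \<tau> ((A ^ n * R') * X u * S * adj (X u)) + 2 * (?c u * \<mu> (Suc n))
      = \<tau> (A ^ n * (Q u - A)) / of_real (u - t)"
    using eventually_gt[of t]
  proof eventually_elim
    case (elim u)
    define Y where "Y = V u - 1"
    have YM: "Y \<in> M" using elim t by (simp add: Y_def)
    have "A ^ n * (Q u - A) = (A ^ n * R' * Y) * S + A ^ Suc n * adj Y + A ^ n * R' * Y * S * adj Y"
      unfolding Q_minus_A Y_def[symmetric]
      by (simp add: distrib_left A_def power_Suc2 mult.assoc del: power_Suc)
    then have "\<tau> (A ^ n * (Q u - A))
        = \<tau> ((A ^ n * R' * Y) * S) + \<tau> (A ^ Suc n * adj Y) + \<tau> (A ^ n * R' * Y * S * adj Y)"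
      using YM by (simp add: trace_linear del: power_Suc)
    also have "\<tau> ((A ^ n * R' * Y) * S) = \<tau> (S * A ^ n * R' * Y)"
      using tracial[of "A ^ n * R' * Y" S] YM by (simp add: mult.assoc)
    also have "\<dots> = of_real (exp (- (u - t) / 2) - 1) * \<mu> (Suc n)"
      unfolding Y_def using trace_V_minus_one(1)[OF words_sum_algebra(4)] elim by (simp only: trace_S_A_R' less_imp_le)
    also have "\<tau> (A ^ Suc n * adj Y) = of_real (exp (- (u - t) / 2) - 1) * \<mu> (Suc n)"
      unfolding Y_def using trace_V_minus_one(2)[OF words_sum_algebra(1)] elim by (simp only: \<mu>_def less_imp_le)
    finally have eq: "\<tau> (A ^ n * (Q u - A)) = of_real (exp (- (u - t) / 2) - 1) * \<mu> (Suc n)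
        + of_real (exp (- (u - t) / 2) - 1) * \<mu> (Suc n) + \<tau> (A ^ n * R' * Y * S * adj Y)" .
    have "(A ^ n * R') * X u * S * adj (X u) = (1 / (u - t)) *\<^sub>R (A ^ n * R' * Y * S * adj Y)"
      unfolding X_def Y_def[symmetric] using elim by simp
    then have "\<tau> ((A ^ n * R') * X u * S * adj (X u)) = \<tau> (A ^ n * R' * Y * S * adj Y) / of_real (u - t)"
      using YM by (simp add: trace_scaleR)
    then show ?case
      unfolding eq by (simp add: add_divide_distrib)
  qed
  ultimately have "((\<lambda>u. \<tau> (A ^ n * (Q u - A)) / of_real (u - t)) \<longlongrightarrow>
      \<rho> n * \<sigma> 0 + 2 * (of_real (- 1 / 2) * \<mu> (Suc n))) (at_right t)"
    by (rule Lim_transform_eventually)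
  then show ?thesis by simp
qed

text \<open>Telescoping twice and rotating the remaining power of \<open>Q u\<close> to the front by
  traciality; the two factors \<open>E u\<close> use up the denominator \<open>u - t\<close>
  exactly.\<close>

lemma trace_Q_expansion:
  assumes u: "t < u"
  shows "(\<tau> (Q u ^ Suc p) - \<tau> (A ^ Suc p)) / of_real (u - t) =
    (\<Sum>i<Suc p. \<tau> (A ^ p * (Q u - A)) / of_real (u - t)
      + (\<Sum>j<p - i. \<tau> (Q u ^ (p - i - 1 - j) * A ^ i * E u * A ^ j * E u)))"
proof -
  define K where "K = Q u - A"
  have QM: "Q u \<in> M" using u t by simp
  have KM: "K \<in> M" using QM by (simp add: K_def)
  have EE: "\<tau> (a * E u * b * E u) = \<tau> (a * K * b * K) / of_real (u - t)" if "a \<in> M" "b \<in> M" for a b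
  proof -
    have "a * E u * b * E u = (1 / (u - t)) *\<^sub>R (a * K * b * K)"
      unfolding E_def K_def[symmetric] using u by simp
    then show ?thesis using that KM by (simp add: trace_scaleR)
  qed
  have "\<tau> (Q u ^ Suc p) - \<tau> (A ^ Suc p) = \<tau> (Q u ^ Suc p - A ^ Suc p)"
    using QM by (simp add: trace_linear del: power_Suc)
  also have "\<dots> = (\<Sum>i<Suc p. \<tau> (A ^ i * K * Q u ^ (p - i)))"
    unfolding power_diff_telescope using QM by (subst trace_sum) (simp_all add: K_def)
  also have "\<dots> = (\<Sum>i<Suc p. \<tau> (A ^ p * K)
      + (\<Sum>j<p - i. \<tau> (Q u ^ (p - i - 1 - j) * A ^ i * K * A ^ j * K)))"
  proof (rule sum.cong[OF refl])
    fix i assume "i \<in> {..<Suc p}"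
    then have i: "i \<le> p" by simp
    have "Q u ^ (p - i) = A ^ (p - i) + (\<Sum>j<p - i. A ^ j * K * Q u ^ (p - i - 1 - j))"
      using power_diff_telescope[of "Q u" "p - i" A] by (simp add: K_def algebra_simps)
    then have "A ^ i * K * Q u ^ (p - i)
        = A ^ i * K * A ^ (p - i) + (\<Sum>j<p - i. A ^ i * K * A ^ j * K * Q u ^ (p - i - 1 - j))"
      by (simp add: distrib_left sum_distrib_left mult.assoc)
    then have "\<tau> (A ^ i * K * Q u ^ (p - i))
        = \<tau> (A ^ i * K * A ^ (p - i)) + (\<Sum>j<p - i. \<tau> (A ^ i * K * A ^ j * K * Q u ^ (p - i - 1 - j)))"
      using KM QM by (simp add: trace_linear trace_sum)
    also have "\<tau> (A ^ i * K * A ^ (p - i)) = \<tau> (A ^ p * K)"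
      using tracial[of "A ^ i * K" "A ^ (p - i)"] KM i by (simp flip: mult.assoc power_add)
    also have "(\<Sum>j<p - i. \<tau> (A ^ i * K * A ^ j * K * Q u ^ (p - i - 1 - j)))
        = (\<Sum>j<p - i. \<tau> (Q u ^ (p - i - 1 - j) * A ^ i * K * A ^ j * K))"
    proof (rule sum.cong[OF refl])
      fix j
      show "\<tau> (A ^ i * K * A ^ j * K * Q u ^ (p - i - 1 - j)) = \<tau> (Q u ^ (p - i - 1 - j) * A ^ i * K * A ^ j * K)"
        using tracial[of "A ^ i * K * A ^ j * K" "Q u ^ (p - i - 1 - j)"] KM QM by (simp add: mult.assoc)
    qed
    finally show "\<tau> (A ^ i * K * Q u ^ (p - i)) = \<tau> (A ^ p * K)
        + (\<Sum>j<p - i. \<tau> (Q u ^ (p - i - 1 - j) * A ^ i * K * A ^ j * K))" .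
  qed
  finally have "\<tau> (Q u ^ Suc p) - \<tau> (A ^ Suc p) = (\<Sum>i<Suc p. \<tau> (A ^ p * K)
      + (\<Sum>j<p - i. \<tau> (Q u ^ (p - i - 1 - j) * A ^ i * K * A ^ j * K)))" .
  then show ?thesis
    using QM by (simp only: sum_divide_distrib add_divide_distrib EE mult_closed power_closed A_M K_def[symmetric])
qed

lemma Q_right_derivative:
  "((\<lambda>u. (\<tau> (Q u ^ Suc p) - \<tau> (A ^ Suc p)) / of_real (u - t)) \<longlongrightarrow>
    of_nat (Suc p) * (\<rho> p * \<sigma> 0 - \<mu> (Suc p)) + of_nat (Suc p) / 2 * (\<Sum>j<p. m (p - 1 - j) j)) (at_right t)"
proof -
  let ?g = "\<lambda>j. m (p - 1 - j) j"
  have pair: "((\<lambda>u. \<tau> (Q u ^ (p - i - 1 - j) * A ^ i * E u * A ^ j * E u)) \<longlongrightarrow> ?g j) (at_right t)"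
    if "j < p - i" for i j
  proof (rule E_pair_limit)
    have "((\<lambda>u. Q u ^ (p - i - 1 - j) * A ^ i) \<longlongrightarrow> A ^ (p - i - 1 - j) * A ^ i) (at_right t)"
      by (intro tendsto_intros Q_tendsto)
    \<comment> \<open>The exponents add up to \<open>p - 1 - j\<close>, free of \<open>i\<close>, so
      the limit depends on \<open>j\<close> alone and \<open>i\<close> only bounds the range of
      \<open>j\<close>.\<close>
    moreover have "A ^ (p - i - 1 - j) * A ^ i = A ^ (p - 1 - j)"
      using that by (simp flip: power_add)
    ultimately show "((\<lambda>u. Q u ^ (p - i - 1 - j) * A ^ i) \<longlongrightarrow> A ^ (p - 1 - j)) (at_right t)" by simp
  qed (use t in simp)
  have "((\<lambda>u. \<Sum>i<Suc p. \<tau> (A ^ p * (Q u - A)) / of_real (u - t)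
      + (\<Sum>j<p - i. \<tau> (Q u ^ (p - i - 1 - j) * A ^ i * E u * A ^ j * E u))) \<longlongrightarrow>
      (\<Sum>i<Suc p. (\<rho> p * \<sigma> 0 - \<mu> (Suc p)) + (\<Sum>j<p - i. ?g j))) (at_right t)"
    by (intro tendsto_sum tendsto_add first_order_limit pair) simp
  moreover have "\<forall>\<^sub>F u in at_right t. (\<Sum>i<Suc p. \<tau> (A ^ p * (Q u - A)) / of_real (u - t)
      + (\<Sum>j<p - i. \<tau> (Q u ^ (p - i - 1 - j) * A ^ i * E u * A ^ j * E u)))
      = (\<tau> (Q u ^ Suc p) - \<tau> (A ^ Suc p)) / of_real (u - t)"
    using eventually_gt[of t] by eventually_elim (simp only: trace_Q_expansion)
  ultimately have "((\<lambda>u. (\<tau> (Q u ^ Suc p) - \<tau> (A ^ Suc p)) / of_real (u - t)) \<longlongrightarrow>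
      (\<Sum>i<Suc p. (\<rho> p * \<sigma> 0 - \<mu> (Suc p)) + (\<Sum>j<p - i. ?g j))) (at_right t)"
    by (rule Lim_transform_eventually)
  moreover have "(\<Sum>i<Suc p. (\<rho> p * \<sigma> 0 - \<mu> (Suc p)) + (\<Sum>j<p - i. ?g j))
      = of_nat (Suc p) * (\<rho> p * \<sigma> 0 - \<mu> (Suc p)) + of_nat (Suc p) / 2 * (\<Sum>j<p. ?g j)"
  proof -
    \<comment> \<open>\<open>m\<close> is symmetric in its arguments, so the triangular sum is half
      of \<open>Suc p\<close> complete rows.\<close>
    have "2 * (\<Sum>i<Suc p. \<Sum>j<p - i. ?g j) = of_nat (Suc p) * (\<Sum>j<p. ?g j)"
      by (rule sum_triangle_symmetric) (simp add: m_def mult_ac)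
    then have "(\<Sum>i<Suc p. \<Sum>j<p - i. ?g j) = of_nat (Suc p) / 2 * (\<Sum>j<p. ?g j)"
      by (simp only: times_divide_eq_left eq_divide_eq_numeral1 mult.commute) simp
    then show ?thesis
      by (simp only: sum.distrib sum_constant card_lessThan)
  qed
  ultimately show ?thesis by simp
qed


subsection \<open>The differential equations\<close>

lemma trace_conjugate:
  assumes "x \<in> M"
  shows "\<tau> ((U t * x * adj (U t)) ^ n) = \<tau> (x ^ n)"
proof -
  have "(U t * x * adj (U t)) ^ n = U t * x ^ n * adj (U t)"
    by (induction n) (simp_all add: UU UU' mult.assoc)
  moreover have "\<tau> (U t * x ^ n * adj (U t)) = \<tau> (x ^ n)"
    using tracial[of "U t * x ^ n" "adj (U t)"] assms t by (simp add: UU')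
  ultimately show ?thesis by simp
qed

lemma moment_Q:
  assumes "t \<le> u"
  shows "moment n u = \<tau> (Q u ^ n)"
proof -
  have "R * U u * S * adj (U u) = U t * Q u * adj (U t)"
    by (simp add: Q_def R'_def V_def mult.assoc UU UU')
  then show ?thesis
    using trace_conjugate[of "Q u" n] assms t by (simp add: moment_def)
qed

lemma moment_\<mu>: "moment n t = \<mu> n"
  using moment_Q[of t n] by (simp add: Q_def V_def UU \<mu>_def A_def)

text \<open>Cyclicity brings the two outer copies of \<open>R'\<close> together and they cancel;
  with \<open>\<sigma>_Suc\<close> an odd word is peeled from both ends down to its middle
  letter.\<close>

lemma \<rho>_Suc: "\<rho> (Suc k) = \<sigma> k"
proof -
  have "A ^ Suc k * R' = R' * (S * A ^ k * R')"
    by (simp add: A_def mult.assoc)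
  then have "\<rho> (Suc k) = \<tau> (S * A ^ k * R' * R')"
    using tracial[of R' "S * A ^ k * R'"] by (simp add: \<rho>_def)
  then show ?thesis by (simp add: mult.assoc R'_props \<sigma>_def)
qed

lemma \<sigma>_Suc: "\<sigma> (Suc k) = \<rho> k"
proof -
  have "S * A ^ Suc k = S * (A ^ k * R') * S"
    by (simp add: A_def power_Suc2 mult.assoc del: power_Suc)
  then have "\<sigma> (Suc k) = \<tau> (S * (S * (A ^ k * R')))"
    using tracial[of "S * (A ^ k * R')" S] by (simp add: \<sigma>_def del: power_Suc)
  then show ?thesis
    using S_props by (simp add: \<rho>_def flip: mult.assoc)
qed

lemma \<rho>\<sigma>_parity:
  "\<rho> k = (if even k then \<tau> R else \<tau> S) \<and> \<sigma> k = (if even k then \<tau> S else \<tau> R)"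
proof (induction k)
  case 0
  have "\<tau> R' = \<tau> R"
    using tracial[of "adj (U t)" "R * U t"] t by (simp add: R'_def mult.assoc UU)
  then show ?case by (simp add: \<rho>_def \<sigma>_def)
qed (simp add: \<rho>_Suc \<sigma>_Suc)

text \<open>For even \<open>p\<close> the indices \<open>p - 1 - j\<close> and \<open>j\<close> have
  opposite parity, so all products are \<open>\<tau> R * \<tau> S\<close>. For
  \<open>p = 2 * k + 1\<close> they have equal parity, which gives \<open>k + 1\<close> squares of
  \<open>\<tau> R\<close> and \<open>k\<close> of \<open>\<tau> S\<close>. In both cases the first
  order term \<open>\<rho> p * \<sigma> 0\<close> supplies the missing summand.\<close>

lemma parity_sum:
  "(\<Sum>j<p. \<rho> (p - 1 - j) * \<rho> j) + \<rho> p * \<sigma> 0 =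
    (if odd (Suc p) then of_nat (Suc p) * (\<tau> R * \<tau> S)
     else of_nat (Suc p) * (((\<tau> R)\<^sup>2 + (\<tau> S)\<^sup>2) / 2))"
proof -
  have \<sigma>0: "\<sigma> 0 = \<tau> S" and \<rho>: "\<And>k. \<rho> k = (if even k then \<tau> R else \<tau> S)"
    using \<rho>\<sigma>_parity by auto
  show ?thesis
  proof (cases "even p")
    case True
    have "\<rho> (p - 1 - j) * \<rho> j = \<tau> R * \<tau> S" if "j < p" for j
    proof -
      have "p = (p - 1 - j) + j + 1" using that by simp
      then have "even (p - 1 - j) \<longleftrightarrow> odd j" using True by presburger
      then show ?thesis by (simp add: \<rho> mult.commute)
    qed
    then have "(\<Sum>j<p. \<rho> (p - 1 - j) * \<rho> j) = of_nat p * (\<tau> R * \<tau> S)" by simp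
    then show ?thesis using True by (simp add: \<sigma>0 \<rho> algebra_simps)
  next
    case False
    then obtain k where p: "p = 2 * k + 1" by (elim oddE)
    have "\<rho> (p - 1 - j) * \<rho> j = (if even j then (\<tau> R)\<^sup>2 else (\<tau> S)\<^sup>2)" if "j < p" for j
    proof -
      have "p = (p - 1 - j) + j + 1" using that by simp
      then have "even (p - 1 - j) \<longleftrightarrow> even j" using False by presburger
      then show ?thesis by (simp add: \<rho> power2_eq_square)
    qed
    then have "(\<Sum>j<p. \<rho> (p - 1 - j) * \<rho> j) = (\<Sum>j<p. if even j then (\<tau> R)\<^sup>2 else (\<tau> S)\<^sup>2)"
      by (intro sum.cong) simp_all
    also have "\<dots> = of_nat (k + 1) * (\<tau> R)\<^sup>2 + of_nat k * (\<tau> S)\<^sup>2"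
      unfolding p by (rule sum_alternating)
    finally show ?thesis
      using False by (simp add: \<sigma>0 \<rho> p power2_eq_square algebra_simps)
  qed
qed

lemma moment_right_derivative:
  assumes n: "n \<ge> 1"
  shows "((\<lambda>u. (1 / (u - t)) *\<^sub>R (moment n u - moment n t)) \<longlongrightarrow>
    - of_nat n * moment n t - of_nat n * (\<Sum>k=1..n-1. moment k t * moment (n - k) t)
      + (if odd n then of_nat n ^ 2 * (\<tau> R * \<tau> S)
         else of_nat n ^ 2 * (((\<tau> R)\<^sup>2 + (\<tau> S)\<^sup>2) / 2))) (at_right t)"
proof -
  obtain p where p: "n = Suc p" using n by (cases n) auto
  have "\<forall>\<^sub>F u in at_right t. (\<tau> (Q u ^ Suc p) - \<tau> (A ^ Suc p)) / of_real (u - t)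
      = (1 / (u - t)) *\<^sub>R (moment n u - moment n t)"
    using eventually_gt[of t]
  proof eventually_elim
    case (elim u)
    then show ?case
      by (simp add: moment_Q[of u] moment_\<mu> p \<mu>_def scaleR_conv_of_real divide_inverse_commute
          del: power_Suc)
  qed
  from Lim_transform_eventually[OF Q_right_derivative this]
  have lim: "((\<lambda>u. (1 / (u - t)) *\<^sub>R (moment n u - moment n t)) \<longlongrightarrow>
    of_nat n * (\<rho> p * \<sigma> 0 - \<mu> n) + of_nat n / 2 * (\<Sum>j<p. m (p - 1 - j) j)) (at_right t)"
    by (simp only: p)
  \<comment> \<open>By \<open>\<sigma>_Suc\<close> both products of odd words in \<open>m\<close>
    become products of two \<open>\<rho>\<close>; the summation index \<open>k\<close> is
    \<open>Suc j\<close>.\<close>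
  have m_sum: "(\<Sum>j<p. m (p - 1 - j) j)
      = 2 * (\<Sum>j<p. \<rho> (p - 1 - j) * \<rho> j) - 2 * (\<Sum>k=1..n-1. \<mu> k * \<mu> (n - k))"
  proof -
    have "(\<Sum>k=1..n-1. \<mu> k * \<mu> (n - k)) = (\<Sum>j<p. \<mu> (Suc (p - 1 - j)) * \<mu> (Suc j))"
      by (rule sum.reindex_bij_witness[of _ Suc "\<lambda>k. k - 1"]) (auto simp: p Suc_diff_Suc Suc_diff_le mult.commute)
    then show ?thesis
      by (simp only: m_def \<sigma>_Suc sum_distrib_left flip: sum_subtractf)
        (intro sum.cong refl, simp add: algebra_simps)
  qed
  \<comment> \<open>The factor 2 in \<open>m_sum\<close> cancels the \<open>1/2\<close>. One factor
    \<open>n\<close> stands before the parity sum, which contributes the other one.\<close>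
  have "of_nat n * (\<rho> p * \<sigma> 0 - \<mu> n) + of_nat n / 2 * (\<Sum>j<p. m (p - 1 - j) j)
      = - of_nat n * \<mu> n - of_nat n * (\<Sum>k=1..n-1. \<mu> k * \<mu> (n - k))
        + of_nat n * ((\<Sum>j<p. \<rho> (p - 1 - j) * \<rho> j) + \<rho> p * \<sigma> 0)"
    unfolding m_sum by (simp add: algebra_simps)
  with lim have "((\<lambda>u. (1 / (u - t)) *\<^sub>R (moment n u - moment n t)) \<longlongrightarrow>
    - of_nat n * \<mu> n - of_nat n * (\<Sum>k=1..n-1. \<mu> k * \<mu> (n - k))
      + of_nat n * ((\<Sum>j<p. \<rho> (p - 1 - j) * \<rho> j) + \<rho> p * \<sigma> 0)) (at_right t)"
    by (simp only:)
  moreover have "of_nat n * ((\<Sum>j<p. \<rho> (p - 1 - j) * \<rho> j) + \<rho> p * \<sigma> 0)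
      = (if odd n then of_nat n ^ 2 * (\<tau> R * \<tau> S) else of_nat n ^ 2 * (((\<tau> R)\<^sup>2 + (\<tau> S)\<^sup>2) / 2))"
    unfolding parity_sum p by (simp only: power2_eq_square mult.assoc split: if_split) simp
  ultimately show ?thesis by (simp only: moment_\<mu>)
qed

end

lemma continuous_moment: "continuous_on {0..} (moment n)"
proof -
  have "continuous_on {0..} (\<lambda>t. (R * U t * S * adj (U t)) ^ n)"
    by (intro continuous_intros continuous_U bounded_linear.continuous_on[OF bounded_linear_adj])
  then show ?thesis
    unfolding moment_def[abs_def] by (rule continuous_on_trace) simp
qed

lemma moment_derivative:
  assumes "n \<ge> 1" "t \<ge> 0"
  shows "(moment n has_vector_derivative
    (- of_nat n * moment n t - of_nat n * (\<Sum>k=1..n-1. moment k t * moment (n - k) t)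
      + (if odd n then of_nat n ^ 2 * (\<tau> R * \<tau> S)
         else of_nat n ^ 2 * (((\<tau> R)\<^sup>2 + (\<tau> S)\<^sup>2) / 2)))) (at t within {0..})"
  by (rule has_vector_derivative_of_right_derivative[OF continuous_moment _ moment_right_derivative[OF _ assms(1)] assms(2)])
    (intro continuous_intros continuous_moment)

end

theorem proposition2p1:
  fixes M :: "'h::complex_hilbert_space bop set"
    and \<tau> :: "'h bop \<Rightarrow> complex"
    and R S :: "'h bop"
    and U :: "real \<Rightarrow> 'h bop"
    and \<alpha> \<beta> :: complex
    and f :: "nat \<Rightarrow> real \<Rightarrow> complex"
  assumes "wstar_probability_space M \<tau>"
    and "R \<in> M" "symmetry R" "\<tau> R = \<alpha>"
    and "S \<in> M" "symmetry S" "\<tau> S = \<beta>"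
    and "free_unitary_brownian_motion M \<tau> U"
    and "freely_independent \<tau> (U ` {0..}) {R, S}"
    and "\<And>n t. n \<ge> 1 \<Longrightarrow> t \<ge> 0 \<Longrightarrow> f n t = \<tau> ((R * U t * S * adj (U t)) ^ n)"
  shows "(\<forall>t\<ge>0. (f 1 has_vector_derivative (- f 1 t + \<alpha> * \<beta>)) (at t within {0..})) \<and>
    (\<forall>n\<ge>2. \<forall>t\<ge>0. (f n has_vector_derivative
      (- of_nat n * f n t - of_nat n * (\<Sum>k=1..n-1. f k t * f (n - k) t)
        + (if odd n then of_nat n ^ 2 * (\<alpha> * \<beta>)
           else of_nat n ^ 2 * ((\<alpha>\<^sup>2 + \<beta>\<^sup>2) / 2)))) (at t within {0..}))"
proof -
  interpret wstar_probability_space M \<tau> by fact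
  obtain F B where "filtration M F" "free_brownian_motion \<tau> F B" "free_unitary_SDE \<tau> F B U"
    using assms(8) by (auto simp: free_unitary_brownian_motion_def)
  then interpret liberation M \<tau> F B U R S
    using assms(2,3,5,6,9) by unfold_locales
  have f: "f n t = moment n t" if "n \<ge> 1" "t \<ge> 0" for n t
    using assms(10)[OF that] by (simp add: moment_def)
  have "(f n has_vector_derivative
      (- of_nat n * f n t - of_nat n * (\<Sum>k=1..n-1. f k t * f (n - k) t)
        + (if odd n then of_nat n ^ 2 * (\<alpha> * \<beta>)
           else of_nat n ^ 2 * ((\<alpha>\<^sup>2 + \<beta>\<^sup>2) / 2)))) (at t within {0..})"
    if n: "n \<ge> 1" and t: "t \<ge> 0" for n t
  proof (rule has_vector_derivative_transform)
    show "t \<in> {0..}" using t by simp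
    show "f n s = moment n s" if "s \<in> {0..}" for s using f n that by simp
    \<comment> \<open>\<open>f\<close> is specified only for positive indices; in this range both
      \<open>k\<close> and \<open>n - k\<close> are at least 1.\<close>
    have "(\<Sum>k=1..n-1. f k t * f (n - k) t) = (\<Sum>k=1..n-1. moment k t * moment (n - k) t)"
      using t by (intro sum.cong) (auto simp: f)
    then show "(moment n has_vector_derivative
      (- of_nat n * f n t - of_nat n * (\<Sum>k=1..n-1. f k t * f (n - k) t)
        + (if odd n then of_nat n ^ 2 * (\<alpha> * \<beta>)
           else of_nat n ^ 2 * ((\<alpha>\<^sup>2 + \<beta>\<^sup>2) / 2)))) (at t within {0..})"
      using moment_derivative[OF n t] f[OF n t] by (simp only: assms(4,7))
  qed
  \<comment> \<open>For \<open>n = 1\<close> the sum over \<open>k\<close> is empty and the factor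
    \<open>n^2\<close> is 1.\<close>
  from this[of 1] this show ?thesis by simp
qed

end
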